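(* Let $R$ be a Koszul $\Bbbk$-algebra and let $M$ be a linear $R$-module. Then there is a direct sum decomposition $\operatorname{Ext}^*_R(M,M)=\Delta_M\oplus \mathcal N_M$, and $\mathcal N_M$ is a (two-sided) ideal of $\operatorname{Ext}^*_R(M,M)$.
   Context: $\Bbbk$ is a field; modules are right modules. A Koszul $\Bbbk$-algebra is a graded algebra $R=R_0\oplus R_1\oplus\cdots$ with $R_0=\Bbbk\times\cdots\times\Bbbk$ such that $R_0=R/\mathfrak r$, $\mathfrak r=\bigoplus_{i>0}R_i$, is a linear $R$-module. Only graded modules having graded projective resolutions with finitely generated terms are considered. A graded module $M$ generated in degree $0$ is linear if it has a graded projective resolution $P_M^\bullet$ in which, for each $n$, the $n$-th term $P_M^n$ is generated in degree $n$ (a linear resolution). A homomorphism $f\colon M\to N$ of graded modules has degree $i$ if $f(M_k)\subseteq N_{i+k}$ for all $k$. $\operatorname{Ext}^*_R(M,M)=\bigoplus_{n\ge0}\operatorname{Ext}^n_R(M,M)$ is an algebra under the Yoneda product. It is bigraded: $\operatorname{Ext}^n_R(M,M)_i$ consists of the classes represented by degree $i$ homomorphisms $P^n_M\to M$, where $P_M^\bullet$ is a minimal graded projective resolution of $M$. Define $\Delta_M=\bigoplus_{n\ge 0}\operatorname{Ext}^n_R(M,M)_{-n}$ (the diagonal subalgebra) and $\mathcal N_M=\bigoplus_{n\ge0}\bigoplus_{i>-n}\operatorname{Ext}^n_R(M,M)_i$. *)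

theory Defs
  imports "HOL-Algebra.Module" "HOL-Algebra.QuotRing" "HOL-Algebra.Chinese_Remainder"
begin

section \<open>Graded algebras and graded right modules\<close>

record ('k, 'r) gr_algebra = "('k, 'r) module" +
  acomp :: "nat \<Rightarrow> 'r set"

text \<open>As in the library record \<open>module\<close>, the fields \<open>mult\<close> and \<open>one\<close> inherited by a module from
  \<open>ring\<close> carry no information; only the additive structure is used.\<close>

record ('r, 'm) rmodule = "'m ring" +
  act :: "'m \<Rightarrow> 'r \<Rightarrow> 'm"  (infixl "\<triangleleft>\<index>" 70)

record ('r, 'm) gr_module = "('r, 'm) rmodule" +
  mcomp :: "int \<Rightarrow> 'm set"

definition internal_sum :: "('a, 'c) ring_scheme \<Rightarrow> 'i set \<Rightarrow> ('i \<Rightarrow> 'a set) \<Rightarrow> 'a set" where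
  "internal_sum A J G = {finsum A f F | F f. finite F \<and> F \<subseteq> J \<and> (\<forall>i\<in>F. f i \<in> G i)}"

definition is_grading :: "('a, 'c) ring_scheme \<Rightarrow> ('i \<Rightarrow> 'a set) \<Rightarrow> bool" where
  "is_grading A G \<longleftrightarrow>
     (\<forall>i. additive_subgroup (G i) A) \<and>
     (\<forall>x\<in>carrier A. \<exists>!f. (\<forall>i. f i \<in> G i) \<and> finite {i. f i \<noteq> \<zero>\<^bsub>A\<^esub>} \<and>
        x = finsum A f {i. f i \<noteq> \<zero>\<^bsub>A\<^esub>})"

text \<open>The library locale \<open>algebra\<close> is restricted to commutative algebras.\<close>

locale assoc_algebra = K?: field K + R?: ring R + Module.module K R
  for K :: "('k, 'c) ring_scheme" (structure) and R :: "('k, 'r, 'd) module_scheme" (structure) +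
  assumes smult_mult_left:
      "\<lbrakk>a \<in> carrier K; x \<in> carrier R; y \<in> carrier R\<rbrakk>
        \<Longrightarrow> (a \<odot>\<^bsub>R\<^esub> x) \<otimes>\<^bsub>R\<^esub> y = a \<odot>\<^bsub>R\<^esub> (x \<otimes>\<^bsub>R\<^esub> y)"
    and smult_mult_right:
      "\<lbrakk>a \<in> carrier K; x \<in> carrier R; y \<in> carrier R\<rbrakk>
        \<Longrightarrow> x \<otimes>\<^bsub>R\<^esub> (a \<odot>\<^bsub>R\<^esub> y) = a \<odot>\<^bsub>R\<^esub> (x \<otimes>\<^bsub>R\<^esub> y)"

locale graded_algebra = assoc_algebra K R
  for K :: "('k, 'c) ring_scheme" (structure) and R :: "('k, 'r) gr_algebra" (structure) +
  assumes grading: "is_grading R (acomp R)"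
    and acomp_subspace: "submodule (acomp R i) K R"
    and acomp_mult: "\<lbrakk>x \<in> acomp R i; y \<in> acomp R j\<rbrakk> \<Longrightarrow> x \<otimes>\<^bsub>R\<^esub> y \<in> acomp R (i + j)"

locale right_module = R?: ring R + M?: abelian_group M
  for R :: "('r, 'c) ring_scheme" (structure) and M :: "('r, 'm, 'd) rmodule_scheme" (structure) +
  assumes act_closed:
      "\<lbrakk>x \<in> carrier M; r \<in> carrier R\<rbrakk> \<Longrightarrow> x \<triangleleft>\<^bsub>M\<^esub> r \<in> carrier M"
    and act_add_left:
      "\<lbrakk>x \<in> carrier M; y \<in> carrier M; r \<in> carrier R\<rbrakk>
        \<Longrightarrow> (x \<oplus>\<^bsub>M\<^esub> y) \<triangleleft>\<^bsub>M\<^esub> r = x \<triangleleft>\<^bsub>M\<^esub> r \<oplus>\<^bsub>M\<^esub> y \<triangleleft>\<^bsub>M\<^esub> r"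
    and act_add_right:
      "\<lbrakk>x \<in> carrier M; r \<in> carrier R; s \<in> carrier R\<rbrakk>
        \<Longrightarrow> x \<triangleleft>\<^bsub>M\<^esub> (r \<oplus>\<^bsub>R\<^esub> s) = x \<triangleleft>\<^bsub>M\<^esub> r \<oplus>\<^bsub>M\<^esub> x \<triangleleft>\<^bsub>M\<^esub> s"
    and act_assoc:
      "\<lbrakk>x \<in> carrier M; r \<in> carrier R; s \<in> carrier R\<rbrakk>
        \<Longrightarrow> x \<triangleleft>\<^bsub>M\<^esub> (r \<otimes>\<^bsub>R\<^esub> s) = (x \<triangleleft>\<^bsub>M\<^esub> r) \<triangleleft>\<^bsub>M\<^esub> s"
    and act_one: "x \<in> carrier M \<Longrightarrow> x \<triangleleft>\<^bsub>M\<^esub> \<one>\<^bsub>R\<^esub> = x"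

locale graded_module = right_module R M
  for R :: "('k, 'r) gr_algebra" (structure) and M :: "('r, 'm) gr_module" (structure) +
  assumes grading: "is_grading M (mcomp M)"
    and mcomp_act:
      "\<lbrakk>x \<in> mcomp M k; r \<in> acomp R i\<rbrakk> \<Longrightarrow> x \<triangleleft>\<^bsub>M\<^esub> r \<in> mcomp M (k + int i)"

definition rsubmodule ::
  "('r, 'c) ring_scheme \<Rightarrow> ('r, 'm, 'd) rmodule_scheme \<Rightarrow> 'm set \<Rightarrow> bool" where
  "rsubmodule R M N \<longleftrightarrow>
     additive_subgroup N M \<and> (\<forall>x\<in>N. \<forall>r\<in>carrier R. x \<triangleleft>\<^bsub>M\<^esub> r \<in> N)"

definition rspan ::
  "('r, 'c) ring_scheme \<Rightarrow> ('r, 'm, 'd) rmodule_scheme \<Rightarrow> 'm set \<Rightarrow> 'm set" where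
  "rspan R M S = \<Inter>{N. rsubmodule R M N \<and> S \<subseteq> N}"

definition finitely_generated ::
  "('r, 'c) ring_scheme \<Rightarrow> ('r, 'm, 'd) rmodule_scheme \<Rightarrow> bool" where
  "finitely_generated R M \<longleftrightarrow> (\<exists>S. finite S \<and> S \<subseteq> carrier M \<and> rspan R M S = carrier M)"

definition generated_in_degree ::
  "('k, 'r) gr_algebra \<Rightarrow> ('r, 'm) gr_module \<Rightarrow> int \<Rightarrow> bool" where
  "generated_in_degree R M k \<longleftrightarrow> rspan R M (mcomp M k) = carrier M"

definition rmod_hom ::
  "('r, 'c) ring_scheme \<Rightarrow> ('r, 'm, 'd) rmodule_scheme \<Rightarrow> ('r, 'n, 'e) rmodule_scheme
    \<Rightarrow> ('m \<Rightarrow> 'n) set" where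
  "rmod_hom R M N = {f. f \<in> carrier M \<rightarrow> carrier N \<and>
     (\<forall>x\<in>carrier M. \<forall>y\<in>carrier M. f (x \<oplus>\<^bsub>M\<^esub> y) = f x \<oplus>\<^bsub>N\<^esub> f y) \<and>
     (\<forall>x\<in>carrier M. \<forall>r\<in>carrier R. f (x \<triangleleft>\<^bsub>M\<^esub> r) = f x \<triangleleft>\<^bsub>N\<^esub> r)}"

definition has_degree ::
  "('r, 'm) gr_module \<Rightarrow> ('r, 'n) gr_module \<Rightarrow> int \<Rightarrow> ('m \<Rightarrow> 'n) \<Rightarrow> bool" where
  "has_degree M N i f \<longleftrightarrow> (\<forall>k. f ` mcomp M k \<subseteq> mcomp N (i + k))"

section \<open>Projective resolutions\<close>

text \<open>The free right module on a set: finitely supported functions, extended by zero.\<close>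

definition free_rmodule :: "('r, 'c) ring_scheme \<Rightarrow> 'x set \<Rightarrow> ('r, 'x \<Rightarrow> 'r) rmodule" where
  "free_rmodule R X =
     \<lparr>carrier = {v. (\<forall>x\<in>X. v x \<in> carrier R) \<and> (\<forall>x. x \<notin> X \<longrightarrow> v x = \<zero>\<^bsub>R\<^esub>) \<and>
                    finite {x. v x \<noteq> \<zero>\<^bsub>R\<^esub>}},
      mult = undefined, one = undefined,
      zero = (\<lambda>x. \<zero>\<^bsub>R\<^esub>), add = (\<lambda>v w x. v x \<oplus>\<^bsub>R\<^esub> w x),
      act = (\<lambda>v r x. v x \<otimes>\<^bsub>R\<^esub> r)\<rparr>"

text \<open>Projective: a direct summand (retract) of a free module.  Index sets of the element type of
  \<open>P\<close> suffice, since a projective module is a direct summand of the free module on its own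
  underlying set.\<close>

definition projective ::
  "('r, 'c) ring_scheme \<Rightarrow> ('r, 'p, 'd) rmodule_scheme \<Rightarrow> bool" where
  "projective R P \<longleftrightarrow> right_module R P \<and>
     (\<exists>X :: 'p set. \<exists>s \<in> rmod_hom R P (free_rmodule R X). \<exists>q \<in> rmod_hom R (free_rmodule R X) P.
        \<forall>x\<in>carrier P. q (s x) = x)"

text \<open>Data of a resolution
  \<open>\<dots> \<rightarrow> res_mod 1 \<rightarrow> res_mod 0 \<rightarrow> M \<rightarrow> 0\<close>, where \<open>res_diff n\<close> maps the term with index \<open>n + 1\<close>
  to the one with index \<open>n\<close>.\<close>

record ('r, 'p, 'm) resolution =
  res_mod :: "nat \<Rightarrow> ('r, 'p) gr_module"
  res_diff :: "nat \<Rightarrow> 'p \<Rightarrow> 'p"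
  res_aug :: "'p \<Rightarrow> 'm"

text \<open>Finite generation of the terms is a standing convention for all resolutions.\<close>

definition gr_proj_resolution ::
  "('k, 'r) gr_algebra \<Rightarrow> ('r, 'm) gr_module \<Rightarrow> ('r, 'p, 'm) resolution \<Rightarrow> bool" where
  "gr_proj_resolution R M A \<longleftrightarrow>
     (\<forall>n. graded_module R (res_mod A n) \<and> projective R (res_mod A n) \<and>
          finitely_generated R (res_mod A n)) \<and>
     (\<forall>n. res_diff A n \<in> rmod_hom R (res_mod A (Suc n)) (res_mod A n) \<and>
          has_degree (res_mod A (Suc n)) (res_mod A n) 0 (res_diff A n)) \<and>
     res_aug A \<in> rmod_hom R (res_mod A 0) M \<and> has_degree (res_mod A 0) M 0 (res_aug A) \<and>
     res_aug A ` carrier (res_mod A 0) = carrier M \<and>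
     res_diff A 0 ` carrier (res_mod A 1) = a_kernel (res_mod A 0) M (res_aug A) \<and>
     (\<forall>n. res_diff A (Suc n) ` carrier (res_mod A (Suc (Suc n))) =
          a_kernel (res_mod A (Suc n)) (res_mod A n) (res_diff A n))"

text \<open>Up to isomorphism a finitely generated projective right \<open>R\<close>-module is a submodule of some
  \<open>R\<^sup>n\<close>, hence carried by a set of functions from \<open>nat\<close> to \<open>R\<close>.  So it is no restriction to let the
  terms of the linear resolution live in the type \<open>nat \<Rightarrow> 'r\<close>.\<close>

definition linear_module :: "('k, 'r) gr_algebra \<Rightarrow> ('r, 'm) gr_module \<Rightarrow> bool" where
  "linear_module R M \<longleftrightarrow> graded_module R M \<and> generated_in_degree R M 0 \<and>
     (\<exists>A :: ('r, nat \<Rightarrow> 'r, 'm) resolution.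
        gr_proj_resolution R M A \<and> (\<forall>n. generated_in_degree R (res_mod A n) (int n)))"

section \<open>Koszul algebras\<close>

definition graded_rad :: "('k, 'r) gr_algebra \<Rightarrow> 'r set" where
  "graded_rad R = internal_sum R {0<..} (acomp R)"

definition degree_zero_module :: "('k, 'r) gr_algebra \<Rightarrow> ('r, 'r set) gr_module" where
  "degree_zero_module R = (let Q = R Quot graded_rad R in
     \<lparr>carrier = carrier Q, mult = undefined, one = undefined, zero = \<zero>\<^bsub>Q\<^esub>, add = add Q,
      act = (\<lambda>x r. x \<otimes>\<^bsub>Q\<^esub> (graded_rad R +>\<^bsub>R\<^esub> r)),
      mcomp = (\<lambda>i. if i = 0 then carrier Q else {\<zero>\<^bsub>Q\<^esub>})\<rparr>)"

text \<open>The degree zero part is isomorphic to \<open>K \<times> \<dots> \<times> K\<close> as a \<open>K\<close>-algebra; the product ring consists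
  of lists.\<close>

definition split_degree_zero :: "('k, 'c) ring_scheme \<Rightarrow> ('k, 'r) gr_algebra \<Rightarrow> bool" where
  "split_degree_zero K R \<longleftrightarrow>
     (\<exists>n>0. \<exists>\<phi> \<in> ring_iso (R\<lparr>carrier := acomp R 0\<rparr>) (RDirProd_list (replicate n K)).
        \<forall>a\<in>carrier K. \<forall>x\<in>acomp R 0. \<phi> (a \<odot>\<^bsub>R\<^esub> x) = map (\<lambda>y. a \<otimes>\<^bsub>K\<^esub> y) (\<phi> x))"

definition koszul_algebra :: "('k, 'c) ring_scheme \<Rightarrow> ('k, 'r) gr_algebra \<Rightarrow> bool" where
  "koszul_algebra K R \<longleftrightarrow>
     graded_algebra K R \<and> split_degree_zero K R \<and> linear_module R (degree_zero_module R)"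

text \<open>Minimality: the image of each differential lies in \<open>P \<rr>\<close>, where \<open>\<rr>\<close> is the graded radical.\<close>

definition minimal_gr_proj_resolution ::
  "('k, 'r) gr_algebra \<Rightarrow> ('r, 'm) gr_module \<Rightarrow> ('r, 'p, 'm) resolution \<Rightarrow> bool" where
  "minimal_gr_proj_resolution R M A \<longleftrightarrow> gr_proj_resolution R M A \<and>
     (\<forall>n. res_diff A n ` carrier (res_mod A (Suc n)) \<subseteq>
        rspan R (res_mod A n)
          {x \<triangleleft>\<^bsub>res_mod A n\<^esub> r | x r. x \<in> carrier (res_mod A n) \<and> r \<in> graded_rad R})"

section \<open>The Ext algebra\<close>

text \<open>Homomorphisms are made extensional so that the Hom sets are genuine \<open>K\<close>-spaces.  A scalar
  acts on a right \<open>R\<close>-module through its image in \<open>R\<close>.\<close>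

definition hom_space ::
  "('k, 'r) gr_algebra \<Rightarrow> ('r, 'm) gr_module \<Rightarrow> ('r, 'n) gr_module \<Rightarrow> ('k, 'm \<Rightarrow> 'n) module" where
  "hom_space R M N =
     \<lparr>carrier = rmod_hom R M N \<inter> extensional (carrier M),
      mult = undefined, one = undefined,
      zero = (\<lambda>x\<in>carrier M. \<zero>\<^bsub>N\<^esub>),
      add = (\<lambda>f g. \<lambda>x\<in>carrier M. f x \<oplus>\<^bsub>N\<^esub> g x),
      smult = (\<lambda>a f. \<lambda>x\<in>carrier M. f x \<triangleleft>\<^bsub>N\<^esub> (a \<odot>\<^bsub>R\<^esub> \<one>\<^bsub>R\<^esub>))\<rparr>"

text \<open>The quotient \<open>Z / B\<close> of subspaces \<open>B \<subseteq> Z\<close> of a \<open>K\<close>-space \<open>V\<close>.\<close>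

definition quot_space :: "('k, 'v) module \<Rightarrow> 'v set \<Rightarrow> 'v set \<Rightarrow> ('k, 'v set) module" where
  "quot_space V Z B =
     \<lparr>carrier = {B +>\<^bsub>V\<^esub> f | f. f \<in> Z},
      mult = undefined, one = undefined,
      zero = B, add = set_add V,
      smult = (\<lambda>a X. \<Union>f\<in>X. B +>\<^bsub>V\<^esub> (a \<odot>\<^bsub>V\<^esub> f))\<rparr>"

context
  fixes R :: "('k, 'r) gr_algebra" and M :: "('r, 'm) gr_module"
    and A :: "('r, 'p, 'm) resolution"
begin

definition cochains :: "nat \<Rightarrow> ('k, 'p \<Rightarrow> 'm) module" where
  "cochains n = hom_space R (res_mod A n) M"

definition cocycles :: "nat \<Rightarrow> ('p \<Rightarrow> 'm) set" where
  "cocycles n = {f \<in> carrier (cochains n).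
     \<forall>x\<in>carrier (res_mod A (Suc n)). f (res_diff A n x) = \<zero>\<^bsub>M\<^esub>}"

definition coboundaries :: "nat \<Rightarrow> ('p \<Rightarrow> 'm) set" where
  "coboundaries n = (case n of
     0 \<Rightarrow> {\<zero>\<^bsub>cochains 0\<^esub>}
   | Suc m \<Rightarrow> (\<lambda>h. restrict (h \<circ> res_diff A m) (carrier (res_mod A (Suc m))))
                ` carrier (cochains m))"

definition ext_class :: "nat \<Rightarrow> ('p \<Rightarrow> 'm) \<Rightarrow> ('p \<Rightarrow> 'm) set" where
  "ext_class n f = coboundaries n +>\<^bsub>cochains n\<^esub> f"

definition ext_space :: "nat \<Rightarrow> ('k, ('p \<Rightarrow> 'm) set) module" where
  "ext_space n = quot_space (cochains n) (cocycles n) (coboundaries n)"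

definition ext_degree :: "nat \<Rightarrow> int \<Rightarrow> ('p \<Rightarrow> 'm) set set" where
  "ext_degree n i = {ext_class n f | f. f \<in> cocycles n \<and> has_degree (res_mod A n) M i f}"

text \<open>Chain maps \<open>G\<close> of (homological) degree \<open>- n\<close> from the resolution to itself which lift the
  cocycle \<open>g\<close>.\<close>

definition lifts :: "nat \<Rightarrow> ('p \<Rightarrow> 'm) \<Rightarrow> (nat \<Rightarrow> 'p \<Rightarrow> 'p) set" where
  "lifts n g = {G.
     (\<forall>k. G k \<in> rmod_hom R (res_mod A (n + k)) (res_mod A k)) \<and>
     (\<forall>x\<in>carrier (res_mod A n). res_aug A (G 0 x) = g x) \<and>
     (\<forall>k. \<forall>x\<in>carrier (res_mod A (n + Suc k)).
        res_diff A k (G (Suc k) x) = G k (res_diff A (n + k) x))}"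

text \<open>Yoneda product of classes of degrees \<open>m\<close> and \<open>n\<close>: the class of \<open>f \<circ> G m\<close>, where \<open>f\<close> represents
  the first factor and \<open>G\<close> lifts a representative of the second.  The union over all choices follows
  the pattern of \<open>rcoset_mult\<close>; it is a single coset since the class does not depend on them.
  No signs are inserted in the lifts or in the composition.\<close>

definition yoneda ::
  "nat \<Rightarrow> nat \<Rightarrow> ('p \<Rightarrow> 'm) set \<Rightarrow> ('p \<Rightarrow> 'm) set \<Rightarrow> ('p \<Rightarrow> 'm) set" where
  "yoneda m n X Y = (\<Union>f\<in>X. \<Union>g\<in>Y. \<Union>G\<in>lifts n g.
     ext_class (m + n) (restrict (f \<circ> G m) (carrier (res_mod A (m + n)))))"

text \<open>The direct sum over all \<open>n\<close>: finitely supported families of classes.\<close>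

definition ext_algebra :: "('k, nat \<Rightarrow> ('p \<Rightarrow> 'm) set) module" where
  "ext_algebra =
     \<lparr>carrier = {x. (\<forall>n. x n \<in> carrier (ext_space n)) \<and> finite {n. x n \<noteq> \<zero>\<^bsub>ext_space n\<^esub>}},
      mult = (\<lambda>x y n. \<Oplus>\<^bsub>ext_space n\<^esub>m\<in>{..n}. yoneda m (n - m) (x m) (y (n - m))),
      one = (\<lambda>n. if n = 0 then ext_class 0 (restrict (res_aug A) (carrier (res_mod A 0)))
                 else \<zero>\<^bsub>ext_space n\<^esub>),
      zero = (\<lambda>n. \<zero>\<^bsub>ext_space n\<^esub>),
      add = (\<lambda>x y n. x n \<oplus>\<^bsub>ext_space n\<^esub> y n),
      smult = (\<lambda>a x n. a \<odot>\<^bsub>ext_space n\<^esub> x n)\<rparr>"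

definition ext_diagonal :: "(nat \<Rightarrow> ('p \<Rightarrow> 'm) set) set" where
  "ext_diagonal = {x \<in> carrier ext_algebra. \<forall>n. x n \<in> ext_degree n (- int n)}"

definition ext_off_diagonal :: "(nat \<Rightarrow> ('p \<Rightarrow> 'm) set) set" where
  "ext_off_diagonal = {x \<in> carrier ext_algebra.
     \<forall>n. x n \<in> internal_sum (ext_space n) {- int n<..} (ext_degree n)}"

end

end

(* A cocycle on the n-th term P_n is a finite sum of homogeneous ones because P_n is finitely
generated, and taking homogeneous components commutes with the degree 0 differentials; hence Ext^n is
the direct sum of its homogeneous parts. A homogeneous cocycle has a homogeneous lift to a chain map,
so Yoneda products add degrees. Finally, Ext can be computed with a linear resolution of M, whose n-th
term is generated in degree n, while M vanishes in negative degrees; so nothing of degree below -n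
survives in Ext^n, and a product with one factor strictly above the diagonal stays strictly above it.
*)

theory Submission
  imports Defs
begin

section \<open>Internal sums and gradings\<close>

text \<open>The given resolution and the linear one may have different element types and are never
  identified. Comparison maps run in both directions; their composite on the given resolution lifts
  the identity of \<open>M\<close>, so by homotopy it fixes every Ext class, although the class has
  passed through the linear resolution, where its degree is bounded below. Directness of the sum
  cannot be read off from cochains alone: a relation between homogeneous classes holds only up to
  coboundaries, and it splits by degree because components of coboundaries are coboundaries.
  \<open>yoneda\<close> is a union over all representatives and lifts, so it becomes usable only
  after three choices are shown harmless: the first representative, the lift, and the second
  representative. The last is settled by one special lift of a coboundary, concentrated in degree 0.
  Once bilinearity, associativity and the unit laws hold for classes of fixed degree, the passage to
  finitely supported families is formal and is done for arbitrary graded products.\<close>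

lemma additive_subgroupI':
  assumes "abelian_group A" "H \<subseteq> carrier A" "\<zero>\<^bsub>A\<^esub> \<in> H"
    and "\<And>x y. \<lbrakk>x \<in> H; y \<in> H\<rbrakk> \<Longrightarrow> x \<oplus>\<^bsub>A\<^esub> y \<in> H"
    and "\<And>x. x \<in> H \<Longrightarrow> \<ominus>\<^bsub>A\<^esub> x \<in> H"
  shows "additive_subgroup H A"
proof -
  interpret abelian_group A by fact
  show ?thesis
    unfolding additive_subgroup_def subgroup_def
    using assms by (auto simp: a_inv_def)
qed

context abelian_group begin

text \<open>Lets later arguments about Ext classes speak of single homogeneous classes and of sums
  of two, without handling the finite families inside \<open>internal_sum\<close>.\<close>

lemma internal_sum_induct [consumes 1, case_names sub zero hom add]:
  assumes "x \<in> internal_sum G J H"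
    and sub: "\<And>i. i \<in> J \<Longrightarrow> H i \<subseteq> carrier G"
    and "P \<zero>" and hom: "\<And>i x. \<lbrakk>i \<in> J; x \<in> H i\<rbrakk> \<Longrightarrow> P x"
    and add: "\<And>x y. \<lbrakk>x \<in> carrier G; y \<in> carrier G; P x; P y\<rbrakk> \<Longrightarrow> P (x \<oplus> y)"
  shows "P x"
proof -
  obtain F f where x: "x = finsum G f F" and F: "finite F" "F \<subseteq> J" "\<forall>i\<in>F. f i \<in> H i"
    using assms(1) unfolding internal_sum_def by blast
  from F have "P (finsum G f F)"
  proof (induction F rule: finite_induct)
    case empty then show ?case using \<open>P \<zero>\<close> by simp
  next
    case (insert a F)
    then have f: "f \<in> F \<rightarrow> carrier G" "f a \<in> carrier G" using sub by blast+
    have "finsum G f F \<in> carrier G" using f by simp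
    then show ?case using insert f add hom[of a "f a"] by simp
  qed
  with x show ?thesis by simp
qed

lemma internal_sum_closed:
  assumes "\<And>i. i \<in> J \<Longrightarrow> H i \<subseteq> carrier G"
  shows "internal_sum G J H \<subseteq> carrier G"
proof
  fix x assume "x \<in> internal_sum G J H"
  then show "x \<in> carrier G" by (induction rule: internal_sum_induct) (use assms in auto)
qed

lemma internal_sum_incl:
  assumes "i \<in> J" "x \<in> H i" "x \<in> carrier G"
  shows "x \<in> internal_sum G J H"
proof -
  have "x = finsum G (\<lambda>_. x) {i}" using assms by simp
  then show ?thesis using assms unfolding internal_sum_def by blast
qed

lemma internal_sum_mono: "J \<subseteq> J' \<Longrightarrow> internal_sum G J H \<subseteq> internal_sum G J' H"
  unfolding internal_sum_def by blast

lemma finsum_extend_zero: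
  assumes "finite T" "F \<subseteq> T" "f \<in> F \<rightarrow> carrier G"
  shows "finsum G f F = finsum G (\<lambda>i. if i \<in> F then f i else \<zero>) T"
  by (rule add.finprod_mono_neutral_cong_left) (use assms in auto)

lemma additive_subgroup_internal_sum:
  assumes H: "\<And>i. i \<in> J \<Longrightarrow> additive_subgroup (H i) G"
  shows "additive_subgroup (internal_sum G J H) G"
proof (rule additive_subgroupI')
  show "abelian_group G" by unfold_locales
  have sub: "H i \<subseteq> carrier G" if "i \<in> J" for i
    using additive_subgroup.a_subset[OF H[OF that]] .
  show "internal_sum G J H \<subseteq> carrier G" by (rule internal_sum_closed) (rule sub)
  have "finsum G (\<lambda>_. \<zero>) {} = \<zero>" by simp
  then show zero: "\<zero> \<in> internal_sum G J H" unfolding internal_sum_def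
    by (intro CollectI exI[of _ "{}"] exI[of _ "\<lambda>_. \<zero>"]) simp
  show plus: "x \<oplus> y \<in> internal_sum G J H"
    if xy: "x \<in> internal_sum G J H" "y \<in> internal_sum G J H" for x y
  proof -
    obtain F f F' f' where x: "x = finsum G f F" "finite F" "F \<subseteq> J" "\<forall>i\<in>F. f i \<in> H i"
      and y: "y = finsum G f' F'" "finite F'" "F' \<subseteq> J" "\<forall>i\<in>F'. f' i \<in> H i"
      using xy unfolding internal_sum_def by blast
    have "f i \<in> carrier G" if "i \<in> F" for i using that x(3,4) sub by blast
    moreover have "f' i \<in> carrier G" if "i \<in> F'" for i using that y(3,4) sub by blast
    ultimately have fc: "f \<in> F \<rightarrow> carrier G" "f' \<in> F' \<rightarrow> carrier G" by blast+
    \<comment> \<open>Both families are padded by zero to the common index set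
      \<open>F \<union> F'\<close>, where their sums can be added termwise.\<close>
    let ?g = "\<lambda>i. if i \<in> F then f i else \<zero>" and ?g' = "\<lambda>i. if i \<in> F' then f' i else \<zero>"
    have "x = finsum G ?g (F \<union> F')" "y = finsum G ?g' (F \<union> F')"
      unfolding x(1) y(1) by (rule finsum_extend_zero; use x(2) y(2) fc in blast)+
    then have "x \<oplus> y = finsum G ?g (F \<union> F') \<oplus> finsum G ?g' (F \<union> F')" by (rule arg_cong2)
    also have "\<dots> = finsum G (\<lambda>i. ?g i \<oplus> ?g' i) (F \<union> F')"
      by (rule finsum_addf[symmetric]) (use fc in auto)
    finally have *: "x \<oplus> y = finsum G (\<lambda>i. ?g i \<oplus> ?g' i) (F \<union> F')" .
    have "?g i \<oplus> ?g' i \<in> H i" if "i \<in> F \<union> F'" for i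
    proof -
      have i: "i \<in> J" using that x y by blast
      interpret additive_subgroup "H i" G by (rule H[OF i])
      have "?g i \<in> H i" "?g' i \<in> H i" using x(4) y(4) by auto
      then show ?thesis by (rule a_closed)
    qed
    then have "finite (F \<union> F') \<and> F \<union> F' \<subseteq> J \<and> (\<forall>i\<in>F \<union> F'. ?g i \<oplus> ?g' i \<in> H i)"
      using x(2,3) y(2,3) by blast
    with * show ?thesis unfolding internal_sum_def by blast
  qed
  show "\<ominus> x \<in> internal_sum G J H" if "x \<in> internal_sum G J H" for x
    using that
  proof (induction rule: internal_sum_induct)
    case (hom i x)
    interpret additive_subgroup "H i" G by (rule H[OF hom(1)])
    have "\<ominus> x \<in> H i" using hom(2) by (rule a_inv_closed)
    then show ?case using internal_sum_incl[OF hom(1)] sub[OF hom(1)] by blast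
  next
    case (add x y)
    then show ?case using plus[OF add(4,3)] by (simp add: minus_add a_comm)
  next
    case zero
    have "\<ominus> \<zero> = \<zero>" by (rule minus_equality) simp_all
    then show ?case using \<open>\<zero> \<in> internal_sum G J H\<close> by argo
  qed (rule sub)
qed

end

text \<open>Meaningful on the carrier, where \<open>is_grading\<close> gives existence and
  uniqueness. The family of all parts is one value, so the uniqueness clause yields equality of
  whole families at once.\<close>

definition hpart :: "('a, 'c) ring_scheme \<Rightarrow> ('i \<Rightarrow> 'a set) \<Rightarrow> 'a \<Rightarrow> 'i \<Rightarrow> 'a" where
  "hpart A H x = (THE f. (\<forall>i. f i \<in> H i) \<and> finite {i. f i \<noteq> \<zero>\<^bsub>A\<^esub>} \<and>
     x = finsum A f {i. f i \<noteq> \<zero>\<^bsub>A\<^esub>})"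

text \<open>The index type stays arbitrary because the algebra is graded by \<open>nat\<close> and
  its modules by \<open>int\<close>.\<close>

locale graded_group = abelian_group G for G (structure) and H :: "'i \<Rightarrow> 'a set" +
  assumes grading: "is_grading G H"
begin

lemma comp_subgroup: "additive_subgroup (H i) G"
  using grading unfolding is_grading_def by blast

lemma comp_closed: "x \<in> H i \<Longrightarrow> x \<in> carrier G"
  using additive_subgroup.a_subset[OF comp_subgroup] by blast

lemma comp_zero [simp]: "\<zero> \<in> H i"
  using additive_subgroup.zero_closed[OF comp_subgroup] .

lemma comp_add: "x \<in> H i \<Longrightarrow> y \<in> H i \<Longrightarrow> x \<oplus> y \<in> H i"
  using additive_subgroup.a_closed[OF comp_subgroup] .

lemma hpart_props:
  assumes "x \<in> carrier G"
  shows "hpart G H x i \<in> H i" "finite {i. hpart G H x i \<noteq> \<zero>}"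
    "x = finsum G (hpart G H x) {i. hpart G H x i \<noteq> \<zero>}"
proof -
  have "\<exists>!f. (\<forall>i. f i \<in> H i) \<and> finite {i. f i \<noteq> \<zero>} \<and> x = finsum G f {i. f i \<noteq> \<zero>}"
    using grading assms unfolding is_grading_def by blast
  from theI'[OF this] show "hpart G H x i \<in> H i" "finite {i. hpart G H x i \<noteq> \<zero>}"
    "x = finsum G (hpart G H x) {i. hpart G H x i \<noteq> \<zero>}"
    unfolding hpart_def[symmetric] by blast+
qed

lemma hpart_closed [simp]: "x \<in> carrier G \<Longrightarrow> hpart G H x i \<in> carrier G"
  using hpart_props(1) comp_closed by blast

text \<open>The uniqueness clause of \<open>is_grading\<close> sums over the exact support. In
  practice one only has some finite \<open>F\<close> containing it, so the sum is trimmed before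
  uniqueness is applied.\<close>

lemma hpart_eqI:
  assumes f: "\<And>i. f i \<in> H i" and F: "finite F" "\<And>i. i \<notin> F \<Longrightarrow> f i = \<zero>"
    and x: "x = finsum G f F"
  shows "hpart G H x = f"
proof -
  have fc: "f i \<in> carrier G" for i using f comp_closed by blast
  have s: "{i. f i \<noteq> \<zero>} \<subseteq> F" using F by blast
  have e: "x = finsum G f {i. f i \<noteq> \<zero>}"
    unfolding x by (rule add.finprod_mono_neutral_cong_right) (use fc F s in auto)
  have xc: "x \<in> carrier G" unfolding x using fc by auto
  have "\<exists>!f. (\<forall>i. f i \<in> H i) \<and> finite {i. f i \<noteq> \<zero>} \<and> x = finsum G f {i. f i \<noteq> \<zero>}"
    using grading xc unfolding is_grading_def by blast
  then show ?thesis unfolding hpart_def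
    by (rule the1_equality) (use f e finite_subset[OF s F(1)] in blast)+
qed

lemma hpart_hom:
  assumes "x \<in> H i" shows "hpart G H x = (\<lambda>j. if j = i then x else \<zero>)"
  by (rule hpart_eqI[of _ "{i}"]) (use assms comp_closed in auto)

lemma hpart_zero [simp]: "hpart G H \<zero> i = \<zero>"
  using hpart_hom[of \<zero> i, OF comp_zero] by simp

lemma finsum_hpart:
  assumes "x \<in> carrier G" "finite F" "{i. hpart G H x i \<noteq> \<zero>} \<subseteq> F"
  shows "x = finsum G (hpart G H x) F"
proof -
  have "finsum G (hpart G H x) {i. hpart G H x i \<noteq> \<zero>} = finsum G (hpart G H x) F"
    by (rule add.finprod_mono_neutral_cong_left) (use assms in auto)
  then show ?thesis using hpart_props(3)[OF assms(1)] by simp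
qed

lemma hpart_add:
  assumes "x \<in> carrier G" "y \<in> carrier G"
  shows "hpart G H (x \<oplus> y) i = hpart G H x i \<oplus> hpart G H y i"
proof -
  let ?F = "{i. hpart G H x i \<noteq> \<zero>} \<union> {i. hpart G H y i \<noteq> \<zero>}"
  have fin: "finite ?F" using hpart_props(2) assms by blast
  have x: "x = finsum G (hpart G H x) ?F" and y: "y = finsum G (hpart G H y) ?F"
    using finsum_hpart[OF _ fin] assms by blast+
  have "x \<oplus> y = finsum G (hpart G H x) ?F \<oplus> finsum G (hpart G H y) ?F"
    using x y by simp
  also have "\<dots> = finsum G (\<lambda>i. hpart G H x i \<oplus> hpart G H y i) ?F"
    by (rule finsum_addf[symmetric]) (use assms in auto)
  finally have *: "x \<oplus> y = finsum G (\<lambda>i. hpart G H x i \<oplus> hpart G H y i) ?F" .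
  have "hpart G H (x \<oplus> y) = (\<lambda>i. hpart G H x i \<oplus> hpart G H y i)"
    by (rule hpart_eqI[OF _ fin _ *]) (use hpart_props(1)[OF assms(1)] hpart_props(1)[OF assms(2)] in \<open>auto intro: comp_add\<close>)
  then show ?thesis by simp
qed

lemma carrier_eq_internal_sum: "carrier G = internal_sum G UNIV H"
proof
  show "carrier G \<subseteq> internal_sum G UNIV H"
    unfolding internal_sum_def using hpart_props by blast
  show "internal_sum G UNIV H \<subseteq> carrier G"
    by (rule internal_sum_closed) (use comp_closed in blast)
qed

lemma hom_induct [consumes 1, case_names zero hom add]:
  assumes "x \<in> carrier G" "P \<zero>" "\<And>i x. x \<in> H i \<Longrightarrow> P x"
    "\<And>x y. \<lbrakk>x \<in> carrier G; y \<in> carrier G; P x; P y\<rbrakk> \<Longrightarrow> P (x \<oplus> y)"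
  shows "P x"
  using assms(1) unfolding carrier_eq_internal_sum
proof (induction rule: internal_sum_induct)
  case (hom i x)
  then show ?case using assms(3) by blast
next
  case (add x y)
  then show ?case using assms(4) by blast
qed (use assms(2) comp_closed in blast)+

end

section \<open>Additive maps and their homogeneous components\<close>

text \<open>Weaker than \<open>rmod_hom\<close> on purpose: it also covers the action of a fixed
  scalar, taking a homogeneous part, evaluation of a cochain, the coboundary operator, and
  multiplication by a fixed Ext class.\<close>

definition additive :: "('a, 'c) ring_scheme \<Rightarrow> ('b, 'd) ring_scheme \<Rightarrow> ('a \<Rightarrow> 'b) \<Rightarrow> bool" where
  "additive A B f \<longleftrightarrow> f \<in> carrier A \<rightarrow> carrier B \<and>
     (\<forall>x\<in>carrier A. \<forall>y\<in>carrier A. f (x \<oplus>\<^bsub>A\<^esub> y) = f x \<oplus>\<^bsub>B\<^esub> f y)"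

lemma additiveD:
  assumes "additive A B f"
  shows "x \<in> carrier A \<Longrightarrow> f x \<in> carrier B"
    "x \<in> carrier A \<Longrightarrow> y \<in> carrier A \<Longrightarrow> f (x \<oplus>\<^bsub>A\<^esub> y) = f x \<oplus>\<^bsub>B\<^esub> f y"
  using assms unfolding additive_def by auto

lemma additive_zero:
  assumes "abelian_group A" "abelian_group B" "additive A B f"
  shows "f \<zero>\<^bsub>A\<^esub> = \<zero>\<^bsub>B\<^esub>"
proof -
  interpret A: abelian_group A by fact
  interpret B: abelian_group B by fact
  note f = additiveD[OF assms(3)]
  have "f \<zero>\<^bsub>A\<^esub> \<oplus>\<^bsub>B\<^esub> f \<zero>\<^bsub>A\<^esub> = f \<zero>\<^bsub>A\<^esub>" using f(2)[of "\<zero>\<^bsub>A\<^esub>" "\<zero>\<^bsub>A\<^esub>"] by simp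
  then show ?thesis using f(1)[of "\<zero>\<^bsub>A\<^esub>"] by (metis A.zero_closed B.add.l_cancel_one')
qed

lemma additive_inv:
  assumes "abelian_group A" "abelian_group B" "additive A B f" "x \<in> carrier A"
  shows "f (\<ominus>\<^bsub>A\<^esub> x) = \<ominus>\<^bsub>B\<^esub> f x"
proof -
  interpret A: abelian_group A by fact
  interpret B: abelian_group B by fact
  note f = additiveD[OF assms(3)]
  have "f (\<ominus>\<^bsub>A\<^esub> x) \<oplus>\<^bsub>B\<^esub> f x = f (\<ominus>\<^bsub>A\<^esub> x \<oplus>\<^bsub>A\<^esub> x)" using f(2) assms(4) by simp
  also have "\<dots> = \<zero>\<^bsub>B\<^esub>" using assms(4) additive_zero[OF assms(1-3)] by (simp add: A.l_neg)
  finally show ?thesis using f(1) assms(4) by (metis A.a_inv_closed B.minus_equality)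
qed

lemma additive_minus:
  assumes "abelian_group A" "abelian_group B" "additive A B f" "x \<in> carrier A" "y \<in> carrier A"
  shows "f (x \<ominus>\<^bsub>A\<^esub> y) = f x \<ominus>\<^bsub>B\<^esub> f y"
proof -
  interpret A: abelian_group A by fact
  show ?thesis
    using additiveD(2)[OF assms(3,4), of "\<ominus>\<^bsub>A\<^esub> y"] additive_inv[OF assms(1-3,5)] assms(5)
    by (simp add: a_minus_def)
qed

lemma additive_finsum:
  assumes "abelian_group A" "abelian_group B" "additive A B f" "g \<in> F \<rightarrow> carrier A"
  shows "f (finsum A g F) = finsum B (\<lambda>i. f (g i)) F"
proof (cases "finite F")
  case True
  interpret A: abelian_group A by fact
  interpret B: abelian_group B by fact
  note f = additiveD[OF assms(3)]
  from True assms(4) show ?thesis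
  proof (induction F rule: finite_induct)
    case empty then show ?case using additive_zero[OF assms(1-3)] by simp
  next
    case (insert a F)
    then have g: "g \<in> F \<rightarrow> carrier A" "g a \<in> carrier A" by auto
    then have fg: "(\<lambda>i. f (g i)) \<in> F \<rightarrow> carrier B" "f (g a) \<in> carrier B" using f by auto
    show ?case using insert g fg f(2)[OF g(2) A.finsum_closed[OF g(1)]] by simp
  qed
next
  case False
  interpret A: abelian_group A by fact
  interpret B: abelian_group B by fact
  show ?thesis using False additive_zero[OF assms(1-3)] by simp
qed

lemma additive_comp:
  assumes "additive A B f" "additive B C g"
  shows "additive A C (\<lambda>x. g (f x))"
  unfolding additive_def using additiveD[OF assms(1)] additiveD[OF assms(2)] by auto

text \<open>The component of \<open>f\<close> that raises degrees by \<open>i\<close>: of the image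
  of the part of \<open>x\<close> in degree \<open>k\<close>, only degree \<open>i + k\<close> is
  kept. The sum is finite because \<open>x\<close> has finitely many parts. Restriction to the
  carrier makes the result extensional, as elements of \<open>hom_space\<close> must be.\<close>

definition hcomp :: "('a, 'c) ring_scheme \<Rightarrow> (int \<Rightarrow> 'a set) \<Rightarrow> ('b, 'd) ring_scheme \<Rightarrow>
    (int \<Rightarrow> 'b set) \<Rightarrow> int \<Rightarrow> ('a \<Rightarrow> 'b) \<Rightarrow> 'a \<Rightarrow> 'b" where
  "hcomp A H B L i f = (\<lambda>x\<in>carrier A.
     finsum B (\<lambda>k. hpart B L (f (hpart A H x k)) (i + k)) {k. hpart A H x k \<noteq> \<zero>\<^bsub>A\<^esub>})"

text \<open>Homogeneous elements generate the group. Identities about components are thereby checked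
  on homogeneous arguments, where \<open>hcomp\<close> is a single part of the image.\<close>

lemma (in graded_group) additive_eqI:
  assumes "abelian_group B" "additive G B f" "additive G B g"
    and "\<And>k x. x \<in> H k \<Longrightarrow> f x = g x" and "x \<in> carrier G"
  shows "f x = g x"
  using assms(5)
proof (induction rule: hom_induct)
  case zero
  show ?case using additive_zero[OF abelian_group_axioms assms(1,2)]
      additive_zero[OF abelian_group_axioms assms(1,3)] by simp
next
  case (hom i x)
  then show ?case by (rule assms(4))
next
  case (add x y)
  then show ?case using additiveD(2)[OF assms(2)] additiveD(2)[OF assms(3)] by simp
qed

lemma (in graded_group) additive_hpart: "additive G G (\<lambda>x. hpart G H x i)"
  unfolding additive_def by (simp add: hpart_add)

text \<open>For \<open>x\<close> in degree \<open>l\<close> the image has only the part in degree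
  \<open>i + l\<close>; cancellation is what makes \<open>i + k = i + l\<close> equivalent to
  \<open>k = l\<close>. The index type covers both gradings, by \<open>nat\<close> and by
  \<open>int\<close>.\<close>

lemma hpart_map:
  fixes i k :: "'i :: cancel_semigroup_add"
  assumes "graded_group A H" "graded_group B L" "additive A B e"
    and deg: "\<And>k. e ` H k \<subseteq> L (i + k)" and x: "x \<in> carrier A"
  shows "hpart B L (e x) (i + k) = e (hpart A H x k)"
proof -
  interpret A: graded_group A H by fact
  interpret B: graded_group B L by fact
  have ag: "abelian_group A" "abelian_group B" by unfold_locales
  show ?thesis
  proof (rule A.additive_eqI[OF ag(2) _ _ _ x])
    show "additive A B (\<lambda>x. hpart B L (e x) (i + k))"
      using additive_comp[OF assms(3) B.additive_hpart] .
    show "additive A B (\<lambda>x. e (hpart A H x k))"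
      using additive_comp[OF A.additive_hpart assms(3)] .
    fix l x assume x: "x \<in> H l"
    then have "e x \<in> L (i + l)" using deg by blast
    then show "hpart B L (e x) (i + k) = e (hpart A H x k)"
      using A.hpart_hom[OF x] B.hpart_hom additive_zero[OF ag assms(3)] by auto
  qed
qed

section \<open>Components of additive maps between graded groups\<close>

locale graded_pair = A: graded_group A H + B: graded_group B L
  for A :: "('a, 'c) ring_scheme" and H :: "int \<Rightarrow> 'a set"
    and B :: "('b, 'd) ring_scheme" and L :: "int \<Rightarrow> 'b set"
begin

lemma ag: "abelian_group A" "abelian_group B" by unfold_locales

text \<open>Frees the sum from the support of \<open>x\<close>, so that the components at
  \<open>x\<close>, \<open>y\<close> and their sum can be written over one finite set.\<close>

lemma hcomp_superset:
  assumes f: "additive A B f" and x: "x \<in> carrier A"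
    and F: "finite F" "{k. hpart A H x k \<noteq> \<zero>\<^bsub>A\<^esub>} \<subseteq> F"
  shows "hcomp A H B L i f x = finsum B (\<lambda>k. hpart B L (f (hpart A H x k)) (i + k)) F"
proof -
  have "finsum B (\<lambda>k. hpart B L (f (hpart A H x k)) (i + k)) {k. hpart A H x k \<noteq> \<zero>\<^bsub>A\<^esub>}
      = finsum B (\<lambda>k. hpart B L (f (hpart A H x k)) (i + k)) F"
    by (rule B.add.finprod_mono_neutral_cong_left)
      (use F x additive_zero[OF ag f] additiveD(1)[OF f] in auto)
  then show ?thesis using x unfolding hcomp_def by simp
qed

lemma hcomp_homogeneous:
  assumes f: "additive A B f" and x: "x \<in> H k"
  shows "hcomp A H B L i f x = hpart B L (f x) (i + k)"
proof -
  have x': "x \<in> carrier A" using A.comp_closed x .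
  have "hcomp A H B L i f x = finsum B (\<lambda>k. hpart B L (f (hpart A H x k)) (i + k)) {k}"
    by (rule hcomp_superset[OF f x']) (use A.hpart_hom[OF x] in auto)
  also have "\<dots> = hpart B L (f x) (i + k)"
    using A.hpart_hom[OF x] B.hpart_closed additiveD(1)[OF f x'] by simp
  finally show ?thesis .
qed

lemma hcomp_closed:
  assumes f: "additive A B f" and x: "x \<in> carrier A"
  shows "hcomp A H B L i f x \<in> carrier B"
proof -
  have "f (hpart A H x k) \<in> carrier B" for k using additiveD(1)[OF f] x by simp
  then show ?thesis unfolding hcomp_def using x by auto
qed

lemma hcomp_additive:
  assumes f: "additive A B f"
  shows "additive A B (hcomp A H B L i f)"
  unfolding additive_def
proof (intro conjI ballI Pi_I)
  fix x assume "x \<in> carrier A" then show "hcomp A H B L i f x \<in> carrier B" by (rule hcomp_closed[OF f])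
next
  fix x y assume xy: "x \<in> carrier A" "y \<in> carrier A"
  let ?F = "{k. hpart A H x k \<noteq> \<zero>\<^bsub>A\<^esub>} \<union> {k. hpart A H y k \<noteq> \<zero>\<^bsub>A\<^esub>}"
  let ?t = "\<lambda>x k. hpart B L (f (hpart A H x k)) (i + k)"
  have F: "finite ?F" using A.hpart_props(2) xy by blast
  have xy': "x \<oplus>\<^bsub>A\<^esub> y \<in> carrier A" using xy by simp
  have tc: "?t z k \<in> carrier B" if "z \<in> carrier A" for z k
    using that additiveD(1)[OF f] by simp
  have "{k. hpart A H (x \<oplus>\<^bsub>A\<^esub> y) k \<noteq> \<zero>\<^bsub>A\<^esub>} \<subseteq> ?F" using A.hpart_add[OF xy] by auto
  then have "hcomp A H B L i f (x \<oplus>\<^bsub>A\<^esub> y) = finsum B (?t (x \<oplus>\<^bsub>A\<^esub> y)) ?F"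
    by (rule hcomp_superset[OF f xy' F])
  also have "?t (x \<oplus>\<^bsub>A\<^esub> y) = (\<lambda>k. ?t x k \<oplus>\<^bsub>B\<^esub> ?t y k)"
    using xy A.hpart_add[OF xy] additiveD[OF f] by (simp add: B.hpart_add)
  also have "finsum B \<dots> ?F = finsum B (?t x) ?F \<oplus>\<^bsub>B\<^esub> finsum B (?t y) ?F"
    by (rule B.finsum_addf) (use tc xy in auto)
  also have "finsum B (?t x) ?F = hcomp A H B L i f x"
    using hcomp_superset[OF f xy(1) F] by simp
  also have "finsum B (?t y) ?F = hcomp A H B L i f y"
    using hcomp_superset[OF f xy(2) F] by simp
  finally show "hcomp A H B L i f (x \<oplus>\<^bsub>A\<^esub> y) = hcomp A H B L i f x \<oplus>\<^bsub>B\<^esub> hcomp A H B L i f y" .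
qed

lemma hcomp_degree:
  assumes f: "additive A B f"
  shows "hcomp A H B L i f ` H k \<subseteq> L (i + k)"
  using hcomp_homogeneous[OF f] B.hpart_props(1)[OF additiveD(1)[OF f A.comp_closed]] by auto

text \<open>The way components are identified later: guess an additive map and compare it with
  \<open>f\<close> on homogeneous elements.\<close>

lemma hcomp_eqI:
  assumes "additive A B f" "additive A B g" "\<And>k x. x \<in> H k \<Longrightarrow> g x = hpart B L (f x) (i + k)"
    and "x \<in> carrier A"
  shows "hcomp A H B L i f x = g x"
  by (rule A.additive_eqI[OF ag(2) hcomp_additive[OF assms(1)] assms(2) _ assms(4)])
    (use assms hcomp_homogeneous in auto)

lemma hcomp_of_degree:
  assumes "additive A B f" "\<And>k. f ` H k \<subseteq> L (i + k)" "x \<in> carrier A"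
  shows "hcomp A H B L j f x = (if j = i then f x else \<zero>\<^bsub>B\<^esub>)"
proof (rule hcomp_eqI[OF assms(1) _ _ assms(3)])
  show "additive A B (\<lambda>x. if j = i then f x else \<zero>\<^bsub>B\<^esub>)"
    using assms(1) unfolding additive_def by auto
  fix k x assume "x \<in> H k"
  then have "f x \<in> L (i + k)" using assms(2) by blast
  then show "(if j = i then f x else \<zero>\<^bsub>B\<^esub>) = hpart B L (f x) (j + k)"
    using B.hpart_hom by auto
qed

lemma hcomp_add:
  assumes f: "additive A B f" "additive A B g" and x: "x \<in> carrier A"
    and h: "\<And>x. x \<in> carrier A \<Longrightarrow> h x = f x \<oplus>\<^bsub>B\<^esub> g x"
  shows "hcomp A H B L i h x = hcomp A H B L i f x \<oplus>\<^bsub>B\<^esub> hcomp A H B L i g x"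
proof (rule hcomp_eqI[OF _ _ _ x])
  note c = additiveD[OF f(1)] additiveD[OF f(2)]
    additiveD[OF hcomp_additive[OF f(1)]] additiveD[OF hcomp_additive[OF f(2)]]
  show "additive A B h" unfolding additive_def using h c(1-4) by (auto simp: B.a_ac)
  show "additive A B (\<lambda>x. hcomp A H B L i f x \<oplus>\<^bsub>B\<^esub> hcomp A H B L i g x)"
    unfolding additive_def using c by (auto simp: B.a_ac)
  fix k x assume x: "x \<in> H k"
  then show "hcomp A H B L i f x \<oplus>\<^bsub>B\<^esub> hcomp A H B L i g x = hpart B L (h x) (i + k)"
    using h hcomp_homogeneous[OF _ x] f c A.comp_closed[OF x] by (simp add: B.hpart_add)
qed

text \<open>The claim is made for every finite set beyond some \<open>F\<close>. In this form it
  survives sums, since two such sets are merged by union, and for the same reason it can be met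
  simultaneously for finitely many generators.\<close>

lemma hcomp_sum_eventually:
  assumes f: "additive A B f" and x: "x \<in> carrier A"
  shows "\<exists>F. finite F \<and> (\<forall>F'. finite F' \<longrightarrow> F \<subseteq> F' \<longrightarrow>
           f x = finsum B (\<lambda>i. hcomp A H B L i f x) F')"
  using x
proof (induction rule: A.hom_induct)
  case zero
  have "hcomp A H B L i f \<zero>\<^bsub>A\<^esub> = \<zero>\<^bsub>B\<^esub>" for i
    using additive_zero[OF ag hcomp_additive[OF f]] .
  then show ?case using additive_zero[OF ag f] by (intro exI[of _ "{}"]) simp
next
  case (hom k x)
  have fx: "f x \<in> carrier B" using additiveD(1)[OF f A.comp_closed[OF hom]] .
  \<comment> \<open>For \<open>x\<close> of degree \<open>k\<close>, the part of \<open>f x\<close>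
    in degree \<open>l\<close> belongs to the component of degree \<open>l - k\<close>.\<close>
  let ?F = "(\<lambda>l. l - k) ` {l. hpart B L (f x) l \<noteq> \<zero>\<^bsub>B\<^esub>}"
  have "finite ?F" using B.hpart_props(2)[OF fx] by simp
  moreover have "f x = finsum B (\<lambda>i. hcomp A H B L i f x) F'" if F': "finite F'" "?F \<subseteq> F'" for F'
  proof -
    have sub: "{l. hpart B L (f x) l \<noteq> \<zero>\<^bsub>B\<^esub>} \<subseteq> (\<lambda>i. i + k) ` F'"
    proof
      fix l assume "l \<in> {l. hpart B L (f x) l \<noteq> \<zero>\<^bsub>B\<^esub>}"
      then have "l - k \<in> F'" using F'(2) by blast
      then show "l \<in> (\<lambda>i. i + k) ` F'" by (intro image_eqI[of _ _ "l - k"]) auto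
    qed
    have "f x = finsum B (hpart B L (f x)) ((\<lambda>i. i + k) ` F')"
      by (rule B.finsum_hpart) (use fx F'(1) sub in auto)
    also have "\<dots> = finsum B (\<lambda>i. hpart B L (f x) (i + k)) F'"
      by (rule B.finsum_reindex) (use fx in \<open>auto simp: inj_on_def\<close>)
    also have "\<dots> = finsum B (\<lambda>i. hcomp A H B L i f x) F'"
      using hcomp_homogeneous[OF f hom] by simp
    finally show ?thesis .
  qed
  ultimately show ?case by blast
next
  case (add x y)
  from add(3,4) obtain F F' where
    F: "finite F" "\<And>T. finite T \<Longrightarrow> F \<subseteq> T \<Longrightarrow> f x = finsum B (\<lambda>i. hcomp A H B L i f x) T" and
    F': "finite F'" "\<And>T. finite T \<Longrightarrow> F' \<subseteq> T \<Longrightarrow> f y = finsum B (\<lambda>i. hcomp A H B L i f y) T"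
    by blast
  have "f (x \<oplus>\<^bsub>A\<^esub> y) = finsum B (\<lambda>i. hcomp A H B L i f (x \<oplus>\<^bsub>A\<^esub> y)) T"
    if T: "finite T" "F \<union> F' \<subseteq> T" for T
  proof -
    have "f (x \<oplus>\<^bsub>A\<^esub> y) = f x \<oplus>\<^bsub>B\<^esub> f y" using additiveD(2)[OF f add(1,2)] .
    also have "\<dots> = finsum B (\<lambda>i. hcomp A H B L i f x) T \<oplus>\<^bsub>B\<^esub> finsum B (\<lambda>i. hcomp A H B L i f y) T"
      using F(2)[OF T(1)] F'(2)[OF T(1)] T(2) by simp
    also have "\<dots> = finsum B (\<lambda>i. hcomp A H B L i f x \<oplus>\<^bsub>B\<^esub> hcomp A H B L i f y) T"
      by (rule B.finsum_addf[symmetric]) (use hcomp_closed[OF f] add in auto)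
    finally show ?thesis using additiveD(2)[OF hcomp_additive[OF f] add(1,2)] by simp
  qed
  then show ?case using F(1) F'(1) by (intro exI[of _ "F \<union> F'"]) blast
qed

end

section \<open>Right modules\<close>

context right_module begin

lemma act_zero_left: "r \<in> carrier R \<Longrightarrow> \<zero>\<^bsub>M\<^esub> \<triangleleft>\<^bsub>M\<^esub> r = \<zero>\<^bsub>M\<^esub>"
  by (rule additive_zero[OF M.abelian_group_axioms M.abelian_group_axioms, of "\<lambda>x. x \<triangleleft>\<^bsub>M\<^esub> r"])
    (auto simp: additive_def act_closed act_add_left)

lemma act_zero_right: "x \<in> carrier M \<Longrightarrow> x \<triangleleft>\<^bsub>M\<^esub> \<zero>\<^bsub>R\<^esub> = \<zero>\<^bsub>M\<^esub>"
  by (rule additive_zero[OF R.abelian_group_axioms M.abelian_group_axioms, of "\<lambda>r. x \<triangleleft>\<^bsub>M\<^esub> r"])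
    (auto simp: additive_def act_closed act_add_right)

lemma act_minus_left:
  assumes "r \<in> carrier R" "x \<in> carrier M"
  shows "(\<ominus>\<^bsub>M\<^esub> x) \<triangleleft>\<^bsub>M\<^esub> r = \<ominus>\<^bsub>M\<^esub> (x \<triangleleft>\<^bsub>M\<^esub> r)"
  by (rule additive_inv[OF M.abelian_group_axioms M.abelian_group_axioms, of "\<lambda>x. x \<triangleleft>\<^bsub>M\<^esub> r"])
    (use assms in \<open>auto simp: additive_def act_closed act_add_left\<close>)

end

lemma rmod_homI:
  assumes "\<And>x. x \<in> carrier M \<Longrightarrow> f x \<in> carrier N"
    and "\<And>x y. x \<in> carrier M \<Longrightarrow> y \<in> carrier M \<Longrightarrow> f (x \<oplus>\<^bsub>M\<^esub> y) = f x \<oplus>\<^bsub>N\<^esub> f y"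
    and "\<And>x r. x \<in> carrier M \<Longrightarrow> r \<in> carrier R \<Longrightarrow> f (x \<triangleleft>\<^bsub>M\<^esub> r) = f x \<triangleleft>\<^bsub>N\<^esub> r"
  shows "f \<in> rmod_hom R M N"
  using assms unfolding rmod_hom_def by auto

lemma rmod_homD:
  assumes "f \<in> rmod_hom R M N"
  shows "x \<in> carrier M \<Longrightarrow> f x \<in> carrier N"
    "x \<in> carrier M \<Longrightarrow> y \<in> carrier M \<Longrightarrow> f (x \<oplus>\<^bsub>M\<^esub> y) = f x \<oplus>\<^bsub>N\<^esub> f y"
    "x \<in> carrier M \<Longrightarrow> r \<in> carrier R \<Longrightarrow> f (x \<triangleleft>\<^bsub>M\<^esub> r) = f x \<triangleleft>\<^bsub>N\<^esub> r"
    "additive M N f"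
  using assms unfolding rmod_hom_def additive_def by auto

lemma rmod_hom_zero:
  assumes "right_module R M" "right_module R N" "f \<in> rmod_hom R M N"
  shows "f \<zero>\<^bsub>M\<^esub> = \<zero>\<^bsub>N\<^esub>"
  using additive_zero[OF _ _ rmod_homD(4)[OF assms(3)]] assms(1,2) unfolding right_module_def by blast

lemma rmod_hom_comp:
  assumes "f \<in> rmod_hom R L M" "g \<in> rmod_hom R M N"
  shows "(\<lambda>x. g (f x)) \<in> rmod_hom R L N"
  using rmod_homD[OF assms(1)] rmod_homD[OF assms(2)] by (intro rmod_homI) auto

lemma rmod_hom_cong:
  assumes "right_module R M" "f \<in> rmod_hom R M N" "\<And>x. x \<in> carrier M \<Longrightarrow> g x = f x"
  shows "g \<in> rmod_hom R M N"
proof -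
  interpret right_module R M by fact
  show ?thesis using rmod_homD[OF assms(2)] assms(3) act_closed by (intro rmod_homI) auto
qed

lemma rmod_hom_restrict:
  assumes "right_module R M" "f \<in> rmod_hom R M N"
  shows "restrict f (carrier M) \<in> rmod_hom R M N"
  by (rule rmod_hom_cong[OF assms]) simp

lemma rmod_hom_add:
  assumes "right_module R N" "f \<in> rmod_hom R M N" "g \<in> rmod_hom R M N"
  shows "(\<lambda>x. f x \<oplus>\<^bsub>N\<^esub> g x) \<in> rmod_hom R M N"
proof -
  interpret N: right_module R N by fact
  show ?thesis using rmod_homD[OF assms(2)] rmod_homD[OF assms(3)]
    by (intro rmod_homI) (auto simp: N.M.a_ac N.act_add_left)
qed

lemma rmod_hom_inv:
  assumes "right_module R N" "f \<in> rmod_hom R M N"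
  shows "(\<lambda>x. \<ominus>\<^bsub>N\<^esub> f x) \<in> rmod_hom R M N"
proof -
  interpret N: right_module R N by fact
  show ?thesis using rmod_homD[OF assms(2)]
    by (intro rmod_homI) (auto simp: N.M.a_ac N.act_minus_left N.M.minus_add)
qed

lemma rmod_hom_minus:
  assumes "right_module R N" "f \<in> rmod_hom R M N" "g \<in> rmod_hom R M N"
  shows "(\<lambda>x. f x \<ominus>\<^bsub>N\<^esub> g x) \<in> rmod_hom R M N"
  using rmod_hom_add[OF assms(1,2) rmod_hom_inv[OF assms(1,3)]] by (simp add: a_minus_def)

lemma rmod_hom_const_zero:
  assumes "right_module R N"
  shows "(\<lambda>x. \<zero>\<^bsub>N\<^esub>) \<in> rmod_hom R M N"
proof -
  interpret N: right_module R N by fact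
  show ?thesis by (intro rmod_homI) (auto simp: N.act_zero_left)
qed

section \<open>Free and projective modules\<close>

lemma free_rmodule_simps [simp]:
  "zero (free_rmodule R X) = (\<lambda>x. \<zero>\<^bsub>R\<^esub>)"
  "add (free_rmodule R X) v w = (\<lambda>x. v x \<oplus>\<^bsub>R\<^esub> w x)"
  "act (free_rmodule R X) v r = (\<lambda>x. v x \<otimes>\<^bsub>R\<^esub> r)"
  by (simp_all add: free_rmodule_def)

lemma free_rmodule_carrier:
  "v \<in> carrier (free_rmodule R X) \<longleftrightarrow>
     (\<forall>x\<in>X. v x \<in> carrier R) \<and> (\<forall>x. x \<notin> X \<longrightarrow> v x = \<zero>\<^bsub>R\<^esub>) \<and> finite {x. v x \<noteq> \<zero>\<^bsub>R\<^esub>}"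
  by (simp add: free_rmodule_def)

context ring begin

lemma free_rmodule_closed: "v \<in> carrier (free_rmodule R X) \<Longrightarrow> v x \<in> carrier R"
  by (cases "x \<in> X") (auto simp: free_rmodule_carrier)

lemma right_module_free: "right_module R (free_rmodule R X)"
proof -
  let ?F = "free_rmodule R X"
  note c = free_rmodule_closed[of _ X]
  have "abelian_group ?F"
  proof (rule abelian_groupI)
    fix v w assume v: "v \<in> carrier ?F" and w: "w \<in> carrier ?F"
    have "{x. v x \<oplus> w x \<noteq> \<zero>} \<subseteq> {x. v x \<noteq> \<zero>} \<union> {x. w x \<noteq> \<zero>}" by auto
    then have "finite {x. v x \<oplus> w x \<noteq> \<zero>}"
      by (rule finite_subset) (use v w in \<open>simp add: free_rmodule_carrier\<close>)
    then show "v \<oplus>\<^bsub>?F\<^esub> w \<in> carrier ?F" using v w c by (auto simp: free_rmodule_carrier)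
  next
    fix v assume v: "v \<in> carrier ?F"
    have "{x. \<ominus> v x \<noteq> \<zero>} \<subseteq> {x. v x \<noteq> \<zero>}" by auto
    then have "finite {x. \<ominus> v x \<noteq> \<zero>}"
      by (rule finite_subset) (use v in \<open>simp add: free_rmodule_carrier\<close>)
    then have "(\<lambda>x. \<ominus> v x) \<in> carrier ?F" using v c by (auto simp: free_rmodule_carrier)
    then show "\<exists>y\<in>carrier ?F. y \<oplus>\<^bsub>?F\<^esub> v = \<zero>\<^bsub>?F\<^esub>"
      by (rule bexI[rotated]) (use c[OF v] in \<open>simp add: l_neg\<close>)
  qed (use c in \<open>auto simp: free_rmodule_carrier a_ac\<close>)
  moreover have "v \<triangleleft>\<^bsub>?F\<^esub> r \<in> carrier ?F" if v: "v \<in> carrier ?F" and r: "r \<in> carrier R" for v r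
  proof -
    have "{x. v x \<otimes> r \<noteq> \<zero>} \<subseteq> {x. v x \<noteq> \<zero>}" using r by auto
    then have "finite {x. v x \<otimes> r \<noteq> \<zero>}"
      by (rule finite_subset) (use v in \<open>simp add: free_rmodule_carrier\<close>)
    then show ?thesis using v r c by (auto simp: free_rmodule_carrier)
  qed
  ultimately show ?thesis
    unfolding right_module_def right_module_axioms_def
    using ring_axioms c by (auto simp: l_distr r_distr m_assoc)
qed

definition basis_vec :: "'x \<Rightarrow> 'x \<Rightarrow> 'a" where
  "basis_vec a = (\<lambda>x. if x = a then \<one> else \<zero>)"

lemma basis_vec_closed: "a \<in> X \<Longrightarrow> basis_vec a \<in> carrier (free_rmodule R X)"
  unfolding free_rmodule_carrier basis_vec_def by auto

text \<open>Induction on the size of the support: one nonzero coordinate is split off as a scalar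
  multiple of a basis vector.\<close>

lemma free_rmodule_hom_eqI:
  assumes N: "right_module R N" and f: "f \<in> rmod_hom R (free_rmodule R X) N"
    and g: "g \<in> rmod_hom R (free_rmodule R X) N"
    and eq: "\<And>a. a \<in> X \<Longrightarrow> f (basis_vec a) = g (basis_vec a)"
    and v: "v \<in> carrier (free_rmodule R X)"
  shows "f v = g v"
  using v
proof (induction "card {x. v x \<noteq> \<zero>}" arbitrary: v)
  let ?F = "free_rmodule R X"
  interpret F: right_module R ?F by (rule right_module_free)
  interpret N: right_module R N by fact
  case 0
  then have "v = \<zero>\<^bsub>?F\<^esub>" by (auto simp: free_rmodule_carrier)
  then show ?case using rmod_hom_zero[OF F.right_module_axioms N f] rmod_hom_zero[OF F.right_module_axioms N g]
    by metis
next
  case (Suc n)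
  let ?F = "free_rmodule R X"
  from Suc(2) obtain a where a: "v a \<noteq> \<zero>" by (metis (mono_tags, lifting) card.empty empty_Collect_eq nat.distinct(1))
  have aX: "a \<in> X" and va: "v a \<in> carrier R" using a Suc(3) by (auto simp: free_rmodule_carrier)
  let ?w = "v(a := \<zero>)" and ?b = "basis_vec a \<triangleleft>\<^bsub>?F\<^esub> v a"
  have fin: "finite {x. v x \<noteq> \<zero>}" using Suc(3) by (simp add: free_rmodule_carrier)
  have s: "{x. ?w x \<noteq> \<zero>} = {x. v x \<noteq> \<zero>} - {a}" by auto
  have w: "?w \<in> carrier ?F" using Suc(3) fin unfolding free_rmodule_carrier s by auto
  have "card {x. ?w x \<noteq> \<zero>} = n" unfolding s using Suc(2) a fin by simp
  then have fw: "f ?w = g ?w" using Suc(1)[OF _ w] by simp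
  have b: "?b \<in> carrier ?F"
    using right_module.act_closed[OF right_module_free basis_vec_closed[OF aX] va] .
  have fb: "f ?b = g ?b"
    using rmod_homD(3)[OF f basis_vec_closed[OF aX] va] rmod_homD(3)[OF g basis_vec_closed[OF aX] va]
      eq[OF aX] by simp
  have "v = ?w \<oplus>\<^bsub>?F\<^esub> ?b"
    using free_rmodule_closed[OF Suc(3)] va by (auto simp: basis_vec_def)
  then show ?case using rmod_homD(2)[OF f w b] rmod_homD(2)[OF g w b] fw fb by metis
qed

lemma free_rmodule_hom_exists:
  assumes N: "right_module R N" and y: "\<And>a. a \<in> X \<Longrightarrow> y a \<in> carrier N"
  shows "\<exists>\<phi>\<in>rmod_hom R (free_rmodule R X) N. \<forall>a\<in>X. \<phi> (basis_vec a) = y a"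
proof -
  let ?F = "free_rmodule R X"
  interpret N: right_module R N by fact
  \<comment> \<open>The combination of the prescribed images with the coefficients of
    \<open>v\<close>. Only the support of \<open>v\<close> enters, and it lies in \<open>X\<close>,
    where \<open>y\<close> is controlled.\<close>
  define \<phi> where "\<phi> v = finsum N (\<lambda>x. y x \<triangleleft>\<^bsub>N\<^esub> v x) {x. v x \<noteq> \<zero>}" for v
  have tc: "y x \<triangleleft>\<^bsub>N\<^esub> v x \<in> carrier N" if "v \<in> carrier ?F" "x \<in> X" for x v
    using N.act_closed[OF y[OF that(2)] free_rmodule_closed[OF that(1)]] .
  have sup: "{x. v x \<noteq> \<zero>} \<subseteq> X" "finite {x. v x \<noteq> \<zero>}" if "v \<in> carrier ?F" for v
    using that by (auto simp: free_rmodule_carrier)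
  have ext: "\<phi> v = finsum N (\<lambda>x. y x \<triangleleft>\<^bsub>N\<^esub> v x) T"
    if v: "v \<in> carrier ?F" and T: "finite T" "T \<subseteq> X" "{x. v x \<noteq> \<zero>} \<subseteq> T" for v T
    unfolding \<phi>_def
  proof (rule N.M.add.finprod_mono_neutral_cong_left)
    show "\<And>i. i \<in> T - {x. v x \<noteq> \<zero>} \<Longrightarrow> y i \<triangleleft>\<^bsub>N\<^esub> v i = \<zero>\<^bsub>N\<^esub>"
      using T(2) y N.act_zero_right by auto
    show "(\<lambda>x. y x \<triangleleft>\<^bsub>N\<^esub> v x) \<in> T \<rightarrow> carrier N" using tc[OF v] T(2) by blast
  qed (use T in auto)
  have closed: "\<phi> v \<in> carrier N" if v: "v \<in> carrier ?F" for v
    unfolding \<phi>_def using tc[OF v] sup[OF v] by (intro N.M.finsum_closed) auto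
  have "\<phi> \<in> rmod_hom R ?F N"
  proof (rule rmod_homI)
    fix v w assume v: "v \<in> carrier ?F" and w: "w \<in> carrier ?F"
    let ?T = "{x. v x \<noteq> \<zero>} \<union> {x. w x \<noteq> \<zero>}"
    have T: "finite ?T" "?T \<subseteq> X" using sup[OF v] sup[OF w] by auto
    interpret F: right_module R ?F by (rule right_module_free)
    have vw: "v \<oplus>\<^bsub>?F\<^esub> w \<in> carrier ?F" using v w by blast
    have "\<phi> (v \<oplus>\<^bsub>?F\<^esub> w) = finsum N (\<lambda>x. y x \<triangleleft>\<^bsub>N\<^esub> (v \<oplus>\<^bsub>?F\<^esub> w) x) ?T"
      by (rule ext[OF vw T]) auto
    also have "\<dots> = finsum N (\<lambda>x. y x \<triangleleft>\<^bsub>N\<^esub> v x \<oplus>\<^bsub>N\<^esub> y x \<triangleleft>\<^bsub>N\<^esub> w x) ?T"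
    proof (rule N.M.finsum_cong')
      show "(\<lambda>x. y x \<triangleleft>\<^bsub>N\<^esub> v x \<oplus>\<^bsub>N\<^esub> y x \<triangleleft>\<^bsub>N\<^esub> w x) \<in> ?T \<rightarrow> carrier N"
        using tc[OF v] tc[OF w] T(2) by blast
      fix x assume "x \<in> ?T"
      then have "y x \<in> carrier N" using T(2) y by blast
      then show "y x \<triangleleft>\<^bsub>N\<^esub> (v \<oplus>\<^bsub>?F\<^esub> w) x = y x \<triangleleft>\<^bsub>N\<^esub> v x \<oplus>\<^bsub>N\<^esub> y x \<triangleleft>\<^bsub>N\<^esub> w x"
        using N.act_add_right free_rmodule_closed[OF v] free_rmodule_closed[OF w] by simp
    qed simp
    also have "\<dots> = finsum N (\<lambda>x. y x \<triangleleft>\<^bsub>N\<^esub> v x) ?T \<oplus>\<^bsub>N\<^esub> finsum N (\<lambda>x. y x \<triangleleft>\<^bsub>N\<^esub> w x) ?T"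
      by (rule N.M.finsum_addf) (use tc[OF v] tc[OF w] T(2) in blast)+
    also have "finsum N (\<lambda>x. y x \<triangleleft>\<^bsub>N\<^esub> v x) ?T = \<phi> v" by (rule ext[OF v T, symmetric]) auto
    also have "finsum N (\<lambda>x. y x \<triangleleft>\<^bsub>N\<^esub> w x) ?T = \<phi> w" by (rule ext[OF w T, symmetric]) auto
    finally show "\<phi> (v \<oplus>\<^bsub>?F\<^esub> w) = \<phi> v \<oplus>\<^bsub>N\<^esub> \<phi> w" .
  next
    fix v r assume v: "v \<in> carrier ?F" and r: "r \<in> carrier R"
    let ?T = "{x. v x \<noteq> \<zero>}"
    have vr: "v \<triangleleft>\<^bsub>?F\<^esub> r \<in> carrier ?F" using right_module.act_closed[OF right_module_free v r] .
    have "\<phi> (v \<triangleleft>\<^bsub>?F\<^esub> r) = finsum N (\<lambda>x. y x \<triangleleft>\<^bsub>N\<^esub> (v \<triangleleft>\<^bsub>?F\<^esub> r) x) ?T"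
      by (rule ext[OF vr sup(2,1)[OF v]]) (use r in auto)
    also have "\<dots> = finsum N (\<lambda>x. (y x \<triangleleft>\<^bsub>N\<^esub> v x) \<triangleleft>\<^bsub>N\<^esub> r) ?T"
    proof (rule N.M.finsum_cong')
      show "(\<lambda>x. (y x \<triangleleft>\<^bsub>N\<^esub> v x) \<triangleleft>\<^bsub>N\<^esub> r) \<in> ?T \<rightarrow> carrier N"
        using tc[OF v] sup[OF v] N.act_closed[OF _ r] by blast
      fix x assume "x \<in> ?T"
      then have "y x \<in> carrier N" using sup[OF v] y by blast
      then show "y x \<triangleleft>\<^bsub>N\<^esub> (v \<triangleleft>\<^bsub>?F\<^esub> r) x = (y x \<triangleleft>\<^bsub>N\<^esub> v x) \<triangleleft>\<^bsub>N\<^esub> r"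
        using N.act_assoc free_rmodule_closed[OF v] r by simp
    qed simp
    also have "\<dots> = \<phi> v \<triangleleft>\<^bsub>N\<^esub> r" unfolding \<phi>_def
      by (rule additive_finsum[OF N.M.abelian_group_axioms N.M.abelian_group_axioms, symmetric,
        of "\<lambda>x. x \<triangleleft>\<^bsub>N\<^esub> r"])
        (use tc[OF v] sup[OF v] in \<open>auto simp: additive_def N.act_add_left N.act_closed r\<close>)
    finally show "\<phi> (v \<triangleleft>\<^bsub>?F\<^esub> r) = \<phi> v \<triangleleft>\<^bsub>N\<^esub> r" .
  qed (rule closed)
  moreover have "\<phi> (basis_vec a) = y a" if a: "a \<in> X" for a
  proof -
    have "\<phi> (basis_vec a) = finsum N (\<lambda>x. y x \<triangleleft>\<^bsub>N\<^esub> basis_vec a x) {a}"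
      by (rule ext) (use a basis_vec_closed in \<open>auto simp: basis_vec_def\<close>)
    then show ?thesis using y[OF a] N.act_one by (simp add: basis_vec_def N.act_closed)
  qed
  ultimately show ?thesis by blast
qed

end

text \<open>Preimages under \<open>e\<close> are chosen for the images of the basis vectors, and the
  resulting map is precomposed with the section \<open>s\<close>. Asking only that the image of
  \<open>f\<close> lie in that of \<open>e\<close> allows lifting into a kernel that is the image of
  a differential, without forming that kernel as a module.\<close>

lemma projective_lift:
  fixes P :: "('r, 'p, 'e) rmodule_scheme"
  assumes P: "projective R P" and Q: "right_module R Q" and N: "right_module R N"
    and e: "e \<in> rmod_hom R Q N" and f: "f \<in> rmod_hom R P N"
    and im: "f ` carrier P \<subseteq> e ` carrier Q"
  shows "\<exists>h\<in>rmod_hom R P Q. \<forall>x\<in>carrier P. e (h x) = f x"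
proof -
  interpret Q: right_module R Q by fact
  obtain X :: "'p set" and s q where s: "s \<in> rmod_hom R P (free_rmodule R X)"
    and q: "q \<in> rmod_hom R (free_rmodule R X) P" and qs: "\<forall>x\<in>carrier P. q (s x) = x"
    using P unfolding projective_def by blast
  have "\<forall>a\<in>X. \<exists>y\<in>carrier Q. e y = f (q (Q.basis_vec a))"
  proof
    fix a assume "a \<in> X"
    then have "f (q (Q.basis_vec a)) \<in> e ` carrier Q"
      using rmod_homD(1)[OF q Q.basis_vec_closed] im by blast
    then show "\<exists>y\<in>carrier Q. e y = f (q (Q.basis_vec a))" by auto
  qed
  then obtain y where y: "\<And>a. a \<in> X \<Longrightarrow> y a \<in> carrier Q"
    "\<And>a. a \<in> X \<Longrightarrow> e (y a) = f (q (Q.basis_vec a))"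
    by metis
  obtain \<phi> where \<phi>: "\<phi> \<in> rmod_hom R (free_rmodule R X) Q" "\<forall>a\<in>X. \<phi> (Q.basis_vec a) = y a"
    using Q.free_rmodule_hom_exists[OF Q, of X y] y(1) by blast
  have "e (\<phi> v) = f (q v)" if "v \<in> carrier (free_rmodule R X)" for v
    by (rule Q.free_rmodule_hom_eqI[OF N rmod_hom_comp[OF \<phi>(1) e] rmod_hom_comp[OF q f] _ that])
      (use \<phi>(2) y(2) in simp)
  then have "\<forall>x\<in>carrier P. e (\<phi> (s x)) = f x" using rmod_homD(1)[OF s] qs by simp
  then show ?thesis by (rule bexI[OF _ rmod_hom_comp[OF s \<phi>(1)]])
qed

section \<open>Homogeneous components of module homomorphisms\<close>

lemma graded_module_group:
  assumes "graded_module R M"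
  shows "graded_group M (mcomp M)" "right_module R M" "abelian_group M"
proof -
  interpret graded_module R M by fact
  show "graded_group M (mcomp M)" by unfold_locales (rule grading)
  show "right_module R M" "abelian_group M" by unfold_locales
qed

lemma graded_module_pair:
  assumes "graded_module R M" "graded_module R N"
  shows "graded_pair M (mcomp M) N (mcomp N)"
  using graded_module_group(1)[OF assms(1)] graded_module_group(1)[OF assms(2)]
  unfolding graded_pair_def by blast

abbreviation hom_comp :: "('r, 'm) gr_module \<Rightarrow> ('r, 'n) gr_module \<Rightarrow> int \<Rightarrow> ('m \<Rightarrow> 'n) \<Rightarrow> 'm \<Rightarrow> 'n" where
  "hom_comp M N \<equiv> hcomp M (mcomp M) N (mcomp N)"

text \<open>Acting by a scalar of degree \<open>i\<close> is an additive map of degree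
  \<open>i\<close>, so this is an instance of \<open>hpart_map\<close>.\<close>

lemma hpart_act:
  assumes M: "graded_module R M" and "x \<in> carrier M" "r \<in> carrier R" "r \<in> acomp R i"
  shows "hpart M (mcomp M) (x \<triangleleft>\<^bsub>M\<^esub> r) (int i + k) = hpart M (mcomp M) x k \<triangleleft>\<^bsub>M\<^esub> r"
proof (rule hpart_map[OF graded_module_group(1)[OF M] graded_module_group(1)[OF M]])
  interpret graded_module R M by fact
  show "additive M M (\<lambda>x. x \<triangleleft>\<^bsub>M\<^esub> r)"
    unfolding additive_def using assms act_closed act_add_left by auto
  show "(\<lambda>x. x \<triangleleft>\<^bsub>M\<^esub> r) ` mcomp M k \<subseteq> mcomp M (int i + k)" for k
    using mcomp_act[OF _ assms(4)] by (auto simp: add.commute)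
qed fact

text \<open>Linearity is tested on homogeneous scalars and then on homogeneous elements. There a
  component is a single part of the image, and a homogeneous scalar merely shifts parts.\<close>

lemma hom_comp_rmod_hom:
  assumes M: "graded_module R M" and N: "graded_module R N" and R: "is_grading R (acomp R)"
    and f: "f \<in> rmod_hom R M N"
  shows "hom_comp M N j f \<in> rmod_hom R M N"
proof -
  interpret M: graded_module R M by fact
  interpret N: graded_module R N by fact
  interpret R: graded_group R "acomp R" by unfold_locales (rule R)
  interpret graded_pair M "mcomp M" N "mcomp N" by (rule graded_module_pair[OF M N])
  note fa = rmod_homD(4)[OF f]
  note ca = hcomp_additive[OF fa, of j]
  show ?thesis
  proof (rule rmod_homI)
    fix x r assume x: "x \<in> carrier M" and r: "r \<in> carrier R"
    from r show "hom_comp M N j f (x \<triangleleft>\<^bsub>M\<^esub> r) = hom_comp M N j f x \<triangleleft>\<^bsub>N\<^esub> r"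
    proof (induction rule: R.hom_induct)
      case zero
      show ?case using x M.act_zero_right N.act_zero_right additiveD(1)[OF ca] additive_zero[OF ag ca]
        by simp
    next
      case (add r s)
      then show ?case using x M.act_add_right N.act_add_right M.act_closed additiveD[OF ca] by simp
    next
      case (hom i r)
      have r: "r \<in> carrier R" using R.comp_closed hom .
      show ?case
      proof (rule A.additive_eqI[OF ag(2) _ _ _ x])
        have "additive M M (\<lambda>x. x \<triangleleft>\<^bsub>M\<^esub> r)"
          unfolding additive_def using r M.act_closed M.act_add_left by auto
        from additive_comp[OF this ca] show "additive M N (\<lambda>x. hom_comp M N j f (x \<triangleleft>\<^bsub>M\<^esub> r))" .
        have "additive N N (\<lambda>x. x \<triangleleft>\<^bsub>N\<^esub> r)"
          unfolding additive_def using r N.act_closed N.act_add_left by auto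
        from additive_comp[OF ca this] show "additive M N (\<lambda>x. hom_comp M N j f x \<triangleleft>\<^bsub>N\<^esub> r)" .
        fix k x assume x: "x \<in> mcomp M k"
        have xc: "x \<in> carrier M" using A.comp_closed[OF x] .
        have "hom_comp M N j f (x \<triangleleft>\<^bsub>M\<^esub> r) = hpart N (mcomp N) (f x \<triangleleft>\<^bsub>N\<^esub> r) (int i + (j + k))"
          using hcomp_homogeneous[OF fa M.mcomp_act[OF x hom]] rmod_homD(3)[OF f xc r]
          by (simp add: algebra_simps)
        also have "\<dots> = hpart N (mcomp N) (f x) (j + k) \<triangleleft>\<^bsub>N\<^esub> r"
          by (rule hpart_act[OF N rmod_homD(1)[OF f xc] r hom])
        finally show "hom_comp M N j f (x \<triangleleft>\<^bsub>M\<^esub> r) = hom_comp M N j f x \<triangleleft>\<^bsub>N\<^esub> r"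
          using hcomp_homogeneous[OF fa x] by simp
      qed
    qed
  qed (use additiveD[OF ca] in auto)
qed

lemma has_degree_comp:
  assumes "has_degree L M i f" "has_degree M N j g"
  shows "has_degree L N (j + i) (\<lambda>x. g (f x))"
  unfolding has_degree_def
proof (intro allI image_subsetI)
  fix k x assume "x \<in> mcomp L k"
  then have "f x \<in> mcomp M (i + k)" using assms(1) unfolding has_degree_def by blast
  then show "g (f x) \<in> mcomp N (j + i + k)"
    using assms(2) unfolding has_degree_def by (metis add.assoc image_subset_iff)
qed

lemma hom_comp_has_degree:
  assumes M: "graded_module R M" and N: "graded_module R N" and f: "f \<in> rmod_hom R M N"
  shows "has_degree M N j (hom_comp M N j f)"
proof -
  interpret graded_pair M "mcomp M" N "mcomp N" by (rule graded_module_pair[OF M N])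
  show ?thesis unfolding has_degree_def using hcomp_degree[OF rmod_homD(4)[OF f]] by blast
qed

lemma hom_comp_of_degree:
  assumes M: "graded_module R M" and N: "graded_module R N" and f: "f \<in> rmod_hom R M N"
    and "has_degree M N i f" "x \<in> carrier M"
  shows "hom_comp M N j f x = (if j = i then f x else \<zero>\<^bsub>N\<^esub>)"
proof -
  interpret graded_pair M "mcomp M" N "mcomp N" by (rule graded_module_pair[OF M N])
  show ?thesis using hcomp_of_degree[OF rmod_homD(4)[OF f] _ assms(5)] assms(4)
    unfolding has_degree_def by blast
qed

text \<open>Degree 0 maps do not mix components. With a differential as \<open>d\<close>, this will
  show that components preserve cocycles and coboundaries. The separate \<open>h\<close> admits
  restricted composites, which agree with \<open>f\<close> after \<open>d\<close> only on the
  carrier.\<close>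

lemma hom_comp_precomp:
  assumes L: "graded_module R L" and M: "graded_module R M" and N: "graded_module R N"
    and d: "d \<in> rmod_hom R L M" "has_degree L M 0 d" and f: "f \<in> rmod_hom R M N"
    and x: "x \<in> carrier L" and h: "\<And>x. x \<in> carrier L \<Longrightarrow> h x = f (d x)"
  shows "hom_comp L N j h x = hom_comp M N j f (d x)"
proof -
  interpret MN: graded_pair M "mcomp M" N "mcomp N" by (rule graded_module_pair[OF M N])
  interpret LN: graded_pair L "mcomp L" N "mcomp N" by (rule graded_module_pair[OF L N])
  note fa = rmod_homD(4)[OF f] and da = rmod_homD(4)[OF d(1)]
  have ha: "h \<in> rmod_hom R L N"
    by (rule rmod_hom_cong[OF graded_module_group(2)[OF L] rmod_hom_comp[OF d(1) f]]) (rule h)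
  show ?thesis
  proof (rule LN.hcomp_eqI[OF rmod_homD(4)[OF ha] _ _ x])
    show "additive L N (\<lambda>x. hom_comp M N j f (d x))"
      by (rule additive_comp[OF da MN.hcomp_additive[OF fa]])
    fix k x assume x: "x \<in> mcomp L k"
    then have "d x \<in> mcomp M k" using d(2) unfolding has_degree_def by auto
    then show "hom_comp M N j f (d x) = hpart N (mcomp N) (h x) (j + k)"
      using MN.hcomp_homogeneous[OF fa] h[OF LN.A.comp_closed[OF x]] by simp
  qed
qed

text \<open>The counterpart on the other side: a component of a lift is a lift of the component,
  which makes lifts homogeneous.\<close>

lemma hom_comp_postcomp:
  assumes L: "graded_module R L" and M: "graded_module R M" and N: "graded_module R N"
    and f: "f \<in> rmod_hom R L M" and e: "e \<in> rmod_hom R M N" "has_degree M N 0 e"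
    and x: "x \<in> carrier L" and h: "\<And>x. x \<in> carrier L \<Longrightarrow> h x = e (f x)"
  shows "hom_comp L N j h x = e (hom_comp L M j f x)"
proof -
  interpret LM: graded_pair L "mcomp L" M "mcomp M" by (rule graded_module_pair[OF L M])
  interpret LN: graded_pair L "mcomp L" N "mcomp N" by (rule graded_module_pair[OF L N])
  note fa = rmod_homD(4)[OF f] and ea = rmod_homD(4)[OF e(1)]
  have ha: "h \<in> rmod_hom R L N"
    by (rule rmod_hom_cong[OF graded_module_group(2)[OF L] rmod_hom_comp[OF f e(1)]]) (rule h)
  show ?thesis
  proof (rule LN.hcomp_eqI[OF rmod_homD(4)[OF ha] _ _ x])
    show "additive L N (\<lambda>x. e (hom_comp L M j f x))"
      by (rule additive_comp[OF LM.hcomp_additive[OF fa] ea])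
    fix k x assume x: "x \<in> mcomp L k"
    have "hpart N (mcomp N) (e (f x)) (0 + (j + k)) = e (hpart M (mcomp M) (f x) (j + k))"
      by (rule hpart_map[OF LM.B.graded_group_axioms LN.B.graded_group_axioms ea])
        (use e(2) rmod_homD(1)[OF f LM.A.comp_closed[OF x]] in \<open>auto simp: has_degree_def\<close>)
    then show "e (hom_comp L M j f x) = hpart N (mcomp N) (h x) (j + k)"
      using LM.hcomp_homogeneous[OF fa x] h[OF LM.A.comp_closed[OF x]] by simp
  qed
qed

text \<open>Each generator has its own finite set of degrees; their union works for all elements,
  because the elements at which \<open>f\<close> equals the finite sum of components form a
  submodule.\<close>

lemma finitely_generated_hom_finite_sum:
  assumes M: "graded_module R M" and N: "graded_module R N" and R: "is_grading R (acomp R)"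
    and f: "f \<in> rmod_hom R M N" and fg: "finitely_generated R M"
  shows "\<exists>F. finite F \<and> (\<forall>x\<in>carrier M. f x = finsum N (\<lambda>i. hom_comp M N i f x) F)"
proof -
  interpret M: graded_module R M by fact
  interpret N: graded_module R N by fact
  interpret graded_pair M "mcomp M" N "mcomp N" by (rule graded_module_pair[OF M N])
  note fa = rmod_homD(4)[OF f]
  note hc = rmod_homD[OF hom_comp_rmod_hom[OF M N R f]]
  obtain S where S: "finite S" "S \<subseteq> carrier M" "rspan R M S = carrier M"
    using fg unfolding finitely_generated_def by blast
  have "\<forall>s\<in>S. \<exists>F. finite F \<and> (\<forall>F'. finite F' \<longrightarrow> F \<subseteq> F' \<longrightarrow>
           f s = finsum N (\<lambda>i. hom_comp M N i f s) F')"
    using hcomp_sum_eventually[OF fa] S(2) by blast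
  then obtain \<Phi> where \<Phi>: "\<And>s. s \<in> S \<Longrightarrow> finite (\<Phi> s)"
    "\<And>s F'. \<lbrakk>s \<in> S; finite F'; \<Phi> s \<subseteq> F'\<rbrakk> \<Longrightarrow> f s = finsum N (\<lambda>i. hom_comp M N i f s) F'"
    by metis
  define F where "F = (\<Union>s\<in>S. \<Phi> s)"
  have F: "finite F" using S(1) \<Phi>(1) unfolding F_def by blast
  let ?g = "\<lambda>x. finsum N (\<lambda>i. hom_comp M N i f x) F"
  have g: "?g \<in> rmod_hom R M N"
  proof (rule rmod_homI)
    fix x y assume xy: "x \<in> carrier M" "y \<in> carrier M"
    then show "?g (x \<oplus>\<^bsub>M\<^esub> y) = ?g x \<oplus>\<^bsub>N\<^esub> ?g y"
      using hc(2)[OF xy] hc(1)[OF xy(1)] hc(1)[OF xy(2)] by (simp add: N.M.finsum_addf)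
  next
    fix x r assume xr: "x \<in> carrier M" "r \<in> carrier R"
    have "additive N N (\<lambda>x. x \<triangleleft>\<^bsub>N\<^esub> r)"
      unfolding additive_def using xr N.act_closed N.act_add_left by auto
    from additive_finsum[OF ag(2) ag(2) this, of "\<lambda>i. hom_comp M N i f x" F]
    show "?g (x \<triangleleft>\<^bsub>M\<^esub> r) = ?g x \<triangleleft>\<^bsub>N\<^esub> r" using hc(3)[OF xr] hc(1)[OF xr(1)] by simp
  qed (use hc(1) in auto)
  let ?E = "{x \<in> carrier M. f x = ?g x}"
  have "additive_subgroup ?E M"
  proof (rule additive_subgroupI'[OF ag(1)])
    show "\<zero>\<^bsub>M\<^esub> \<in> ?E" using additive_zero[OF ag fa] additive_zero[OF ag rmod_homD(4)[OF g]] by simp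
    show "\<And>x y. x \<in> ?E \<Longrightarrow> y \<in> ?E \<Longrightarrow> x \<oplus>\<^bsub>M\<^esub> y \<in> ?E"
      using rmod_homD(2)[OF f] rmod_homD(2)[OF g] by simp
    show "\<And>x. x \<in> ?E \<Longrightarrow> \<ominus>\<^bsub>M\<^esub> x \<in> ?E"
      using additive_inv[OF ag fa] additive_inv[OF ag rmod_homD(4)[OF g]] by simp
  qed blast
  moreover have "\<forall>x\<in>?E. \<forall>r\<in>carrier R. x \<triangleleft>\<^bsub>M\<^esub> r \<in> ?E"
    using rmod_homD(3)[OF f] rmod_homD(3)[OF g] M.act_closed by simp
  ultimately have "rsubmodule R M ?E" unfolding rsubmodule_def by blast
  moreover have "S \<subseteq> ?E" using S(2) \<Phi>(2)[OF _ F] unfolding F_def by blast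
  ultimately have "rspan R M S \<subseteq> ?E" unfolding rspan_def by blast
  then show ?thesis using S(3) F by blast
qed

section \<open>Comparison of resolutions\<close>

text \<open>Start from any lift and pass to its component of degree \<open>j\<close>: since
  \<open>e\<close> has degree 0, it lifts the component of \<open>f\<close>, which is
  \<open>f\<close> itself. The implication serves chain maps with and without a degree in one
  statement.\<close>

lemma graded_projective_lift:
  assumes R: "is_grading R (acomp R)" and P: "graded_module R P" "projective R P"
    and Q: "graded_module R Q" and N: "graded_module R N"
    and e: "e \<in> rmod_hom R Q N" "has_degree Q N 0 e" and f: "f \<in> rmod_hom R P N"
    and im: "f ` carrier P \<subseteq> e ` carrier Q"
  shows "\<exists>h\<in>rmod_hom R P Q. (\<forall>x\<in>carrier P. e (h x) = f x) \<and>
           (has_degree P N j f \<longrightarrow> has_degree P Q j h)"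
proof -
  note rm = graded_module_group(2)
  obtain h where h: "h \<in> rmod_hom R P Q" "\<forall>x\<in>carrier P. e (h x) = f x"
    using projective_lift[OF P(2) rm[OF Q] rm[OF N] e(1) f im] by blast
  show ?thesis
  proof (cases "has_degree P N j f")
    case True
    have "e (hom_comp P Q j h x) = f x" if "x \<in> carrier P" for x
      using hom_comp_postcomp[OF P(1) Q N h(1) e that, of f j]
        hom_comp_of_degree[OF P(1) N f True that, of j] h(2) by simp
    then show ?thesis
      using hom_comp_rmod_hom[OF P(1) Q R h(1)] hom_comp_has_degree[OF P(1) Q h(1)] by blast
  qed (use h in blast)
qed

lemma resolutionD:
  assumes "gr_proj_resolution R M A"
  shows "graded_module R (res_mod A n)" "projective R (res_mod A n)"
    "finitely_generated R (res_mod A n)"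
    "res_diff A n \<in> rmod_hom R (res_mod A (Suc n)) (res_mod A n)"
    "has_degree (res_mod A (Suc n)) (res_mod A n) 0 (res_diff A n)"
    "res_aug A \<in> rmod_hom R (res_mod A 0) M" "has_degree (res_mod A 0) M 0 (res_aug A)"
    "res_aug A ` carrier (res_mod A 0) = carrier M"
    "x \<in> carrier (res_mod A 0) \<Longrightarrow>
       x \<in> res_diff A 0 ` carrier (res_mod A (Suc 0)) \<longleftrightarrow> res_aug A x = \<zero>\<^bsub>M\<^esub>"
    "y \<in> carrier (res_mod A (Suc n)) \<Longrightarrow>
       y \<in> res_diff A (Suc n) ` carrier (res_mod A (Suc (Suc n))) \<longleftrightarrow>
       res_diff A n y = \<zero>\<^bsub>res_mod A n\<^esub>"
  using assms unfolding gr_proj_resolution_def a_kernel_def kernel_def by auto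

lemma resolution_complex:
  assumes "gr_proj_resolution R M A"
  shows "x \<in> carrier (res_mod A (Suc 0)) \<Longrightarrow> res_aug A (res_diff A 0 x) = \<zero>\<^bsub>M\<^esub>"
    "y \<in> carrier (res_mod A (Suc (Suc n))) \<Longrightarrow>
       res_diff A n (res_diff A (Suc n) y) = \<zero>\<^bsub>res_mod A n\<^esub>"
  using resolutionD(9,10)[OF assms] rmod_homD(1)[OF resolutionD(4)[OF assms]] by blast+

text \<open>The source is only a complex of graded projectives, with neither exactness nor an
  augmentation built in. So it can be a resolution, or the tail of one from index \<open>n\<close>
  on with a cocycle in the role of the augmentation. The element types of source and target may
  differ.\<close>

locale comparison =
  fixes R :: "('k, 'r) gr_algebra" and P :: "nat \<Rightarrow> ('r, 'p) gr_module" and p :: "nat \<Rightarrow> 'p \<Rightarrow> 'p"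
    and N :: "('r, 'n) gr_module" and B :: "('r, 'q, 'n) resolution"
  assumes R: "is_grading R (acomp R)" and N: "graded_module R N"
    and P: "\<And>k. graded_module R (P k)" "\<And>k. projective R (P k)"
    and p: "\<And>k. p k \<in> rmod_hom R (P (Suc k)) (P k)" "\<And>k. has_degree (P (Suc k)) (P k) 0 (p k)"
    and pp: "\<And>k x. x \<in> carrier (P (Suc (Suc k))) \<Longrightarrow> p k (p (Suc k) x) = \<zero>\<^bsub>P k\<^esub>"
    and B: "gr_proj_resolution R N B"
begin

abbreviation "Q \<equiv> res_mod B"
abbreviation "q \<equiv> res_diff B"

lemmas BD = resolutionD[OF B]
lemmas rmP = graded_module_group(2)[OF P(1)]
lemmas rmQ = graded_module_group(2)[OF BD(1)]

lemma chain_map_exists: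
  assumes g: "g \<in> rmod_hom R (P 0) N" "\<And>x. x \<in> carrier (P (Suc 0)) \<Longrightarrow> g (p 0 x) = \<zero>\<^bsub>N\<^esub>"
  shows "\<exists>G. (\<forall>k. G k \<in> rmod_hom R (P k) (Q k)) \<and>
     (\<forall>x\<in>carrier (P 0). res_aug B (G 0 x) = g x) \<and>
     (\<forall>k. \<forall>x\<in>carrier (P (Suc k)). q k (G (Suc k) x) = G k (p k x)) \<and>
     (has_degree (P 0) N j g \<longrightarrow> (\<forall>k. has_degree (P k) (Q k) j (G k)))"
proof -
  let ?b = "has_degree (P 0) N j g"
  \<comment> \<open>The third clause is what the next lifting step consumes: \<open>G\<close> sends
    boundaries into the image of the next differential of \<open>B\<close>. The last clause fixes
    the augmentation at index 0 inside a predicate that must be uniform in \<open>k\<close>.\<close>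
  let ?ok = "\<lambda>k G. G \<in> rmod_hom R (P k) (Q k) \<and> (?b \<longrightarrow> has_degree (P k) (Q k) j G) \<and>
      (\<forall>x\<in>carrier (P (Suc k)). G (p k x) \<in> q k ` carrier (Q (Suc k))) \<and>
      (k = 0 \<longrightarrow> (\<forall>x\<in>carrier (P 0). res_aug B (G x) = g x))"
  have "\<exists>G. \<forall>k. ?ok k (G k) \<and> (\<forall>x\<in>carrier (P (Suc k)). q k (G (Suc k) x) = G k (p k x))"
  proof (rule dependent_nat_choice)
    have "g ` carrier (P 0) \<subseteq> res_aug B ` carrier (Q 0)" using rmod_homD(1)[OF g(1)] BD(8) by auto
    then obtain G where G: "G \<in> rmod_hom R (P 0) (Q 0)"
      "\<forall>x\<in>carrier (P 0). res_aug B (G x) = g x" "?b \<longrightarrow> has_degree (P 0) (Q 0) j G"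
      using graded_projective_lift[OF R P(1,2) BD(1) N BD(6,7) g(1), of j] by blast
    moreover have "G (p 0 x) \<in> q 0 ` carrier (Q (Suc 0))" if "x \<in> carrier (P (Suc 0))" for x
      using that G(2) g(2) rmod_homD(1)[OF p(1)] rmod_homD(1)[OF G(1)] BD(9) by metis
    ultimately show "\<exists>G. ?ok 0 G" by blast
  next
    fix G k assume ok: "?ok k G"
    have Gp: "(\<lambda>x. G (p k x)) \<in> rmod_hom R (P (Suc k)) (Q k)"
      using rmod_hom_comp[OF p(1)] ok by blast
    have deg: "?b \<longrightarrow> has_degree (P (Suc k)) (Q k) j (\<lambda>x. G (p k x))"
      using has_degree_comp[OF p(2), of k "Q k" j G] ok by auto
    have "(\<lambda>x. G (p k x)) ` carrier (P (Suc k)) \<subseteq> q k ` carrier (Q (Suc k))" using ok by blast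
    from graded_projective_lift[OF R P(1,2) BD(1) BD(1) BD(4,5) Gp this, of j]
    obtain G' where G': "G' \<in> rmod_hom R (P (Suc k)) (Q (Suc k))"
      "\<forall>x\<in>carrier (P (Suc k)). q k (G' x) = G (p k x)" "?b \<longrightarrow> has_degree (P (Suc k)) (Q (Suc k)) j G'"
      using deg by blast
    have "G' (p (Suc k) x) \<in> q (Suc k) ` carrier (Q (Suc (Suc k)))"
      if x: "x \<in> carrier (P (Suc (Suc k)))" for x
    proof -
      have px: "p (Suc k) x \<in> carrier (P (Suc k))" using rmod_homD(1)[OF p(1)] x by blast
      have "q k (G' (p (Suc k) x)) = G \<zero>\<^bsub>P k\<^esub>" using G'(2) px pp[OF x] by simp
      also have "\<dots> = \<zero>\<^bsub>Q k\<^esub>" using ok rmod_hom_zero[OF rmP rmQ] by blast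
      finally show ?thesis using BD(10) rmod_homD(1)[OF G'(1) px] by blast
    qed
    then show "\<exists>G'. ?ok (Suc k) G' \<and> (\<forall>x\<in>carrier (P (Suc k)). q k (G' x) = G (p k x))"
      using G' by blast
  qed
  then obtain G where "\<forall>k. ?ok k (G k) \<and> (\<forall>x\<in>carrier (P (Suc k)). q k (G (Suc k) x) = G k (p k x))"
    by blast
  then show ?thesis by (intro exI[of _ G]) auto
qed

text \<open>Only the two adjacent homotopy maps at one index are produced, because comparing two
  composites in a fixed degree uses just these.\<close>

lemma null_homotopy:
  assumes G: "\<And>k. G k \<in> rmod_hom R (P k) (Q k)"
    "\<And>x. x \<in> carrier (P 0) \<Longrightarrow> res_aug B (G 0 x) = \<zero>\<^bsub>N\<^esub>"
    "\<And>k x. x \<in> carrier (P (Suc k)) \<Longrightarrow> q k (G (Suc k) x) = G k (p k x)"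
  shows "\<exists>h\<in>rmod_hom R (P 0) (Q (Suc 0)). \<forall>x\<in>carrier (P 0). G 0 x = q 0 (h x)"
    and "\<exists>h\<in>rmod_hom R (P (Suc m)) (Q (Suc (Suc m))). \<exists>h'\<in>rmod_hom R (P m) (Q (Suc m)).
      \<forall>x\<in>carrier (P (Suc m)). G (Suc m) x = q (Suc m) (h x) \<oplus>\<^bsub>Q (Suc m)\<^esub> h' (p m x)"
proof -
  have "G 0 ` carrier (P 0) \<subseteq> q 0 ` carrier (Q (Suc 0))"
    using rmod_homD(1)[OF G(1)] G(2) BD(9) by blast
  from projective_lift[OF P(2) rmQ rmQ BD(4) G(1) this]
  obtain h where "h \<in> rmod_hom R (P 0) (Q (Suc 0))" "\<forall>x\<in>carrier (P 0). q 0 (h x) = G 0 x"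
    by blast
  then show base: "\<exists>h\<in>rmod_hom R (P 0) (Q (Suc 0)). \<forall>x\<in>carrier (P 0). G 0 x = q 0 (h x)"
    by (intro bexI[of _ h]) simp_all
  have step: "\<exists>h'\<in>rmod_hom R (P (Suc m)) (Q (Suc (Suc m))).
      \<forall>x\<in>carrier (P (Suc m)). G (Suc m) x = q (Suc m) (h' x) \<oplus>\<^bsub>Q (Suc m)\<^esub> h (p m x)"
    if h: "h \<in> rmod_hom R (P m) (Q (Suc m))"
      and hp: "\<forall>x\<in>carrier (P (Suc m)). q m (h (p m x)) = G m (p m x)" for h m
  proof -
    interpret Qm: right_module R "Q (Suc m)" by (rule rmQ)
    interpret Qm0: right_module R "Q m" by (rule rmQ)
    \<comment> \<open>What remains of \<open>G (Suc m)\<close> after subtracting the previous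
      homotopy is killed by \<open>q m\<close>, so exactness puts it into the image of the next
      differential.\<close>
    let ?f = "\<lambda>x. G (Suc m) x \<ominus>\<^bsub>Q (Suc m)\<^esub> h (p m x)"
    have f: "?f \<in> rmod_hom R (P (Suc m)) (Q (Suc m))"
      by (rule rmod_hom_minus[OF rmQ G(1) rmod_hom_comp[OF p(1) h]])
    have "?f x \<in> q (Suc m) ` carrier (Q (Suc (Suc m)))" if x: "x \<in> carrier (P (Suc m))" for x
    proof -
      have c: "G (Suc m) x \<in> carrier (Q (Suc m))" "h (p m x) \<in> carrier (Q (Suc m))"
        using x rmod_homD(1)[OF G(1)] rmod_homD(1)[OF rmod_hom_comp[OF p(1) h]] by blast+
      have "q m (?f x) = q m (G (Suc m) x) \<ominus>\<^bsub>Q m\<^esub> q m (h (p m x))"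
        by (rule additive_minus[OF Qm.M.abelian_group_axioms Qm0.M.abelian_group_axioms
            rmod_homD(4)[OF BD(4)] c])
      also have "\<dots> = \<zero>\<^bsub>Q m\<^esub>"
        using hp x G(3)[OF x] rmod_homD(1)[OF rmod_hom_comp[OF p(1) G(1)] x]
        by (simp add: a_minus_def Qm0.M.r_neg)
      finally show ?thesis using BD(10) rmod_homD(1)[OF f x] by blast
    qed
    then obtain h' where h': "h' \<in> rmod_hom R (P (Suc m)) (Q (Suc (Suc m)))"
      "\<forall>x\<in>carrier (P (Suc m)). q (Suc m) (h' x) = ?f x"
      using projective_lift[OF P(2) rmQ rmQ BD(4) f] by blast
    have "G (Suc m) x = q (Suc m) (h' x) \<oplus>\<^bsub>Q (Suc m)\<^esub> h (p m x)" if x: "x \<in> carrier (P (Suc m))" for x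
    proof -
      have c: "G (Suc m) x \<in> carrier (Q (Suc m))" "h (p m x) \<in> carrier (Q (Suc m))"
        using x rmod_homD(1)[OF G(1)] rmod_homD(1)[OF rmod_hom_comp[OF p(1) h]] by blast+
      show ?thesis using h'(2) x c by (simp add: a_minus_def Qm.M.a_assoc Qm.M.l_neg)
    qed
    then show ?thesis using h'(1) by blast
  qed
  \<comment> \<open>The invariant is weaker than the homotopy identity: it asserts the equation only
    after precomposition with \<open>p m\<close>. That is what \<open>step\<close> takes as input,
    and it is inherited because the older term \<open>h (p m x)\<close> dies on boundaries.\<close>
  have ex: "\<exists>h\<in>rmod_hom R (P m) (Q (Suc m)). \<forall>x\<in>carrier (P (Suc m)). q m (h (p m x)) = G m (p m x)" for m
  proof (induction m)
    case 0
    then show ?case using base rmod_homD(1)[OF p(1)] by metis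
  next
    case (Suc m)
    then obtain h where h: "h \<in> rmod_hom R (P m) (Q (Suc m))"
      "\<forall>x\<in>carrier (P (Suc m)). q m (h (p m x)) = G m (p m x)" by blast
    obtain h' where h': "h' \<in> rmod_hom R (P (Suc m)) (Q (Suc (Suc m)))"
      "\<forall>x\<in>carrier (P (Suc m)). G (Suc m) x = q (Suc m) (h' x) \<oplus>\<^bsub>Q (Suc m)\<^esub> h (p m x)"
      using step[OF h] by blast
    interpret Qm: right_module R "Q (Suc m)" by (rule rmQ)
    have "q (Suc m) (h' (p (Suc m) x)) = G (Suc m) (p (Suc m) x)"
      if x: "x \<in> carrier (P (Suc (Suc m)))" for x
    proof -
      have px: "p (Suc m) x \<in> carrier (P (Suc m))" using rmod_homD(1)[OF p(1) x] .
      have "h (p m (p (Suc m) x)) = \<zero>\<^bsub>Q (Suc m)\<^esub>"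
        using pp[OF x] rmod_hom_zero[OF rmP rmQ h(1)] by simp
      then show ?thesis
        using h'(2) px rmod_homD(1)[OF rmod_hom_comp[OF h'(1) BD(4)] px] by simp
    qed
    then show ?case using h'(1) by blast
  qed
  from ex[of m] step[of _ m] show "\<exists>h\<in>rmod_hom R (P (Suc m)) (Q (Suc (Suc m))).
      \<exists>h'\<in>rmod_hom R (P m) (Q (Suc m)).
      \<forall>x\<in>carrier (P (Suc m)). G (Suc m) x = q (Suc m) (h x) \<oplus>\<^bsub>Q (Suc m)\<^esub> h' (p m x)"
    by blast
qed

end

section \<open>Convolution products\<close>

text \<open>Both sides run over the triples with sum \<open>n\<close>, grouped differently. The
  induction splits off the triples whose first entry is 0 and lowers the first entry of the others
  by one. It is the index part of associativity.\<close>

lemma (in abelian_monoid) finsum_triangle: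
  fixes g :: "nat \<Rightarrow> nat \<Rightarrow> nat \<Rightarrow> 'a"
  assumes "\<And>a b c. a + b + c = n \<Longrightarrow> g a b c \<in> carrier G"
  shows "(\<Oplus>m\<in>{..n}. \<Oplus>k\<in>{..m}. g k (m - k) (n - m)) = (\<Oplus>k\<in>{..n}. \<Oplus>j\<in>{..n - k}. g k j (n - k - j))"
  using assms
proof (induction n arbitrary: g)
  case 0
  then show ?case by simp
next
  case (Suc n)
  let ?g = "\<lambda>a. g (Suc a)"
  have c: "g a b c \<in> carrier G" if "a + b + c = Suc n" for a b c using Suc(2) that .
  have cz: "(\<lambda>m. g 0 (Suc m) (n - m)) \<in> {..n} \<rightarrow> carrier G" by (auto intro!: c)
  have ci: "(\<lambda>m. \<Oplus>k\<in>{..m}. ?g k (m - k) (n - m)) \<in> {..n} \<rightarrow> carrier G"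
    by (auto intro!: c finsum_closed)
  have cj: "(\<Oplus>k\<in>{..n}. \<Oplus>j\<in>{..n - k}. ?g k j (n - k - j)) \<in> carrier G"
    by (auto intro!: c finsum_closed)
  have inner: "(\<Oplus>k\<in>{..Suc m}. g k (Suc m - k) (n - m))
      = (\<Oplus>k\<in>{..m}. ?g k (m - k) (n - m)) \<oplus> g 0 (Suc m) (n - m)" if "m \<le> n" for m
    by (subst finsum_Suc2) (use that in \<open>auto intro!: c\<close>)
  have z: "(\<Oplus>j\<in>{..Suc n}. g 0 j (Suc n - j)) = (\<Oplus>m\<in>{..n}. g 0 (Suc m) (n - m)) \<oplus> g 0 0 (Suc n)"
    by (subst finsum_Suc2) (auto intro!: c)
  have "(\<Oplus>m\<in>{..Suc n}. \<Oplus>k\<in>{..m}. g k (m - k) (Suc n - m))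
      = (\<Oplus>m\<in>{..n}. \<Oplus>k\<in>{..Suc m}. g k (Suc m - k) (n - m)) \<oplus> g 0 0 (Suc n)"
    by (subst finsum_Suc2) (use c[of 0 0 "Suc n"] in \<open>auto intro!: c finsum_closed\<close>)
  also have "(\<Oplus>m\<in>{..n}. \<Oplus>k\<in>{..Suc m}. g k (Suc m - k) (n - m))
      = (\<Oplus>m\<in>{..n}. (\<Oplus>k\<in>{..m}. ?g k (m - k) (n - m)) \<oplus> g 0 (Suc m) (n - m))"
    by (rule finsum_cong') (use inner cz ci in \<open>auto simp: Pi_iff\<close>)
  also have "\<dots> = (\<Oplus>m\<in>{..n}. \<Oplus>k\<in>{..m}. ?g k (m - k) (n - m)) \<oplus> (\<Oplus>m\<in>{..n}. g 0 (Suc m) (n - m))"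
    by (rule finsum_addf[OF ci cz])
  also have "(\<Oplus>m\<in>{..n}. \<Oplus>k\<in>{..m}. ?g k (m - k) (n - m))
      = (\<Oplus>k\<in>{..n}. \<Oplus>j\<in>{..n - k}. ?g k j (n - k - j))"
    by (rule Suc(1)) (auto intro!: c)
  also have "\<dots> \<oplus> (\<Oplus>m\<in>{..n}. g 0 (Suc m) (n - m)) \<oplus> g 0 0 (Suc n)
      = (\<Oplus>k\<in>{..n}. \<Oplus>j\<in>{..n - k}. ?g k j (n - k - j)) \<oplus> (\<Oplus>j\<in>{..Suc n}. g 0 j (Suc n - j))"
    unfolding z by (rule a_assoc[OF cj finsum_closed[OF cz]]) (auto intro!: c)
  also have "\<dots> = (\<Oplus>k\<in>{..Suc n}. \<Oplus>j\<in>{..Suc n - k}. g k j (Suc n - k - j))"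
    by (subst (2) finsum_Suc2) (auto intro!: c finsum_closed)
  finally show ?case .
qed

lemma finsum_in_additive_subgroup:
  assumes "abelian_group G" "additive_subgroup S G" "f \<in> F \<rightarrow> S"
  shows "finsum G f F \<in> S"
proof -
  interpret abelian_group G by fact
  interpret S: additive_subgroup S G by fact
  show ?thesis using assms(3)
  proof (induction F rule: infinite_finite_induct)
    case (insert a F)
    then have "f \<in> F \<rightarrow> S" "f a \<in> S" by auto
    moreover from this have "f \<in> F \<rightarrow> carrier G" "f a \<in> carrier G" using S.a_subset by auto
    ultimately show ?case using insert by simp
  qed auto
qed

text \<open>Keeps the bookkeeping of convolution apart from homology. The structure \<open>X\<close>
  is a parameter with prescribed fields rather than a new construction, so that
  \<open>ext_algebra\<close> itself becomes an instance.\<close>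

locale graded_product =
  fixes E :: "nat \<Rightarrow> ('x, 'c) ring_scheme" and \<mu> :: "nat \<Rightarrow> nat \<Rightarrow> 'x \<Rightarrow> 'x \<Rightarrow> 'x" and u :: 'x
    and X :: "(nat \<Rightarrow> 'x, 'd) ring_scheme"
  assumes E: "abelian_group (E n)"
    and \<mu>_closed: "\<lbrakk>x \<in> carrier (E m); y \<in> carrier (E n)\<rbrakk> \<Longrightarrow> \<mu> m n x y \<in> carrier (E (m + n))"
    and \<mu>_add_left: "\<lbrakk>x \<in> carrier (E m); x' \<in> carrier (E m); y \<in> carrier (E n)\<rbrakk> \<Longrightarrow>
          \<mu> m n (x \<oplus>\<^bsub>E m\<^esub> x') y = \<mu> m n x y \<oplus>\<^bsub>E (m + n)\<^esub> \<mu> m n x' y"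
    and \<mu>_add_right: "\<lbrakk>x \<in> carrier (E m); y \<in> carrier (E n); y' \<in> carrier (E n)\<rbrakk> \<Longrightarrow>
          \<mu> m n x (y \<oplus>\<^bsub>E n\<^esub> y') = \<mu> m n x y \<oplus>\<^bsub>E (m + n)\<^esub> \<mu> m n x y'"
    and \<mu>_assoc: "\<lbrakk>x \<in> carrier (E m); y \<in> carrier (E n); z \<in> carrier (E p)\<rbrakk> \<Longrightarrow>
          \<mu> (m + n) p (\<mu> m n x y) z = \<mu> m (n + p) x (\<mu> n p y z)"
    and u_closed: "u \<in> carrier (E 0)"
    and \<mu>_unit_left: "x \<in> carrier (E n) \<Longrightarrow> \<mu> 0 n u x = x"
    and \<mu>_unit_right: "x \<in> carrier (E n) \<Longrightarrow> \<mu> n 0 x u = x"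
    and X_carrier: "carrier X = {x. (\<forall>n. x n \<in> carrier (E n)) \<and> finite {n. x n \<noteq> \<zero>\<^bsub>E n\<^esub>}}"
    and X_mult: "mult X = (\<lambda>x y n. \<Oplus>\<^bsub>E n\<^esub>m\<in>{..n}. \<mu> m (n - m) (x m) (y (n - m)))"
    and X_one: "one X = (\<lambda>n. if n = 0 then u else \<zero>\<^bsub>E n\<^esub>)"
    and X_zero: "zero X = (\<lambda>n. \<zero>\<^bsub>E n\<^esub>)"
    and X_add: "add X = (\<lambda>x y n. x n \<oplus>\<^bsub>E n\<^esub> y n)"
begin

sublocale E: abelian_group "E n" for n by (rule E)

lemma \<mu>_additive_left: "y \<in> carrier (E n) \<Longrightarrow> additive (E m) (E (m + n)) (\<lambda>x. \<mu> m n x y)"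
  unfolding additive_def using \<mu>_closed \<mu>_add_left by simp

lemma \<mu>_additive_right: "x \<in> carrier (E m) \<Longrightarrow> additive (E n) (E (m + n)) (\<mu> m n x)"
  unfolding additive_def using \<mu>_closed \<mu>_add_right by simp

lemma \<mu>_zero_left: "y \<in> carrier (E n) \<Longrightarrow> \<mu> m n \<zero>\<^bsub>E m\<^esub> y = \<zero>\<^bsub>E (m + n)\<^esub>"
  using additive_zero[OF E E \<mu>_additive_left] by blast

lemma \<mu>_zero_right: "x \<in> carrier (E m) \<Longrightarrow> \<mu> m n x \<zero>\<^bsub>E n\<^esub> = \<zero>\<^bsub>E (m + n)\<^esub>"
  using additive_zero[OF E E \<mu>_additive_right] by blast

lemma X_closed: "x \<in> carrier X \<Longrightarrow> x n \<in> carrier (E n)"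
  unfolding X_carrier by blast

lemma \<mu>_closed': "\<lbrakk>m \<le> n; x \<in> carrier (E m); y \<in> carrier (E (n - m))\<rbrakk> \<Longrightarrow> \<mu> m (n - m) x y \<in> carrier (E n)"
  using \<mu>_closed[of x m y "n - m"] by simp

lemma X_mult_closed:
  assumes x: "x \<in> carrier X" and y: "y \<in> carrier X"
  shows "x \<otimes>\<^bsub>X\<^esub> y \<in> carrier X"
proof -
  note xc = X_closed[OF x] and yc = X_closed[OF y]
  have "finite {n. x n \<noteq> \<zero>\<^bsub>E n\<^esub>}" "finite {n. y n \<noteq> \<zero>\<^bsub>E n\<^esub>}" using x y unfolding X_carrier by blast+
  then obtain a b where a: "\<And>n. x n \<noteq> \<zero>\<^bsub>E n\<^esub> \<Longrightarrow> n \<le> a" and b: "\<And>n. y n \<noteq> \<zero>\<^bsub>E n\<^esub> \<Longrightarrow> n \<le> b"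
    unfolding finite_nat_set_iff_bounded_le by blast
  \<comment> \<open>If \<open>n > a + b\<close>, every splitting of \<open>n\<close> has its first
    index above \<open>a\<close> or its second above \<open>b\<close>, so one factor is
    zero.\<close>
  have z: "(x \<otimes>\<^bsub>X\<^esub> y) n = \<zero>\<^bsub>E n\<^esub>" if n: "n > a + b" for n
  proof -
    have "\<mu> m (n - m) (x m) (y (n - m)) = \<zero>\<^bsub>E n\<^esub>" if m: "m \<le> n" for m
    proof (cases "m > a")
      case True
      then have "x m = \<zero>\<^bsub>E m\<^esub>" using a by force
      then show ?thesis using \<mu>_zero_left[OF yc, of m "n - m"] m by simp
    next
      case False
      then have "n - m > b" using n by simp
      then have "y (n - m) = \<zero>\<^bsub>E (n - m)\<^esub>" using b by force
      then show ?thesis using \<mu>_zero_right[OF xc, of m "n - m"] m by simp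
    qed
    then show ?thesis unfolding X_mult by (intro E.add.finprod_one_eqI) auto
  qed
  have "{n. (x \<otimes>\<^bsub>X\<^esub> y) n \<noteq> \<zero>\<^bsub>E n\<^esub>} \<subseteq> {..a + b}" using z by (auto simp: not_less[symmetric])
  then have "finite {n. (x \<otimes>\<^bsub>X\<^esub> y) n \<noteq> \<zero>\<^bsub>E n\<^esub>}" by (rule finite_subset) simp
  moreover have "(x \<otimes>\<^bsub>X\<^esub> y) n \<in> carrier (E n)" for n
    unfolding X_mult by (rule E.finsum_closed) (use \<mu>_closed' xc yc in auto)
  ultimately show ?thesis unfolding X_carrier by blast
qed

lemma X_abelian_group: "abelian_group X"
proof (rule abelian_groupI)
  fix x y assume x: "x \<in> carrier X" and y: "y \<in> carrier X"
  note xc = X_closed[OF x] and yc = X_closed[OF y]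
  have "{n. x n \<oplus>\<^bsub>E n\<^esub> y n \<noteq> \<zero>\<^bsub>E n\<^esub>} \<subseteq> {n. x n \<noteq> \<zero>\<^bsub>E n\<^esub>} \<union> {n. y n \<noteq> \<zero>\<^bsub>E n\<^esub>}" by auto
  then have "finite {n. x n \<oplus>\<^bsub>E n\<^esub> y n \<noteq> \<zero>\<^bsub>E n\<^esub>}"
    by (rule finite_subset) (use x y in \<open>simp add: X_carrier\<close>)
  then show "x \<oplus>\<^bsub>X\<^esub> y \<in> carrier X" using xc yc unfolding X_add by (simp add: X_carrier)
  show "x \<oplus>\<^bsub>X\<^esub> y = y \<oplus>\<^bsub>X\<^esub> x" unfolding X_add using xc yc by (simp add: E.a_comm)
next
  show "\<zero>\<^bsub>X\<^esub> \<in> carrier X" unfolding X_zero by (simp add: X_carrier)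
next
  fix x y z assume "x \<in> carrier X" "y \<in> carrier X" "z \<in> carrier X"
  then show "x \<oplus>\<^bsub>X\<^esub> y \<oplus>\<^bsub>X\<^esub> z = x \<oplus>\<^bsub>X\<^esub> (y \<oplus>\<^bsub>X\<^esub> z)"
    unfolding X_add using E.a_assoc[OF X_closed X_closed X_closed] by presburger
next
  fix x assume x: "x \<in> carrier X"
  note xc = X_closed[OF x]
  show "\<zero>\<^bsub>X\<^esub> \<oplus>\<^bsub>X\<^esub> x = x" unfolding X_add X_zero using xc by simp
  have "finite {n. \<ominus>\<^bsub>E n\<^esub> x n \<noteq> \<zero>\<^bsub>E n\<^esub>}" using x xc by (simp add: X_carrier)
  then have "(\<lambda>n. \<ominus>\<^bsub>E n\<^esub> x n) \<in> carrier X" using xc by (simp add: X_carrier)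
  then show "\<exists>y\<in>carrier X. y \<oplus>\<^bsub>X\<^esub> x = \<zero>\<^bsub>X\<^esub>"
    by (rule bexI[rotated]) (use xc in \<open>simp add: X_add X_zero E.l_neg\<close>)
qed

lemma X_mult_assoc:
  assumes x: "x \<in> carrier X" and y: "y \<in> carrier X" and z: "z \<in> carrier X"
  shows "x \<otimes>\<^bsub>X\<^esub> y \<otimes>\<^bsub>X\<^esub> z = x \<otimes>\<^bsub>X\<^esub> (y \<otimes>\<^bsub>X\<^esub> z)"
proof
  fix n
  note xc = X_closed[OF x] and yc = X_closed[OF y] and zc = X_closed[OF z]
  \<comment> \<open>The common term of both sums, bracketed to the left; the sum bracketed to the
    right is brought to it by \<open>\<mu>_assoc\<close>.\<close>
  let ?T = "\<lambda>a b c. \<mu> (a + b) c (\<mu> a b (x a) (y b)) (z c)"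
  have T: "?T a b c \<in> carrier (E n)" if "a + b + c = n" for a b c
    using \<mu>_closed[OF \<mu>_closed[OF xc yc] zc, of a b c] that by simp
  have l: "\<mu> m (n - m) (\<Oplus>\<^bsub>E m\<^esub>k\<in>{..m}. \<mu> k (m - k) (x k) (y (m - k))) (z (n - m))
      = (\<Oplus>\<^bsub>E n\<^esub>k\<in>{..m}. ?T k (m - k) (n - m))" if m: "m \<le> n" for m
  proof -
    have "\<mu> m (n - m) (\<Oplus>\<^bsub>E m\<^esub>k\<in>{..m}. \<mu> k (m - k) (x k) (y (m - k))) (z (n - m))
      = (\<Oplus>\<^bsub>E (m + (n - m))\<^esub>k\<in>{..m}. \<mu> m (n - m) (\<mu> k (m - k) (x k) (y (m - k))) (z (n - m)))"
      by (rule additive_finsum[OF E E \<mu>_additive_left]) (use xc yc zc \<mu>_closed' in auto)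
    also have "\<dots> = (\<Oplus>\<^bsub>E n\<^esub>k\<in>{..m}. ?T k (m - k) (n - m))"
    proof -
      \<comment> \<open>Truncated subtraction: products land in \<open>E (m + (n - m))\<close>,
        which is \<open>E n\<close> only because \<open>m \<le> n\<close>.\<close>
      have e: "m + (n - m) = n" using m by simp
      show ?thesis unfolding e using m by (intro E.finsum_cong') (auto intro!: T)
    qed
    finally show ?thesis .
  qed
  have r: "\<mu> k (n - k) (x k) (\<Oplus>\<^bsub>E (n - k)\<^esub>j\<in>{..n - k}. \<mu> j (n - k - j) (y j) (z (n - k - j)))
      = (\<Oplus>\<^bsub>E n\<^esub>j\<in>{..n - k}. ?T k j (n - k - j))" if k: "k \<le> n" for k
  proof -
    have "\<mu> k (n - k) (x k) (\<Oplus>\<^bsub>E (n - k)\<^esub>j\<in>{..n - k}. \<mu> j (n - k - j) (y j) (z (n - k - j)))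
      = (\<Oplus>\<^bsub>E (k + (n - k))\<^esub>j\<in>{..n - k}. \<mu> k (n - k) (x k) (\<mu> j (n - k - j) (y j) (z (n - k - j))))"
      by (rule additive_finsum[OF E E \<mu>_additive_right])
        (use xc yc zc \<mu>_closed' in \<open>auto simp del: diff_diff_left\<close>)
    also have "\<dots> = (\<Oplus>\<^bsub>E n\<^esub>j\<in>{..n - k}. ?T k j (n - k - j))"
    proof -
      have "\<mu> k (n - k) (x k) (\<mu> j (n - k - j) (y j) (z (n - k - j))) = ?T k j (n - k - j)"
        if "j \<le> n - k" for j
        using \<mu>_assoc[OF xc yc zc, of k j "n - k - j"] that by (simp del: diff_diff_left)
      moreover have e: "k + (n - k) = n" using k by simp
      ultimately show ?thesis unfolding e using k by (intro E.finsum_cong') (auto intro!: T)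
    qed
    finally show ?thesis .
  qed
  have "(x \<otimes>\<^bsub>X\<^esub> y \<otimes>\<^bsub>X\<^esub> z) n = (\<Oplus>\<^bsub>E n\<^esub>m\<in>{..n}. \<Oplus>\<^bsub>E n\<^esub>k\<in>{..m}. ?T k (m - k) (n - m))"
    unfolding X_mult by (intro E.finsum_cong') (auto simp: l intro!: T E.finsum_closed)
  also have "\<dots> = (\<Oplus>\<^bsub>E n\<^esub>k\<in>{..n}. \<Oplus>\<^bsub>E n\<^esub>j\<in>{..n - k}. ?T k j (n - k - j))"
    by (rule E.finsum_triangle) (rule T)
  also have "\<dots> = (x \<otimes>\<^bsub>X\<^esub> (y \<otimes>\<^bsub>X\<^esub> z)) n"
    unfolding X_mult
    by (intro E.finsum_cong'[symmetric])
      (auto simp: r simp del: diff_diff_left intro!: T E.finsum_closed)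
  finally show "(x \<otimes>\<^bsub>X\<^esub> y \<otimes>\<^bsub>X\<^esub> z) n = (x \<otimes>\<^bsub>X\<^esub> (y \<otimes>\<^bsub>X\<^esub> z)) n" .
qed

lemma X_one_closed: "\<one>\<^bsub>X\<^esub> \<in> carrier X"
proof -
  have "{n. (if n = 0 then u else \<zero>\<^bsub>E n\<^esub>) \<noteq> \<zero>\<^bsub>E n\<^esub>} \<subseteq> {0}" by auto
  then have "finite {n. (if n = 0 then u else \<zero>\<^bsub>E n\<^esub>) \<noteq> \<zero>\<^bsub>E n\<^esub>}" by (rule finite_subset) simp
  then show ?thesis unfolding X_one X_carrier using u_closed by simp
qed

lemma X_ring: "ring X"
proof (rule ringI[OF X_abelian_group])
  show "Group.monoid X"
  proof
    fix x assume x: "x \<in> carrier X"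
    note xc = X_closed[OF x]
    show "\<one>\<^bsub>X\<^esub> \<otimes>\<^bsub>X\<^esub> x = x"
    proof
      fix n
      \<comment> \<open>The unit is concentrated at index 0, so only \<open>m = 0\<close> survives;
        the equation is oriented as \<open>0 = m\<close> to match
        \<open>finsum_singleton\<close>.\<close>
      have "(\<one>\<^bsub>X\<^esub> \<otimes>\<^bsub>X\<^esub> x) n = (\<Oplus>\<^bsub>E n\<^esub>m\<in>{..n}. if 0 = m then x n else \<zero>\<^bsub>E n\<^esub>)"
        unfolding X_mult X_one
      proof (intro E.finsum_cong')
        fix m assume "m \<in> {..n}"
        then show "\<mu> m (n - m) (if m = 0 then u else \<zero>\<^bsub>E m\<^esub>) (x (n - m)) = (if 0 = m then x n else \<zero>\<^bsub>E n\<^esub>)"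
          using \<mu>_unit_left xc \<mu>_zero_left[OF xc, of m "n - m"] by auto
      qed (use xc in auto)
      also have "\<dots> = x n" using xc by (intro E.finsum_singleton) auto
      finally show "(\<one>\<^bsub>X\<^esub> \<otimes>\<^bsub>X\<^esub> x) n = x n" .
    qed
    show "x \<otimes>\<^bsub>X\<^esub> \<one>\<^bsub>X\<^esub> = x"
    proof
      fix n
      have "(x \<otimes>\<^bsub>X\<^esub> \<one>\<^bsub>X\<^esub>) n = (\<Oplus>\<^bsub>E n\<^esub>m\<in>{..n}. if n = m then x n else \<zero>\<^bsub>E n\<^esub>)"
        unfolding X_mult X_one
      proof (intro E.finsum_cong')
        fix m assume "m \<in> {..n}"
        then show "\<mu> m (n - m) (x m) (if n - m = 0 then u else \<zero>\<^bsub>E (n - m)\<^esub>) = (if n = m then x n else \<zero>\<^bsub>E n\<^esub>)"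
          using \<mu>_unit_right xc \<mu>_zero_right[OF xc, of m "n - m"] by auto
      qed (use xc in auto)
      also have "\<dots> = x n" using xc by (intro E.finsum_singleton) auto
      finally show "(x \<otimes>\<^bsub>X\<^esub> \<one>\<^bsub>X\<^esub>) n = x n" .
    qed
  qed (use X_mult_closed X_mult_assoc X_one_closed in auto)
next
  fix x y z assume x: "x \<in> carrier X" and y: "y \<in> carrier X" and z: "z \<in> carrier X"
  note c = X_closed[OF x] X_closed[OF y] X_closed[OF z]
  show "(x \<oplus>\<^bsub>X\<^esub> y) \<otimes>\<^bsub>X\<^esub> z = x \<otimes>\<^bsub>X\<^esub> z \<oplus>\<^bsub>X\<^esub> y \<otimes>\<^bsub>X\<^esub> z"
  proof
    fix n
    have "((x \<oplus>\<^bsub>X\<^esub> y) \<otimes>\<^bsub>X\<^esub> z) n = (\<Oplus>\<^bsub>E n\<^esub>m\<in>{..n}. \<mu> m (n - m) (x m) (z (n - m)) \<oplus>\<^bsub>E n\<^esub> \<mu> m (n - m) (y m) (z (n - m)))"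
      unfolding X_mult X_add
      by (intro E.finsum_cong') (use c \<mu>_closed' \<mu>_add_left[of _ _ _ _ "n - _"] in auto)
    also have "\<dots> = (x \<otimes>\<^bsub>X\<^esub> z \<oplus>\<^bsub>X\<^esub> y \<otimes>\<^bsub>X\<^esub> z) n"
      unfolding X_mult X_add by (intro E.finsum_addf) (use c \<mu>_closed' in auto)
    finally show "((x \<oplus>\<^bsub>X\<^esub> y) \<otimes>\<^bsub>X\<^esub> z) n = (x \<otimes>\<^bsub>X\<^esub> z \<oplus>\<^bsub>X\<^esub> y \<otimes>\<^bsub>X\<^esub> z) n" .
  qed
  show "z \<otimes>\<^bsub>X\<^esub> (x \<oplus>\<^bsub>X\<^esub> y) = z \<otimes>\<^bsub>X\<^esub> x \<oplus>\<^bsub>X\<^esub> z \<otimes>\<^bsub>X\<^esub> y"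
  proof
    fix n
    have "(z \<otimes>\<^bsub>X\<^esub> (x \<oplus>\<^bsub>X\<^esub> y)) n = (\<Oplus>\<^bsub>E n\<^esub>m\<in>{..n}. \<mu> m (n - m) (z m) (x (n - m)) \<oplus>\<^bsub>E n\<^esub> \<mu> m (n - m) (z m) (y (n - m)))"
      unfolding X_mult X_add
      by (intro E.finsum_cong') (use c \<mu>_closed' \<mu>_add_right[of _ _ _ "n - _"] in auto)
    also have "\<dots> = (z \<otimes>\<^bsub>X\<^esub> x \<oplus>\<^bsub>X\<^esub> z \<otimes>\<^bsub>X\<^esub> y) n"
      unfolding X_mult X_add by (intro E.finsum_addf) (use c \<mu>_closed' in auto)
    finally show "(z \<otimes>\<^bsub>X\<^esub> (x \<oplus>\<^bsub>X\<^esub> y)) n = (z \<otimes>\<^bsub>X\<^esub> x \<oplus>\<^bsub>X\<^esub> z \<otimes>\<^bsub>X\<^esub> y) n" .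
  qed
qed

lemma X_a_inv:
  assumes x: "x \<in> carrier X" shows "\<ominus>\<^bsub>X\<^esub> x = (\<lambda>n. \<ominus>\<^bsub>E n\<^esub> x n)"
proof -
  interpret X: abelian_group X by (rule X_abelian_group)
  note xc = X_closed[OF x]
  have "finite {n. \<ominus>\<^bsub>E n\<^esub> x n \<noteq> \<zero>\<^bsub>E n\<^esub>}" using x xc by (simp add: X_carrier)
  then have "(\<lambda>n. \<ominus>\<^bsub>E n\<^esub> x n) \<in> carrier X" using xc by (simp add: X_carrier)
  moreover have "(\<lambda>n. \<ominus>\<^bsub>E n\<^esub> x n) \<oplus>\<^bsub>X\<^esub> x = \<zero>\<^bsub>X\<^esub>" using xc by (simp add: X_add X_zero E.l_neg)
  ultimately show ?thesis using x by (intro X.minus_equality) auto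
qed

text \<open>Serves the diagonal and the off-diagonal part at once, as both are cut out by a
  condition on each component separately.\<close>

lemma componentwise_subgroup:
  assumes S: "\<And>n. additive_subgroup (S n) (E n)"
  shows "additive_subgroup {x \<in> carrier X. \<forall>n. x n \<in> S n} X"
proof (rule additive_subgroupI'[OF X_abelian_group])
  interpret S: additive_subgroup "S n" "E n" for n by (rule S)
  interpret X: abelian_group X by (rule X_abelian_group)
  show "\<zero>\<^bsub>X\<^esub> \<in> {x \<in> carrier X. \<forall>n. x n \<in> S n}" using X.zero_closed unfolding X_zero by simp
  show "\<And>x y. \<lbrakk>x \<in> {x \<in> carrier X. \<forall>n. x n \<in> S n}; y \<in> {x \<in> carrier X. \<forall>n. x n \<in> S n}\<rbrakk> \<Longrightarrow>
      x \<oplus>\<^bsub>X\<^esub> y \<in> {x \<in> carrier X. \<forall>n. x n \<in> S n}"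
    using X.a_closed unfolding X_add by simp
  show "\<And>x. x \<in> {x \<in> carrier X. \<forall>n. x n \<in> S n} \<Longrightarrow> \<ominus>\<^bsub>X\<^esub> x \<in> {x \<in> carrier X. \<forall>n. x n \<in> S n}"
    using X.a_inv_closed by (simp add: X_a_inv)
qed blast

lemma componentwise_ideal:
  assumes S: "\<And>n. additive_subgroup (S n) (E n)"
    and l: "\<And>m n x y. \<lbrakk>x \<in> S m; y \<in> carrier (E n)\<rbrakk> \<Longrightarrow> \<mu> m n x y \<in> S (m + n)"
    and r: "\<And>m n x y. \<lbrakk>x \<in> carrier (E m); y \<in> S n\<rbrakk> \<Longrightarrow> \<mu> m n x y \<in> S (m + n)"
  shows "ideal {x \<in> carrier X. \<forall>n. x n \<in> S n} X"
proof (intro ideal.intro[OF componentwise_subgroup[OF S] X_ring] ideal_axioms.intro)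
  fix a x assume a: "a \<in> {x \<in> carrier X. \<forall>n. x n \<in> S n}" and x: "x \<in> carrier X"
  have "(x \<otimes>\<^bsub>X\<^esub> a) n \<in> S n" for n
  proof -
    have "\<mu> m (n - m) (x m) (a (n - m)) \<in> S n" if "m \<le> n" for m
      using r[of "x m" m "a (n - m)" "n - m"] that a X_closed[OF x] by simp
    then show ?thesis unfolding X_mult by (intro finsum_in_additive_subgroup[OF E S]) auto
  qed
  then show "x \<otimes>\<^bsub>X\<^esub> a \<in> {x \<in> carrier X. \<forall>n. x n \<in> S n}" using X_mult_closed x a by simp
  have "(a \<otimes>\<^bsub>X\<^esub> x) n \<in> S n" for n
  proof -
    have "\<mu> m (n - m) (a m) (x (n - m)) \<in> S n" if "m \<le> n" for m
      using l[of "a m" m "x (n - m)" "n - m"] that a X_closed[OF x] by simp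
    then show ?thesis unfolding X_mult by (intro finsum_in_additive_subgroup[OF E S]) auto
  qed
  then show "a \<otimes>\<^bsub>X\<^esub> x \<in> {x \<in> carrier X. \<forall>n. x n \<in> S n}" using X_mult_closed x a by simp
qed

end

section \<open>Quotients and Hom spaces\<close>

lemma quot_space_simps [simp]:
  "carrier (quot_space V Z B) = (\<lambda>f. B +>\<^bsub>V\<^esub> f) ` Z"
  "zero (quot_space V Z B) = B" "add (quot_space V Z B) = set_add V"
  "smult (quot_space V Z B) = (\<lambda>a X. \<Union>f\<in>X. B +>\<^bsub>V\<^esub> (a \<odot>\<^bsub>V\<^esub> f))"
  by (auto simp: quot_space_def)

text \<open>Only the additive structure is fixed here. Scalars enter through
  \<open>quot_smult\<close>, which takes the required compatibility as premises.\<close>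

locale subquotient = abelian_group V + Z: additive_subgroup Z V + B: additive_subgroup B V
  for V :: "('k, 'v) module" and Z B +
  assumes B_le_Z: "B \<subseteq> Z"
begin

abbreviation "cl f \<equiv> B +>\<^bsub>V\<^esub> f"

lemma abelian_subgroup_B: "abelian_subgroup B V"
  by (rule abelian_subgroupI3) unfold_locales

lemma cl_add: "\<lbrakk>f \<in> carrier V; g \<in> carrier V\<rbrakk> \<Longrightarrow> cl f <+>\<^bsub>V\<^esub> cl g = cl (f \<oplus>\<^bsub>V\<^esub> g)"
  by (rule abelian_subgroup.a_rcos_sum[OF abelian_subgroup_B])

lemma mem_cl: "g \<in> cl f \<longleftrightarrow> (\<exists>b\<in>B. g = b \<oplus>\<^bsub>V\<^esub> f)"
  unfolding a_r_coset_def' by auto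

lemma self_mem_cl: "f \<in> carrier V \<Longrightarrow> f \<in> cl f"
  unfolding mem_cl by (intro bexI[of _ "\<zero>\<^bsub>V\<^esub>"]) simp_all

lemma cl_eq_of_mem: "\<lbrakk>g \<in> cl f; f \<in> carrier V\<rbrakk> \<Longrightarrow> cl g = cl f"
  using a_repr_independence[OF _ _ B.a_subgroup] by metis

lemma cl_add_boundary: "\<lbrakk>b \<in> B; f \<in> carrier V\<rbrakk> \<Longrightarrow> cl (b \<oplus>\<^bsub>V\<^esub> f) = cl f"
  by (rule cl_eq_of_mem) (auto simp: mem_cl)

lemma cl_boundary: "b \<in> B \<Longrightarrow> cl b = B"
  using a_coset_join2[OF _ B.a_subgroup] B.a_subset by blast

lemma cl_minus:
  assumes "f \<in> carrier V" "g \<in> carrier V" "cl f = cl g" shows "f \<ominus>\<^bsub>V\<^esub> g \<in> B"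
proof -
  have "f \<in> cl g" using self_mem_cl[OF assms(1)] assms(3) by simp
  then obtain b where b: "b \<in> B" "f = b \<oplus>\<^bsub>V\<^esub> g" unfolding mem_cl by blast
  have "b \<in> carrier V" using b(1) B.a_subset by blast
  then have "f \<ominus>\<^bsub>V\<^esub> g = b" using b(2) assms(2) by (simp add: a_minus_def a_assoc r_neg)
  then show ?thesis using b(1) by simp
qed

lemma abelian_group_quot: "abelian_group (quot_space V Z B)"
proof (rule abelian_groupI)
  note Zc = Z.a_subset[THEN subsetD]
  fix X Y assume "X \<in> carrier (quot_space V Z B)" and "Y \<in> carrier (quot_space V Z B)"
  then obtain f g where X: "X = cl f" "f \<in> Z" and Y: "Y = cl g" "g \<in> Z" by auto
  show "X \<oplus>\<^bsub>quot_space V Z B\<^esub> Y \<in> carrier (quot_space V Z B)"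
    using X Y Zc by (simp add: cl_add)
  show "X \<oplus>\<^bsub>quot_space V Z B\<^esub> Y = Y \<oplus>\<^bsub>quot_space V Z B\<^esub> X"
    using X Y Zc by (simp add: cl_add a_comm)
  show "\<zero>\<^bsub>quot_space V Z B\<^esub> \<oplus>\<^bsub>quot_space V Z B\<^esub> X = X"
    using X Zc cl_add[of "\<zero>\<^bsub>V\<^esub>" f] cl_boundary[of "\<zero>\<^bsub>V\<^esub>"] by simp
  have "cl (\<ominus>\<^bsub>V\<^esub> f) \<oplus>\<^bsub>quot_space V Z B\<^esub> X = \<zero>\<^bsub>quot_space V Z B\<^esub>"
    using X Zc cl_add[of "\<ominus>\<^bsub>V\<^esub> f" f] cl_boundary[of "\<zero>\<^bsub>V\<^esub>"] by (simp add: l_neg)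
  then show "\<exists>Y\<in>carrier (quot_space V Z B). Y \<oplus>\<^bsub>quot_space V Z B\<^esub> X = \<zero>\<^bsub>quot_space V Z B\<^esub>"
    by (rule bexI) (use X(2) in simp)
next
  note Zc = Z.a_subset[THEN subsetD]
  fix X Y W assume "X \<in> carrier (quot_space V Z B)" "Y \<in> carrier (quot_space V Z B)"
    "W \<in> carrier (quot_space V Z B)"
  then obtain f g h where X: "X = cl f" "f \<in> Z" and Y: "Y = cl g" "g \<in> Z" and W: "W = cl h" "h \<in> Z"
    by auto
  show "X \<oplus>\<^bsub>quot_space V Z B\<^esub> Y \<oplus>\<^bsub>quot_space V Z B\<^esub> W
      = X \<oplus>\<^bsub>quot_space V Z B\<^esub> (Y \<oplus>\<^bsub>quot_space V Z B\<^esub> W)"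
    using X Y W Zc by (simp add: cl_add a_assoc)
qed (auto intro!: image_eqI[of _ _ "\<zero>\<^bsub>V\<^esub>"] simp: cl_boundary)

lemma quot_a_inv: "f \<in> Z \<Longrightarrow> \<ominus>\<^bsub>quot_space V Z B\<^esub> (cl f) = cl (\<ominus>\<^bsub>V\<^esub> f)"
proof -
  assume f: "f \<in> Z"
  interpret q: abelian_group "quot_space V Z B" by (rule abelian_group_quot)
  have fc: "f \<in> carrier V" using f Z.a_subset by blast
  have "cl (\<ominus>\<^bsub>V\<^esub> f) \<oplus>\<^bsub>quot_space V Z B\<^esub> cl f = \<zero>\<^bsub>quot_space V Z B\<^esub>"
    using fc cl_add[of "\<ominus>\<^bsub>V\<^esub> f" f] cl_boundary[of "\<zero>\<^bsub>V\<^esub>"] by (simp add: l_neg)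
  moreover have "cl f \<in> carrier (quot_space V Z B)" "cl (\<ominus>\<^bsub>V\<^esub> f) \<in> carrier (quot_space V Z B)"
    using f by auto
  ultimately show ?thesis by (rule q.minus_equality)
qed

lemma additive_subgroup_classes:
  assumes "additive_subgroup S V" "S \<subseteq> Z"
  shows "additive_subgroup (cl ` S) (quot_space V Z B)"
proof (rule additive_subgroupI'[OF abelian_group_quot])
  interpret S: additive_subgroup S V by fact
  note Sc = S.a_subset[THEN subsetD]
  show "cl ` S \<subseteq> carrier (quot_space V Z B)" using assms(2) by auto
  show "\<zero>\<^bsub>quot_space V Z B\<^esub> \<in> cl ` S"
    by (rule image_eqI[of _ _ "\<zero>\<^bsub>V\<^esub>"]) (auto simp: cl_boundary)
  show "\<And>X Y. \<lbrakk>X \<in> cl ` S; Y \<in> cl ` S\<rbrakk> \<Longrightarrow> X \<oplus>\<^bsub>quot_space V Z B\<^esub> Y \<in> cl ` S"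
    using Sc by (auto simp: cl_add)
  show "\<And>X. X \<in> cl ` S \<Longrightarrow> \<ominus>\<^bsub>quot_space V Z B\<^esub> X \<in> cl ` S"
    using quot_a_inv assms(2) by auto
qed

text \<open>The union over representatives collapses: two representatives differ by an element of
  \<open>B\<close>, which the scalar keeps in \<open>B\<close>, and the coset is not empty.\<close>

lemma quot_smult:
  assumes s: "\<And>f. f \<in> carrier V \<Longrightarrow> a \<odot>\<^bsub>V\<^esub> f \<in> carrier V"
    and add: "\<And>f g. \<lbrakk>f \<in> carrier V; g \<in> carrier V\<rbrakk> \<Longrightarrow> a \<odot>\<^bsub>V\<^esub> (f \<oplus>\<^bsub>V\<^esub> g) = a \<odot>\<^bsub>V\<^esub> f \<oplus>\<^bsub>V\<^esub> a \<odot>\<^bsub>V\<^esub> g"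
    and B: "\<And>b. b \<in> B \<Longrightarrow> a \<odot>\<^bsub>V\<^esub> b \<in> B" and f: "f \<in> carrier V"
  shows "a \<odot>\<^bsub>quot_space V Z B\<^esub> cl f = cl (a \<odot>\<^bsub>V\<^esub> f)"
proof -
  have "cl (a \<odot>\<^bsub>V\<^esub> f') = cl (a \<odot>\<^bsub>V\<^esub> f)" if f': "f' \<in> cl f" for f'
  proof -
    obtain b where b: "b \<in> B" "f' = b \<oplus>\<^bsub>V\<^esub> f" using f' unfolding mem_cl by blast
    have "b \<in> carrier V" using b(1) B.a_subset by blast
    then show ?thesis using b(2) add f cl_add_boundary[OF B[OF b(1)] s[OF f]] by simp
  qed
  then have "(\<Union>f'\<in>cl f. cl (a \<odot>\<^bsub>V\<^esub> f')) = (\<Union>f'\<in>cl f. cl (a \<odot>\<^bsub>V\<^esub> f))"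
    by (rule SUP_cong[OF refl])
  also have "\<dots> = cl (a \<odot>\<^bsub>V\<^esub> f)" using self_mem_cl[OF f] by (subst UN_constant) auto
  finally show ?thesis by simp
qed

end

lemma hom_space_simps [simp]:
  "carrier (hom_space R M N) = rmod_hom R M N \<inter> extensional (carrier M)"
  "zero (hom_space R M N) = (\<lambda>x\<in>carrier M. \<zero>\<^bsub>N\<^esub>)"
  "add (hom_space R M N) = (\<lambda>f g. \<lambda>x\<in>carrier M. f x \<oplus>\<^bsub>N\<^esub> g x)"
  "smult (hom_space R M N) = (\<lambda>a f. \<lambda>x\<in>carrier M. f x \<triangleleft>\<^bsub>N\<^esub> (a \<odot>\<^bsub>R\<^esub> \<one>\<^bsub>R\<^esub>))"
  by (simp_all add: hom_space_def)

lemma restrict_in_hom_space: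
  assumes "right_module R M" "f \<in> rmod_hom R M N"
  shows "restrict f (carrier M) \<in> carrier (hom_space R M N)"
  using rmod_hom_restrict[OF assms] by simp

lemma hom_space_neg:
  assumes "right_module R M" "right_module R N" "f \<in> carrier (hom_space R M N)"
  shows "(\<lambda>x\<in>carrier M. \<ominus>\<^bsub>N\<^esub> f x) \<in> carrier (hom_space R M N)"
    and "(\<lambda>x\<in>carrier M. \<ominus>\<^bsub>N\<^esub> f x) \<oplus>\<^bsub>hom_space R M N\<^esub> f = \<zero>\<^bsub>hom_space R M N\<^esub>"
proof -
  interpret N: right_module R N by fact
  have f: "f \<in> rmod_hom R M N" using assms(3) by simp
  show "(\<lambda>x\<in>carrier M. \<ominus>\<^bsub>N\<^esub> f x) \<in> carrier (hom_space R M N)"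
    by (rule restrict_in_hom_space[OF assms(1) rmod_hom_inv[OF assms(2) f]])
  show "(\<lambda>x\<in>carrier M. \<ominus>\<^bsub>N\<^esub> f x) \<oplus>\<^bsub>hom_space R M N\<^esub> f = \<zero>\<^bsub>hom_space R M N\<^esub>"
    using rmod_homD(1)[OF f] by (auto simp: N.M.l_neg intro!: restrict_ext)
qed

lemma abelian_group_hom_space:
  assumes M: "right_module R M" and N: "right_module R N"
  shows "abelian_group (hom_space R M N)"
proof (rule abelian_groupI)
  interpret N: right_module R N by fact
  let ?V = "hom_space R M N"
  fix f g assume f: "f \<in> carrier ?V" and g: "g \<in> carrier ?V"
  have f': "f \<in> rmod_hom R M N" and g': "g \<in> rmod_hom R M N" using f g by auto
  show "f \<oplus>\<^bsub>?V\<^esub> g \<in> carrier ?V"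
    using restrict_in_hom_space[OF M rmod_hom_add[OF N f' g']] by simp
  show "f \<oplus>\<^bsub>?V\<^esub> g = g \<oplus>\<^bsub>?V\<^esub> f"
    using rmod_homD(1)[OF f'] rmod_homD(1)[OF g'] by (auto simp: N.M.a_comm intro!: restrict_ext)
  show "\<zero>\<^bsub>?V\<^esub> \<oplus>\<^bsub>?V\<^esub> f = f"
    using rmod_homD(1)[OF f'] f by (auto intro!: extensionalityI[of _ "carrier M"])
  show "\<exists>g\<in>carrier ?V. g \<oplus>\<^bsub>?V\<^esub> f = \<zero>\<^bsub>?V\<^esub>" using hom_space_neg[OF M N f] by blast
next
  interpret N: right_module R N by fact
  let ?V = "hom_space R M N"
  show "\<zero>\<^bsub>?V\<^esub> \<in> carrier ?V" using restrict_in_hom_space[OF M rmod_hom_const_zero[OF N]] by simp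
  fix f g h assume "f \<in> carrier ?V" "g \<in> carrier ?V" "h \<in> carrier ?V"
  then have "f \<in> rmod_hom R M N" "g \<in> rmod_hom R M N" "h \<in> rmod_hom R M N" by auto
  from this[THEN rmod_homD(1)] show "f \<oplus>\<^bsub>?V\<^esub> g \<oplus>\<^bsub>?V\<^esub> h = f \<oplus>\<^bsub>?V\<^esub> (g \<oplus>\<^bsub>?V\<^esub> h)"
    by (auto simp: N.M.a_assoc intro!: restrict_ext)
qed

lemma hom_space_a_inv:
  assumes "right_module R M" "right_module R N" "f \<in> carrier (hom_space R M N)"
  shows "\<ominus>\<^bsub>hom_space R M N\<^esub> f = (\<lambda>x\<in>carrier M. \<ominus>\<^bsub>N\<^esub> f x)"
proof -
  interpret abelian_group "hom_space R M N" by (rule abelian_group_hom_space[OF assms(1,2)])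
  show ?thesis by (rule minus_equality[OF hom_space_neg(2)[OF assms] assms(3) hom_space_neg(1)[OF assms]])
qed

lemma additive_subgroup_kernel:
  assumes "abelian_group A" "abelian_group B" "additive A B f"
  shows "additive_subgroup {x \<in> carrier A. f x = \<zero>\<^bsub>B\<^esub>} A"
proof -
  interpret A: abelian_group A by fact
  interpret B: abelian_group B by fact
  show ?thesis
    by (rule additive_subgroupI'[OF assms(1)])
      (use additive_zero[OF assms] additive_inv[OF assms] additiveD(2)[OF assms(3)] in auto)
qed

lemma additive_subgroup_image:
  assumes "abelian_group A" "abelian_group B" "additive A B f"
  shows "additive_subgroup (f ` carrier A) B"
proof -
  interpret A: abelian_group A by fact
  interpret B: abelian_group B by fact
  show ?thesis
  proof (rule additive_subgroupI'[OF assms(2)])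
    show "f ` carrier A \<subseteq> carrier B" using additiveD(1)[OF assms(3)] by blast
    show "\<zero>\<^bsub>B\<^esub> \<in> f ` carrier A"
      using additive_zero[OF assms] by (intro image_eqI[of _ _ "\<zero>\<^bsub>A\<^esub>"]) auto
    show "\<And>x y. \<lbrakk>x \<in> f ` carrier A; y \<in> f ` carrier A\<rbrakk> \<Longrightarrow> x \<oplus>\<^bsub>B\<^esub> y \<in> f ` carrier A"
      using additiveD(2)[OF assms(3), symmetric] by auto
    show "\<And>x. x \<in> f ` carrier A \<Longrightarrow> \<ominus>\<^bsub>B\<^esub> x \<in> f ` carrier A"
      using additive_inv[OF assms, symmetric] by auto
  qed
qed

section \<open>The Ext algebra\<close>

locale ext_setup =
  fixes K :: "('k, 'c) ring_scheme" and R :: "('k, 'r) gr_algebra"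
    and M :: "('r, 'm) gr_module" and A :: "('r, 'p, 'm) resolution"
  assumes R: "graded_algebra K R" and M: "graded_module R M" and A: "gr_proj_resolution R M A"
begin

abbreviation "P n \<equiv> res_mod A n"
abbreviation "d n \<equiv> res_diff A n"
abbreviation "C n \<equiv> cochains R M A n"
abbreviation "Z n \<equiv> cocycles R M A n"
abbreviation "B n \<equiv> coboundaries R M A n"
abbreviation "E n \<equiv> ext_space R M A n"
abbreviation "cls n \<equiv> ext_class R M A n"
abbreviation "Lf n \<equiv> lifts R A n"
abbreviation "yon m n \<equiv> yoneda R M A m n"
abbreviation "D n i \<equiv> ext_degree R M A n i"

lemmas AD = resolutionD[OF A]
lemmas rmP = graded_module_group(2)[OF AD(1)]
lemmas rmM = graded_module_group(2)[OF M]

sublocale M: graded_module R M by (rule M)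
sublocale P: graded_module R "P n" for n by (rule AD(1))

lemma R_graded: "is_grading R (acomp R)"
  using R unfolding graded_algebra_def graded_algebra_axioms_def by blast

section \<open>Cochains, cocycles, coboundaries and their classes\<close>

lemma cochains_iff: "f \<in> carrier (C n) \<longleftrightarrow> f \<in> rmod_hom R (P n) M \<and> f \<in> extensional (carrier (P n))"
  unfolding cochains_def by simp

lemma restrict_cochain: "f \<in> rmod_hom R (P n) M \<Longrightarrow> restrict f (carrier (P n)) \<in> carrier (C n)"
  unfolding cochains_def by (rule restrict_in_hom_space[OF rmP])

lemma cochains_group: "abelian_group (C n)"
  unfolding cochains_def by (rule abelian_group_hom_space[OF rmP rmM])

sublocale C: abelian_group "C n" for n by (rule cochains_group)

lemma cochains_ops:
  "\<zero>\<^bsub>C n\<^esub> = (\<lambda>x\<in>carrier (P n). \<zero>\<^bsub>M\<^esub>)"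
  "f \<oplus>\<^bsub>C n\<^esub> g = (\<lambda>x\<in>carrier (P n). f x \<oplus>\<^bsub>M\<^esub> g x)"
  "a \<odot>\<^bsub>C n\<^esub> f = (\<lambda>x\<in>carrier (P n). f x \<triangleleft>\<^bsub>M\<^esub> (a \<odot>\<^bsub>R\<^esub> \<one>\<^bsub>R\<^esub>))"
  unfolding cochains_def by simp_all

lemma cochains_a_inv: "f \<in> carrier (C n) \<Longrightarrow> \<ominus>\<^bsub>C n\<^esub> f = (\<lambda>x\<in>carrier (P n). \<ominus>\<^bsub>M\<^esub> f x)"
  unfolding cochains_def by (rule hom_space_a_inv[OF rmP rmM])

lemma cochain_eqI:
  assumes "f \<in> carrier (C n)" "g \<in> carrier (C n)" "\<And>x. x \<in> carrier (P n) \<Longrightarrow> f x = g x"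
  shows "f = g"
  using assms by (auto simp: cochains_iff intro: extensionalityI)

text \<open>The coboundary operator, in the exact form that occurs in \<open>coboundaries\<close>.
  Cocycles become its kernel and coboundaries of positive degree its image, so both are subgroups by
  general facts on additive maps.\<close>

definition \<delta> :: "nat \<Rightarrow> ('p \<Rightarrow> 'm) \<Rightarrow> 'p \<Rightarrow> 'm" where
  "\<delta> n h = restrict (h \<circ> d n) (carrier (P (Suc n)))"

lemma \<delta>_additive: "additive (C n) (C (Suc n)) (\<delta> n)"
  unfolding additive_def
proof (intro conjI Pi_I ballI)
  fix h assume "h \<in> carrier (C n)"
  then have "h \<in> rmod_hom R (P n) M" by (simp add: cochains_iff)
  from restrict_cochain[OF rmod_hom_comp[OF AD(4) this]]
  show "\<delta> n h \<in> carrier (C (Suc n))" unfolding \<delta>_def by (simp add: o_def)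
next
  fix f g
  show "\<delta> n (f \<oplus>\<^bsub>C n\<^esub> g) = \<delta> n f \<oplus>\<^bsub>C (Suc n)\<^esub> \<delta> n g"
    unfolding \<delta>_def cochains_ops using rmod_homD(1)[OF AD(4)] by (auto intro!: restrict_ext)
qed

lemma cocycles_iff:
  "f \<in> Z n \<longleftrightarrow> f \<in> carrier (C n) \<and> (\<forall>x\<in>carrier (P (Suc n)). f (d n x) = \<zero>\<^bsub>M\<^esub>)"
  unfolding cocycles_def by blast

lemma cocycles_kernel: "Z n = {f \<in> carrier (C n). \<delta> n f = \<zero>\<^bsub>C (Suc n)\<^esub>}"
  unfolding cocycles_def \<delta>_def cochains_ops
  by (auto simp: fun_eq_iff restrict_def)

lemma coboundaries_Suc: "B (Suc n) = \<delta> n ` carrier (C n)"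
  unfolding coboundaries_def \<delta>_def by simp

lemma coboundaries_0: "B 0 = {\<zero>\<^bsub>C 0\<^esub>}"
  unfolding coboundaries_def by simp

lemma subquotient: "subquotient (C n) (Z n) (B n)"
proof -
  have Z: "additive_subgroup (Z n) (C n)" for n
    unfolding cocycles_kernel by (rule additive_subgroup_kernel[OF cochains_group cochains_group \<delta>_additive])
  have "additive_subgroup (B n) (C n) \<and> B n \<subseteq> Z n"
  proof (cases n)
    case 0
    have "additive_subgroup {\<zero>\<^bsub>C 0\<^esub>} (C 0)" by (rule additive_subgroupI'[OF cochains_group]) auto
    then show ?thesis using additive_subgroup.zero_closed[OF Z[of 0]] 0 coboundaries_0 by simp
  next
    case (Suc m)
    have "additive_subgroup (B (Suc m)) (C (Suc m))"
      unfolding coboundaries_Suc by (rule additive_subgroup_image[OF cochains_group cochains_group \<delta>_additive])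
    moreover have "B (Suc m) \<subseteq> Z (Suc m)"
    proof
      fix f assume "f \<in> B (Suc m)"
      then obtain h where h: "h \<in> carrier (C m)" "f = \<delta> m h" unfolding coboundaries_Suc by blast
      have "h \<in> rmod_hom R (P m) M" using h(1) by (simp add: cochains_iff)
      then have "f (d (Suc m) x) = \<zero>\<^bsub>M\<^esub>" if "x \<in> carrier (P (Suc (Suc m)))" for x
        using that h(2) resolution_complex(2)[OF A that] rmod_hom_zero[OF rmP rmM]
          rmod_homD(1)[OF AD(4)] by (simp add: \<delta>_def)
      then show "f \<in> Z (Suc m)"
        using additiveD(1)[OF \<delta>_additive h(1)] h(2) unfolding cocycles_iff by blast
    qed
    ultimately show ?thesis using Suc by simp
  qed
  then show ?thesis unfolding subquotient_def subquotient_axioms_def using Z cochains_group by blast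
qed

sublocale Q: subquotient "C n" "Z n" "B n" for n by (rule subquotient)

lemma E_eq: "E n = quot_space (C n) (Z n) (B n)"
  by (simp add: ext_space_def)

lemma E_group: "abelian_group (E n)"
  unfolding E_eq by (rule Q.abelian_group_quot)

sublocale E: abelian_group "E n" for n by (rule E_group)

lemma E_carrier: "carrier (E n) = cls n ` Z n"
  unfolding E_eq by (simp add: ext_class_def)

lemma E_zero: "\<zero>\<^bsub>E n\<^esub> = B n"
  unfolding E_eq by simp

lemma Z_closed: "f \<in> Z n \<Longrightarrow> f \<in> carrier (C n)" "f \<in> Z n \<Longrightarrow> f \<in> rmod_hom R (P n) M"
  by (auto simp: cocycles_iff cochains_iff)

lemma B_subset: "b \<in> B n \<Longrightarrow> b \<in> Z n" using Q.B_le_Z by blast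

lemma cls_closed: "f \<in> Z n \<Longrightarrow> cls n f \<in> carrier (E n)"
  unfolding E_carrier by blast

lemma cls_add: "\<lbrakk>f \<in> Z n; g \<in> Z n\<rbrakk> \<Longrightarrow> cls n f \<oplus>\<^bsub>E n\<^esub> cls n g = cls n (f \<oplus>\<^bsub>C n\<^esub> g)"
  unfolding E_eq ext_class_def by (simp add: Q.cl_add Z_closed)

lemma cls_boundary: "b \<in> B n \<Longrightarrow> cls n b = \<zero>\<^bsub>E n\<^esub>"
  unfolding E_zero ext_class_def by (rule Q.cl_boundary)

lemma cls_add_boundary: "\<lbrakk>b \<in> B n; f \<in> Z n\<rbrakk> \<Longrightarrow> cls n (b \<oplus>\<^bsub>C n\<^esub> f) = cls n f"
  unfolding ext_class_def by (rule Q.cl_add_boundary) (auto dest: Z_closed)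

lemma cls_mem: "f' \<in> cls n f \<longleftrightarrow> (\<exists>b\<in>B n. f' = b \<oplus>\<^bsub>C n\<^esub> f)"
  unfolding ext_class_def by (rule Q.mem_cl)

lemma cls_self_mem: "f \<in> Z n \<Longrightarrow> f \<in> cls n f"
  unfolding ext_class_def by (rule Q.self_mem_cl) (rule Z_closed)

lemma cls_eq_minus: "\<lbrakk>f \<in> Z n; g \<in> Z n; cls n f = cls n g\<rbrakk> \<Longrightarrow> f \<ominus>\<^bsub>C n\<^esub> g \<in> B n"
  unfolding ext_class_def by (rule Q.cl_minus) (auto dest: Z_closed)

section \<open>Lifts of cocycles to chain maps\<close>

lemma liftsD:
  assumes "G \<in> Lf n g"
  shows "G k \<in> rmod_hom R (P (k + n)) (P k)"
    "x \<in> carrier (P n) \<Longrightarrow> res_aug A (G 0 x) = g x"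
    "x \<in> carrier (P (Suc (k + n))) \<Longrightarrow> d k (G (Suc k) x) = G k (d (k + n) x)"
  using assms unfolding lifts_def by (auto simp: add.commute)

text \<open>As in \<open>liftsD\<close>, the source is indexed by \<open>k + n\<close> instead of
  the \<open>n + k\<close> of the definition: then \<open>Suc k + n\<close> simplifies to
  \<open>Suc (k + n)\<close>, and the tail of the resolution is literally a complex in
  \<open>k\<close>.\<close>

lemma liftsI:
  assumes "\<And>k. G k \<in> rmod_hom R (P (k + n)) (P k)"
    "\<And>x. x \<in> carrier (P n) \<Longrightarrow> res_aug A (G 0 x) = g x"
    "\<And>k x. x \<in> carrier (P (Suc (k + n))) \<Longrightarrow> d k (G (Suc k) x) = G k (d (k + n) x)"
  shows "G \<in> Lf n g"
  using assms unfolding lifts_def by (auto simp: add.commute)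

lemma shifted_comparison: "comparison R (\<lambda>k. P (k + n)) (\<lambda>k. d (k + n)) M A"
  by unfold_locales (use R_graded AD A resolution_complex(2)[OF A] in auto)

text \<open>A cocycle vanishes on the image of \<open>d n\<close>, so it can play the augmentation
  of the complex that starts at \<open>P n\<close>.\<close>

lemma lift_exists:
  assumes g: "g \<in> Z n"
  shows "\<exists>G\<in>Lf n g. has_degree (P n) M j g \<longrightarrow> (\<forall>k. has_degree (P (k + n)) (P k) j (G k))"
proof -
  interpret comparison R "\<lambda>k. P (k + n)" "\<lambda>k. d (k + n)" M A by (rule shifted_comparison)
  have g': "g \<in> rmod_hom R (P (0 + n)) M" "\<And>x. x \<in> carrier (P (Suc 0 + n)) \<Longrightarrow> g (d (0 + n) x) = \<zero>\<^bsub>M\<^esub>"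
    using g by (auto simp: cocycles_iff cochains_iff)
  obtain G where G: "\<forall>k. G k \<in> rmod_hom R (P (k + n)) (P k)"
     "\<forall>x\<in>carrier (P (0 + n)). res_aug A (G 0 x) = g x"
     "\<forall>k. \<forall>x\<in>carrier (P (Suc k + n)). d k (G (Suc k) x) = G k (d (k + n) x)"
     "has_degree (P (0 + n)) M j g \<longrightarrow> (\<forall>k. has_degree (P (k + n)) (P k) j (G k))"
    using chain_map_exists[OF g', of j] by blast
  have "G \<in> Lf n g" by (rule liftsI) (use G(1-3) in auto)
  then show ?thesis by (rule bexI[rotated]) (use G(4) in simp)
qed

text \<open>The restricted composite inside \<open>yoneda\<close>, named so that its dependence on
  the cocycle and on the lift can be studied separately.\<close>

definition cmp :: "nat \<Rightarrow> nat \<Rightarrow> ('p \<Rightarrow> 'm) \<Rightarrow> (nat \<Rightarrow> 'p \<Rightarrow> 'p) \<Rightarrow> 'p \<Rightarrow> 'm" where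
  "cmp m n f G = restrict (f \<circ> G m) (carrier (P (m + n)))"

lemma cmp_apply: "x \<in> carrier (P (m + n)) \<Longrightarrow> cmp m n f G x = f (G m x)"
  unfolding cmp_def by simp

lemma cmp_cochain:
  assumes "f \<in> carrier (C m)" "G m \<in> rmod_hom R (P (m + n)) (P m)"
  shows "cmp m n f G \<in> carrier (C (m + n))"
proof -
  have "f \<in> rmod_hom R (P m) M" using assms(1) by (simp add: cochains_iff)
  from restrict_cochain[OF rmod_hom_comp[OF assms(2) this]] show ?thesis
    unfolding cmp_def by (simp add: o_def)
qed

lemma cmp_cocycle:
  assumes f: "f \<in> Z m" and G: "G \<in> Lf n g"
  shows "cmp m n f G \<in> Z (m + n)"
  unfolding cocycles_iff
proof (intro conjI ballI cmp_cochain)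
  show "f \<in> carrier (C m)" using f Z_closed by blast
  show "G m \<in> rmod_hom R (P (m + n)) (P m)" by (rule liftsD(1)[OF G])
  fix x assume x: "x \<in> carrier (P (Suc (m + n)))"
  have "G (Suc m) x \<in> carrier (P (Suc m))" using rmod_homD(1)[OF liftsD(1)[OF G, of "Suc m"]] x by simp
  then show "cmp m n f G (d (m + n) x) = \<zero>\<^bsub>M\<^esub>"
    using rmod_homD(1)[OF AD(4) x] liftsD(3)[OF G x] f
    by (simp add: cmp_apply cocycles_iff flip: liftsD(3)[OF G x])
qed

section \<open>Dependence of the product on representatives and lifts\<close>

lemma cmp_add_left:
  assumes "G m \<in> rmod_hom R (P (m + n)) (P m)"
  shows "cmp m n (f \<oplus>\<^bsub>C m\<^esub> g) G = cmp m n f G \<oplus>\<^bsub>C (m + n)\<^esub> cmp m n g G"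
  unfolding cochains_ops using rmod_homD(1)[OF assms] by (auto simp: cmp_def intro!: restrict_ext)

lemma cmp_add_right:
  assumes f: "f \<in> carrier (C m)" and G: "G \<in> Lf n g" and G': "G' \<in> Lf n g'"
    and H: "\<And>x. x \<in> carrier (P (m + n)) \<Longrightarrow> H m x = G m x \<oplus>\<^bsub>P m\<^esub> G' m x"
  shows "cmp m n f H = cmp m n f G \<oplus>\<^bsub>C (m + n)\<^esub> cmp m n f G'"
proof -
  have "f \<in> rmod_hom R (P m) M" using f by (simp add: cochains_iff)
  then show ?thesis unfolding cochains_ops
    using rmod_homD(1)[OF liftsD(1)[OF G]] rmod_homD(1)[OF liftsD(1)[OF G']] H rmod_homD(2)
    by (fastforce simp: cmp_def intro!: restrict_ext)
qed

lemma lifts_add: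
  assumes G: "G \<in> Lf n g" and G': "G' \<in> Lf n g'" and g: "g \<in> carrier (C n)" "g' \<in> carrier (C n)"
  shows "(\<lambda>k x. G k x \<oplus>\<^bsub>P k\<^esub> G' k x) \<in> Lf n (g \<oplus>\<^bsub>C n\<^esub> g')"
proof (rule liftsI)
  show "(\<lambda>x. G k x \<oplus>\<^bsub>P k\<^esub> G' k x) \<in> rmod_hom R (P (k + n)) (P k)" for k
    by (rule rmod_hom_add[OF rmP liftsD(1)[OF G] liftsD(1)[OF G']])
  fix x assume x: "x \<in> carrier (P n)"
  have "G 0 x \<in> carrier (P 0)" "G' 0 x \<in> carrier (P 0)"
    using rmod_homD(1)[OF liftsD(1)[OF G, of 0]] rmod_homD(1)[OF liftsD(1)[OF G', of 0]] x by auto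
  then show "res_aug A (G 0 x \<oplus>\<^bsub>P 0\<^esub> G' 0 x) = (g \<oplus>\<^bsub>C n\<^esub> g') x"
    using x rmod_homD(2)[OF AD(6)] liftsD(2)[OF G x] liftsD(2)[OF G' x] by (simp add: cochains_ops)
next
  fix k x assume x: "x \<in> carrier (P (Suc (k + n)))"
  have "G (Suc k) x \<in> carrier (P (Suc k))" "G' (Suc k) x \<in> carrier (P (Suc k))"
    using rmod_homD(1)[OF liftsD(1)[OF G, of "Suc k"]] rmod_homD(1)[OF liftsD(1)[OF G', of "Suc k"]] x
    by auto
  then show "d k (G (Suc k) x \<oplus>\<^bsub>P (Suc k)\<^esub> G' (Suc k) x) = G k (d (k + n) x) \<oplus>\<^bsub>P k\<^esub> G' k (d (k + n) x)"
    using rmod_homD(2)[OF AD(4)] liftsD(3)[OF G x] liftsD(3)[OF G' x] by simp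
qed

lemma lifts_neg:
  assumes G: "G \<in> Lf n g" and g: "g \<in> carrier (C n)"
  shows "(\<lambda>k x. \<ominus>\<^bsub>P k\<^esub> G k x) \<in> Lf n (\<ominus>\<^bsub>C n\<^esub> g)"
proof (rule liftsI)
  show "(\<lambda>x. \<ominus>\<^bsub>P k\<^esub> G k x) \<in> rmod_hom R (P (k + n)) (P k)" for k
    by (rule rmod_hom_inv[OF rmP liftsD(1)[OF G]])
  note agP = P.M.abelian_group_axioms
  fix x assume x: "x \<in> carrier (P n)"
  have "G 0 x \<in> carrier (P 0)" using rmod_homD(1)[OF liftsD(1)[OF G, of 0]] x by auto
  then show "res_aug A (\<ominus>\<^bsub>P 0\<^esub> G 0 x) = (\<ominus>\<^bsub>C n\<^esub> g) x"
    using x additive_inv[OF agP M.M.abelian_group_axioms rmod_homD(4)[OF AD(6)]] liftsD(2)[OF G x]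
    by (simp add: cochains_a_inv[OF g])
next
  note agP = P.M.abelian_group_axioms
  fix k x assume x: "x \<in> carrier (P (Suc (k + n)))"
  have "G (Suc k) x \<in> carrier (P (Suc k))" using rmod_homD(1)[OF liftsD(1)[OF G, of "Suc k"]] x by auto
  then show "d k (\<ominus>\<^bsub>P (Suc k)\<^esub> G (Suc k) x) = \<ominus>\<^bsub>P k\<^esub> G k (d (k + n) x)"
    using additive_inv[OF agP agP rmod_homD(4)[OF AD(4)]] liftsD(3)[OF G x] by simp
qed

text \<open>A chain map moves past the differential: \<open>u\<close> after \<open>d\<close> after
  \<open>G (Suc m')\<close> equals \<open>u\<close> after \<open>G m'\<close> after
  \<open>d\<close>, the coboundary of the composite of \<open>u\<close> with \<open>G\<close>. In
  degree 0 the only coboundary is zero.\<close>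

lemma cmp_coboundary:
  assumes b: "b \<in> B m" and G: "G \<in> Lf n g"
  shows "cmp m n b G \<in> B (m + n)"
proof (cases m)
  case 0
  have "cmp 0 n \<zero>\<^bsub>C 0\<^esub> G = \<zero>\<^bsub>C (0 + n)\<^esub>"
    unfolding cochains_ops using rmod_homD(1)[OF liftsD(1)[OF G, of 0]]
    by (auto simp: cmp_def intro!: restrict_ext)
  then show ?thesis using b 0 coboundaries_0 Q.B.zero_closed[of n] by simp
next
  case (Suc m')
  then obtain u where u: "u \<in> carrier (C m')" "b = \<delta> m' u" using b coboundaries_Suc by auto
  have "cmp m n b G x = \<delta> (m' + n) (cmp m' n u G) x" if x: "x \<in> carrier (P (m + n))" for x
  proof -
    have x': "x \<in> carrier (P (Suc (m' + n)))" using x Suc by simp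
    have "G m x \<in> carrier (P m)" using rmod_homD(1)[OF liftsD(1)[OF G]] x by blast
    then have "cmp m n b G x = u (d m' (G (Suc m') x))"
      using x u(2) Suc by (simp add: cmp_apply \<delta>_def)
    also have "\<dots> = u (G m' (d (m' + n) x))" using liftsD(3)[OF G x'] by simp
    also have "\<dots> = \<delta> (m' + n) (cmp m' n u G) x"
      using x' rmod_homD(1)[OF AD(4) x'] by (simp add: cmp_apply \<delta>_def)
    finally show ?thesis .
  qed
  moreover have c: "cmp m' n u G \<in> carrier (C (m' + n))" using cmp_cochain u(1) liftsD(1)[OF G] by blast
  moreover have "cmp m n b G \<in> carrier (C (m + n))"
    using cmp_cocycle[OF B_subset[OF b] G] by (rule Z_closed(1))
  ultimately have "cmp m n b G = \<delta> (m' + n) (cmp m' n u G)"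
    using Suc additiveD(1)[OF \<delta>_additive c]
    by (intro cochain_eqI[of _ "m + n"]) auto
  then show ?thesis using c Suc coboundaries_Suc by simp
qed

text \<open>The difference of two lifts of one cocycle lifts zero, hence is null homotopic.\<close>

lemma cmp_zero_lift:
  assumes f: "f \<in> Z m" and G: "G \<in> Lf n \<zero>\<^bsub>C n\<^esub>"
  shows "cmp m n f G \<in> B (m + n)"
proof -
  interpret comparison R "\<lambda>k. P (k + n)" "\<lambda>k. d (k + n)" M A by (rule shifted_comparison)
  have G': "\<And>k. G k \<in> rmod_hom R (P (k + n)) (P k)"
    "\<And>x. x \<in> carrier (P (0 + n)) \<Longrightarrow> res_aug A (G 0 x) = \<zero>\<^bsub>M\<^esub>"
    "\<And>k x. x \<in> carrier (P (Suc k + n)) \<Longrightarrow> d k (G (Suc k) x) = G k (d (k + n) x)"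
    using liftsD[OF G] by (simp_all add: cochains_ops)
  have f': "f \<in> rmod_hom R (P m) M" using f Z_closed by blast
  note fd = f[unfolded cocycles_iff, THEN conjunct2, rule_format]
  show ?thesis
  proof (cases m)
    case 0
    obtain h where h: "h \<in> rmod_hom R (P (0 + n)) (P (Suc 0))" "\<forall>x\<in>carrier (P (0 + n)). G 0 x = d 0 (h x)"
      using null_homotopy(1)[OF G'] by blast
    have "cmp m n f G = \<zero>\<^bsub>C n\<^esub>"
      unfolding cochains_ops using fd 0 h(2) rmod_homD(1)[OF h(1)]
      by (auto simp: cmp_def intro!: restrict_ext)
    then show ?thesis using 0 by simp
  next
    case (Suc m')
    obtain h h' where h: "h \<in> rmod_hom R (P (Suc m' + n)) (P (Suc (Suc m')))"
      and h': "h' \<in> rmod_hom R (P (m' + n)) (P (Suc m'))"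
      and eq: "\<forall>x\<in>carrier (P (Suc m' + n)). G (Suc m') x = d (Suc m') (h x) \<oplus>\<^bsub>P (Suc m')\<^esub> h' (d (m' + n) x)"
      using null_homotopy(2)[OF G', of m'] by blast
    \<comment> \<open>In the homotopy formula the cocycle \<open>f\<close> kills the term
      \<open>d m (h x)\<close>; what survives is \<open>f\<close> after \<open>h'\<close>,
      precomposed with the differential.\<close>
    let ?u = "restrict (\<lambda>x. f (h' x)) (carrier (P (m' + n)))"
    have u: "?u \<in> carrier (C (m' + n))"
      using restrict_cochain[OF rmod_hom_comp[OF h']] f' Suc by simp
    have "cmp m n f G = \<delta> (m' + n) ?u"
    proof (rule cochain_eqI[of _ "m + n"])
      show "cmp m n f G \<in> carrier (C (m + n))"
        using Z_closed(1)[OF f] liftsD(1)[OF G] by (rule cmp_cochain)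
      show "\<delta> (m' + n) ?u \<in> carrier (C (m + n))" using additiveD(1)[OF \<delta>_additive u] Suc by simp
      fix x assume x: "x \<in> carrier (P (m + n))"
      have x': "x \<in> carrier (P (Suc m' + n))" using x Suc by simp
      have dx: "d (m' + n) x \<in> carrier (P (m' + n))" using rmod_homD(1)[OF AD(4)] x' by simp
      have hx: "h x \<in> carrier (P (Suc m))" using rmod_homD(1)[OF h x'] Suc by simp
      have c: "d m (h x) \<in> carrier (P m)" using rmod_homD(1)[OF AD(4) hx] .
      have c': "h' (d (m' + n) x) \<in> carrier (P m)" using rmod_homD(1)[OF h' dx] Suc by simp
      have "G m x = d m (h x) \<oplus>\<^bsub>P m\<^esub> h' (d (m' + n) x)" using eq x' Suc by simp
      then have "f (G m x) = f (d m (h x)) \<oplus>\<^bsub>M\<^esub> f (h' (d (m' + n) x))"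
        using rmod_homD(2)[OF f' c c'] by simp
      also have "\<dots> = f (h' (d (m' + n) x))" using fd hx rmod_homD(1)[OF f' c'] by simp
      finally show "cmp m n f G x = \<delta> (m' + n) ?u x"
        using x x' dx by (simp add: cmp_apply \<delta>_def)
    qed
    then show ?thesis using u Suc coboundaries_Suc by simp
  qed
qed

lemma cmp_lift_diff:
  assumes f: "f \<in> Z m" and G: "G \<in> Lf n g" and G': "G' \<in> Lf n g" and g: "g \<in> carrier (C n)"
  shows "cls (m + n) (cmp m n f G') = cls (m + n) (cmp m n f G)"
proof -
  let ?H = "\<lambda>k x. G' k x \<oplus>\<^bsub>P k\<^esub> (\<ominus>\<^bsub>P k\<^esub> G k x)"
  have H: "?H \<in> Lf n \<zero>\<^bsub>C n\<^esub>"
    using lifts_add[OF G' lifts_neg[OF G g] g C.a_inv_closed[OF g]] g by (simp add: C.r_neg)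
  have "cmp m n f G' = cmp m n f ?H \<oplus>\<^bsub>C (m + n)\<^esub> cmp m n f G"
  proof (rule cmp_add_right[OF Z_closed(1)[OF f] H G])
    fix x assume x: "x \<in> carrier (P (m + n))"
    then have "G m x \<in> carrier (P m)" "G' m x \<in> carrier (P m)"
      using rmod_homD(1)[OF liftsD(1)[OF G]] rmod_homD(1)[OF liftsD(1)[OF G']] by blast+
    then show "G' m x = ?H m x \<oplus>\<^bsub>P m\<^esub> G m x" by (simp add: P.M.a_assoc P.M.l_neg)
  qed
  then show ?thesis using cls_add_boundary[OF cmp_zero_lift[OF f H] cmp_cocycle[OF f G]] by simp
qed

text \<open>By \<open>cmp_lift_diff\<close> one convenient lift decides for all. For
  \<open>b\<close> equal to \<open>u\<close> after \<open>d\<close>, lift \<open>u\<close> through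
  the augmentation to \<open>v\<close>, and use \<open>v\<close> after \<open>d\<close> at index 0
  and zero above; this is a chain map since the square of \<open>d\<close> vanishes. Composing with
  \<open>f\<close> gives the coboundary of \<open>f\<close> after \<open>v\<close> when
  \<open>m = 0\<close>, and zero when \<open>m > 0\<close>.\<close>

lemma coboundary_lift:
  assumes b: "b \<in> B n" and f: "f \<in> Z m"
  shows "\<exists>G\<in>Lf n b. cmp m n f G \<in> B (m + n)"
proof (cases n)
  case 0
  then have "b = \<zero>\<^bsub>C n\<^esub>" using b coboundaries_0 by simp
  moreover obtain G where "G \<in> Lf n b" using lift_exists[OF B_subset[OF b]] by blast
  ultimately show ?thesis using cmp_zero_lift[OF f] by blast
next
  case (Suc n')
  then obtain u where u: "u \<in> carrier (C n')" "b = \<delta> n' u" using b coboundaries_Suc by auto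
  have u': "u \<in> rmod_hom R (P n') M" using u(1) by (simp add: cochains_iff)
  have "u ` carrier (P n') \<subseteq> res_aug A ` carrier (P 0)" using rmod_homD(1)[OF u'] AD(8) by blast
  then obtain v where v: "v \<in> rmod_hom R (P n') (P 0)" "\<forall>x\<in>carrier (P n'). res_aug A (v x) = u x"
    using projective_lift[OF AD(2) rmP rmM AD(6) u'] by blast
  define G where "G k = (if k = 0 then (\<lambda>x. v (d n' x)) else (\<lambda>x. \<zero>\<^bsub>P k\<^esub>))" for k
  have G0: "G 0 \<in> rmod_hom R (P n) (P 0)" unfolding G_def using rmod_hom_comp[OF AD(4) v(1)] Suc by simp
  have L: "G \<in> Lf n b"
  proof (rule liftsI)
    show "G k \<in> rmod_hom R (P (k + n)) (P k)" for k
      using G0 rmod_hom_const_zero[OF rmP] by (cases k) (auto simp: G_def)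
    show "res_aug A (G 0 x) = b x" if "x \<in> carrier (P n)" for x
      using that u(2) v(2) rmod_homD(1)[OF AD(4)] Suc by (simp add: G_def \<delta>_def)
    fix k x assume x: "x \<in> carrier (P (Suc (k + n)))"
    have z: "d k \<zero>\<^bsub>P (Suc k)\<^esub> = \<zero>\<^bsub>P k\<^esub>" by (rule rmod_hom_zero[OF rmP rmP AD(4)])
    show "d k (G (Suc k) x) = G k (d (k + n) x)"
    proof (cases k)
      case 0
      then have "d n' (d n x) = \<zero>\<^bsub>P n'\<^esub>" using resolution_complex(2)[OF A] x Suc by simp
      then show ?thesis using 0 z rmod_hom_zero[OF rmP rmP v(1)] by (simp add: G_def)
    qed (use z in \<open>simp add: G_def\<close>)
  qed
  have f': "f \<in> rmod_hom R (P m) M" using f Z_closed by blast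
  have "cmp m n f G \<in> B (m + n)"
  proof (cases m)
    case 0
    let ?w = "restrict (\<lambda>x. f (v x)) (carrier (P n'))"
    have w: "?w \<in> carrier (C n')" using restrict_cochain[OF rmod_hom_comp[OF v(1)]] f' 0 by simp
    have "cmp m n f G = \<delta> n' ?w"
      using 0 Suc rmod_homD(1)[OF AD(4)] by (auto simp: cmp_def \<delta>_def G_def intro!: restrict_ext)
    then show ?thesis using w 0 Suc coboundaries_Suc by simp
  next
    case (Suc m')
    then have "cmp m n f G = \<zero>\<^bsub>C (m + n)\<^esub>"
      using rmod_hom_zero[OF rmP rmM f'] unfolding cochains_ops
      by (auto simp: cmp_def G_def intro!: restrict_ext)
    then show ?thesis by simp
  qed
  then show ?thesis using L by blast
qed

text \<open>Removes the three choices in turn. The coboundary in \<open>f'\<close> contributes a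
  coboundary; then the lift \<open>G'\<close> is exchanged for \<open>?S\<close>, the sum of
  \<open>G\<close> and the special lift of \<open>c\<close>, which also lifts \<open>g'\<close> and
  differs from \<open>G\<close> by a map whose contribution is a coboundary.\<close>

lemma cmp_cls_cong:
  assumes f: "f \<in> Z m" and g: "g \<in> Z n" and G: "G \<in> Lf n g"
    and f': "f' \<in> cls m f" and g': "g' \<in> cls n g" and G': "G' \<in> Lf n g'"
  shows "cls (m + n) (cmp m n f' G') = cls (m + n) (cmp m n f G)"
proof -
  obtain b where b: "b \<in> B m" "f' = b \<oplus>\<^bsub>C m\<^esub> f" using f' cls_mem by blast
  obtain c where c: "c \<in> B n" "g' = c \<oplus>\<^bsub>C n\<^esub> g" using g' cls_mem by blast
  obtain H where H: "H \<in> Lf n c" "cmp m n f H \<in> B (m + n)" using coboundary_lift[OF c(1) f] by blast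
  let ?S = "\<lambda>k x. H k x \<oplus>\<^bsub>P k\<^esub> G k x"
  have gc: "g \<in> carrier (C n)" "c \<in> carrier (C n)" using g B_subset[OF c(1)] Z_closed by blast+
  have S: "?S \<in> Lf n g'" using lifts_add[OF H(1) G gc(2,1)] c(2) by simp
  have g'c: "g' \<in> carrier (C n)" using gc c(2) by simp
  have "cls (m + n) (cmp m n f' G') = cls (m + n) (cmp m n b G' \<oplus>\<^bsub>C (m + n)\<^esub> cmp m n f G')"
    using cmp_add_left[of G' m n b f] liftsD(1)[OF G'] b(2) by simp
  also have "\<dots> = cls (m + n) (cmp m n f G')"
    by (rule cls_add_boundary[OF cmp_coboundary[OF b(1) G'] cmp_cocycle[OF f G']])
  also have "\<dots> = cls (m + n) (cmp m n f ?S)" by (rule cmp_lift_diff[OF f S G' g'c])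
  also have "\<dots> = cls (m + n) (cmp m n f H \<oplus>\<^bsub>C (m + n)\<^esub> cmp m n f G)"
    using cmp_add_right[OF Z_closed(1)[OF f] H(1) G, of ?S] by simp
  also have "\<dots> = cls (m + n) (cmp m n f G)" by (rule cls_add_boundary[OF H(2) cmp_cocycle[OF f G]])
  finally show ?thesis .
qed

text \<open>All members of the union in \<open>yoneda\<close> coincide and there is at least one, so
  products may be computed with any representatives and any lift.\<close>

lemma yon_cls:
  assumes f: "f \<in> Z m" and g: "g \<in> Z n" and G: "G \<in> Lf n g"
  shows "yon m n (cls m f) (cls n g) = cls (m + n) (cmp m n f G)"
proof
  show "yon m n (cls m f) (cls n g) \<subseteq> cls (m + n) (cmp m n f G)"
    unfolding yoneda_def cmp_def[symmetric] using cmp_cls_cong[OF f g G] by blast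
  show "cls (m + n) (cmp m n f G) \<subseteq> yon m n (cls m f) (cls n g)"
    unfolding yoneda_def cmp_def[symmetric] using cls_self_mem[OF f] cls_self_mem[OF g] G by blast
qed

section \<open>Ring laws for the Yoneda product of classes\<close>

lemma E_cases:
  assumes "X \<in> carrier (E n)"
  obtains f where "f \<in> Z n" "X = cls n f"
  using assms unfolding E_carrier by blast

lemma yon_closed:
  assumes "X \<in> carrier (E m)" "Y \<in> carrier (E n)"
  shows "yon m n X Y \<in> carrier (E (m + n))"
proof -
  obtain f g where f: "f \<in> Z m" "X = cls m f" and g: "g \<in> Z n" "Y = cls n g"
    using assms E_cases by metis
  obtain G where G: "G \<in> Lf n g" using lift_exists[OF g(1)] by blast
  show ?thesis using yon_cls[OF f(1) g(1) G] f g cls_closed[OF cmp_cocycle[OF f(1) G]] by simp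
qed

lemma yon_add_left:
  assumes "X \<in> carrier (E m)" "X' \<in> carrier (E m)" "Y \<in> carrier (E n)"
  shows "yon m n (X \<oplus>\<^bsub>E m\<^esub> X') Y = yon m n X Y \<oplus>\<^bsub>E (m + n)\<^esub> yon m n X' Y"
proof -
  obtain f f' g where f: "f \<in> Z m" "X = cls m f" and f': "f' \<in> Z m" "X' = cls m f'"
    and g: "g \<in> Z n" "Y = cls n g"
    using assms E_cases by metis
  obtain G where G: "G \<in> Lf n g" using lift_exists[OF g(1)] by blast
  have ff: "f \<oplus>\<^bsub>C m\<^esub> f' \<in> Z m" using f f' by simp
  show ?thesis
    using yon_cls[OF f(1) g(1) G] yon_cls[OF f'(1) g(1) G] yon_cls[OF ff g(1) G] f f' g
      cmp_add_left[of G m n f f', OF liftsD(1)[OF G]]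
    by (simp add: cls_add cmp_cocycle[OF _ G])
qed

lemma yon_add_right:
  assumes "X \<in> carrier (E m)" "Y \<in> carrier (E n)" "Y' \<in> carrier (E n)"
  shows "yon m n X (Y \<oplus>\<^bsub>E n\<^esub> Y') = yon m n X Y \<oplus>\<^bsub>E (m + n)\<^esub> yon m n X Y'"
proof -
  obtain f g g' where f: "f \<in> Z m" "X = cls m f" and g: "g \<in> Z n" "Y = cls n g"
    and g': "g' \<in> Z n" "Y' = cls n g'"
    using assms E_cases by metis
  obtain G G' where G: "G \<in> Lf n g" and G': "G' \<in> Lf n g'"
    using lift_exists[OF g(1)] lift_exists[OF g'(1)] by blast
  have gg: "g \<oplus>\<^bsub>C n\<^esub> g' \<in> Z n" using g g' by simp
  have S: "(\<lambda>k x. G k x \<oplus>\<^bsub>P k\<^esub> G' k x) \<in> Lf n (g \<oplus>\<^bsub>C n\<^esub> g')"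
    by (rule lifts_add[OF G G']) (use g g' Z_closed in auto)
  show ?thesis
    using yon_cls[OF f(1) g(1) G] yon_cls[OF f(1) g'(1) G'] yon_cls[OF f(1) gg S] f g g'
      cmp_add_right[OF Z_closed(1)[OF f(1)] G G',
        of "\<lambda>k x. G k x \<oplus>\<^bsub>P k\<^esub> G' k x"]
    by (simp add: cls_add cmp_cocycle[OF _ G] cmp_cocycle[OF _ G'])
qed

lemma yon_assoc:
  assumes "X \<in> carrier (E m)" "Y \<in> carrier (E n)" "W \<in> carrier (E p)"
  shows "yon (m + n) p (yon m n X Y) W = yon m (n + p) X (yon n p Y W)"
proof -
  obtain f g h where f: "f \<in> Z m" "X = cls m f" and g: "g \<in> Z n" "Y = cls n g"
    and h: "h \<in> Z p" "W = cls p h"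
    using assms E_cases by metis
  obtain G H where G: "G \<in> Lf n g" and H: "H \<in> Lf p h"
    using lift_exists[OF g(1)] lift_exists[OF h(1)] by blast
  \<comment> \<open>The composite chain map lifts the composite cocycle; \<open>H\<close> is taken
    at \<open>k + n\<close> because \<open>G k\<close> starts from \<open>P (k + n)\<close>. With
    this lift the two bracketings agree already as cochains.\<close>
  let ?L = "\<lambda>k x. G k (H (k + n) x)"
  have Hc: "H (k + n) x \<in> carrier (P (k + n))" if "x \<in> carrier (P (k + (n + p)))" for k x
    using rmod_homD(1)[OF liftsD(1)[OF H, of "k + n"]] that by (simp add: add.assoc)
  have L: "?L \<in> Lf (n + p) (cmp n p g H)"
  proof (rule liftsI)
    show "?L k \<in> rmod_hom R (P (k + (n + p))) (P k)" for k
      using rmod_hom_comp[OF liftsD(1)[OF H, of "k + n"] liftsD(1)[OF G]] by (simp add: add.assoc)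
    show "res_aug A (?L 0 x) = cmp n p g H x" if x: "x \<in> carrier (P (n + p))" for x
      using liftsD(2)[OF G] Hc[of x 0] x by (simp add: cmp_apply)
    fix k x assume x: "x \<in> carrier (P (Suc (k + (n + p))))"
    have x': "x \<in> carrier (P (Suc (k + n + p)))" using x by (simp add: add.assoc)
    have Hx: "H (Suc k + n) x \<in> carrier (P (Suc (k + n)))" using Hc[of x "Suc k"] x by simp
    have "d k (?L (Suc k) x) = G k (d (k + n) (H (Suc (k + n)) x))"
      using liftsD(3)[OF G Hx] by simp
    also have "\<dots> = G k (H (k + n) (d (k + n + p) x))" using liftsD(3)[OF H x'] by simp
    finally show "d k (?L (Suc k) x) = ?L k (d (k + (n + p)) x)" by (simp add: add.assoc)
  qed
  have "cmp (m + n) p (cmp m n f G) H = cmp m (n + p) f ?L"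
    unfolding cmp_def using Hc by (auto simp: add.assoc intro!: restrict_ext)
  then show ?thesis
    using f g h yon_cls[OF f(1) g(1) G] yon_cls[OF cmp_cocycle[OF f(1) G] h(1) H]
      yon_cls[OF g(1) h(1) H] yon_cls[OF f(1) cmp_cocycle[OF g(1) H] L]
    by (simp add: add.assoc)
qed

abbreviation "aug \<equiv> restrict (res_aug A) (carrier (P 0))"

lemma aug_cocycle: "aug \<in> Z 0"
  unfolding cocycles_iff
  using restrict_cochain[OF AD(6)] rmod_homD(1)[OF AD(4)] resolution_complex(1)[OF A] by simp

text \<open>A lift of \<open>g\<close> is by definition compatible with the augmentation at index 0,
  so the equality holds for cochains.\<close>

lemma yon_unit_left:
  assumes "X \<in> carrier (E n)" shows "yon 0 n (cls 0 aug) X = X"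
proof -
  obtain g where g: "g \<in> Z n" "X = cls n g" using assms E_cases by metis
  obtain G where G: "G \<in> Lf n g" using lift_exists[OF g(1)] by blast
  have "cmp 0 n aug G = g"
    using liftsD(2)[OF G] rmod_homD(1)[OF liftsD(1)[OF G, of 0]] Z_closed(1)[OF g(1)]
      Z_closed(1)[OF cmp_cocycle[OF aug_cocycle G]]
    by (intro cochain_eqI[of _ n]) (auto simp: cmp_apply)
  then show ?thesis using yon_cls[OF aug_cocycle g(1) G] g(2) by simp
qed

text \<open>The identity is one lift of the augmentation, and any other gives the same class. The
  freedom in \<open>G\<close> is used again in \<open>D_vanish\<close>, for a map that factors
  through the linear resolution.\<close>

lemma yon_unit_right_cmp:
  assumes f: "f \<in> Z n" and G: "G \<in> Lf 0 aug"
  shows "cls n (cmp n 0 f G) = cls n f"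
proof -
  have I: "(\<lambda>k x. x) \<in> Lf 0 aug" by (rule liftsI) (auto intro: rmod_homI)
  have "cmp n 0 f (\<lambda>k x. x) = f"
    using Z_closed(1)[OF f] Z_closed(1)[OF cmp_cocycle[OF f I]]
    by (intro cochain_eqI[of _ n]) (auto simp: cmp_apply)
  then show ?thesis using cmp_lift_diff[OF f I G Z_closed(1)[OF aug_cocycle]] by simp
qed

lemma yon_unit_right:
  assumes "X \<in> carrier (E n)" shows "yon n 0 X (cls 0 aug) = X"
proof -
  obtain f where f: "f \<in> Z n" "X = cls n f" using assms E_cases by metis
  obtain G where G: "G \<in> Lf 0 aug" using lift_exists[OF aug_cocycle] by blast
  show ?thesis using yon_cls[OF f(1) aug_cocycle G] yon_unit_right_cmp[OF f(1) G] f(2) by simp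
qed

text \<open>From here on the facts named after \<open>X\<close> speak about the Ext algebra.\<close>

sublocale graded_product "ext_space R M A" "yoneda R M A" "cls 0 aug" "ext_algebra R M A"
proof
qed (use E_group yon_closed yon_add_left yon_add_right yon_assoc cls_closed[OF aug_cocycle]
  yon_unit_left yon_unit_right in \<open>simp_all add: ext_algebra_def\<close>)

end

section \<open>The grading of the Ext algebra\<close>

text \<open>The homogeneous component \<open>e\<close> of degree \<open>0\<close> of \<open>\<one>\<close> is a right unit: compare the components
  of degree \<open>j\<close> in \<open>x = x \<otimes> \<one>\<close> for \<open>x\<close> homogeneous of degree \<open>j\<close>.\<close>

lemma (in graded_algebra) one_in_degree_zero: "\<one>\<^bsub>R\<^esub> \<in> acomp R 0"
proof -
  interpret g: graded_group R "acomp R" by unfold_locales (rule grading)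
  let ?e = "hpart R (acomp R) \<one>\<^bsub>R\<^esub> 0"
  have e: "?e \<in> acomp R 0" "?e \<in> carrier R"
    using g.hpart_props(1)[OF R.one_closed] g.hpart_closed[OF R.one_closed] by blast+
  have "\<one>\<^bsub>R\<^esub> \<otimes>\<^bsub>R\<^esub> ?e = \<one>\<^bsub>R\<^esub>"
  proof (rule g.additive_eqI[where f = "\<lambda>x. x \<otimes>\<^bsub>R\<^esub> ?e" and g = "\<lambda>x. x",
      OF R.abelian_group_axioms _ _ _ R.one_closed])
    show "additive R R (\<lambda>x. x \<otimes>\<^bsub>R\<^esub> ?e)" "additive R R (\<lambda>x. x)"
      unfolding additive_def using e by (auto simp: R.l_distr)
    fix j x assume x: "x \<in> acomp R j"
    have xc: "x \<in> carrier R" using g.comp_closed[OF x] .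
    have "hpart R (acomp R) (x \<otimes>\<^bsub>R\<^esub> \<one>\<^bsub>R\<^esub>) (j + 0) = x \<otimes>\<^bsub>R\<^esub> ?e"
    proof (rule hpart_map[OF g.graded_group_axioms g.graded_group_axioms])
      show "additive R R ((\<otimes>\<^bsub>R\<^esub>) x)" unfolding additive_def using xc by (auto simp: R.r_distr)
      show "(\<otimes>\<^bsub>R\<^esub>) x ` acomp R k \<subseteq> acomp R (j + k)" for k using acomp_mult[OF x] by blast
    qed simp
    then show "x \<otimes>\<^bsub>R\<^esub> ?e = x" using xc g.hpart_hom[OF x] by simp
  qed
  then show ?thesis using e by simp
qed

text \<open>Degree 0 is why scalars preserve the degree of a cochain; centrality is why a scaled
  homomorphism is again \<open>R\<close>-linear.\<close>

lemma (in graded_algebra) scalar_central: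
  assumes a: "a \<in> carrier K"
  shows "a \<odot>\<^bsub>R\<^esub> \<one>\<^bsub>R\<^esub> \<in> acomp R 0" "a \<odot>\<^bsub>R\<^esub> \<one>\<^bsub>R\<^esub> \<in> carrier R"
    "r \<in> carrier R \<Longrightarrow> (a \<odot>\<^bsub>R\<^esub> \<one>\<^bsub>R\<^esub>) \<otimes>\<^bsub>R\<^esub> r = r \<otimes>\<^bsub>R\<^esub> (a \<odot>\<^bsub>R\<^esub> \<one>\<^bsub>R\<^esub>)"
proof -
  show "a \<odot>\<^bsub>R\<^esub> \<one>\<^bsub>R\<^esub> \<in> acomp R 0"
    using submodule.smult_closed[OF acomp_subspace a one_in_degree_zero] .
  show "a \<odot>\<^bsub>R\<^esub> \<one>\<^bsub>R\<^esub> \<in> carrier R" using a by simp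
  show "r \<in> carrier R \<Longrightarrow> (a \<odot>\<^bsub>R\<^esub> \<one>\<^bsub>R\<^esub>) \<otimes>\<^bsub>R\<^esub> r = r \<otimes>\<^bsub>R\<^esub> (a \<odot>\<^bsub>R\<^esub> \<one>\<^bsub>R\<^esub>)"
    using a by (simp add: smult_mult_left smult_mult_right)
qed

text \<open>The kernel is a submodule, hence everything as soon as it contains the generating
  component.\<close>

lemma generated_in_degree_hom_zero:
  assumes P: "right_module R P" and N: "right_module R N" and f: "f \<in> rmod_hom R P N"
    and gen: "generated_in_degree R P k" and z: "\<And>x. x \<in> mcomp P k \<Longrightarrow> f x = \<zero>\<^bsub>N\<^esub>"
    and sub: "mcomp P k \<subseteq> carrier P" and x: "x \<in> carrier P"
  shows "f x = \<zero>\<^bsub>N\<^esub>"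
proof -
  interpret P: right_module R P by fact
  interpret N: right_module R N by fact
  let ?E = "{x \<in> carrier P. f x = \<zero>\<^bsub>N\<^esub>}"
  have "additive_subgroup ?E P"
    by (rule additive_subgroup_kernel[OF P.M.abelian_group_axioms N.M.abelian_group_axioms rmod_homD(4)[OF f]])
  then have "rsubmodule R P ?E"
    unfolding rsubmodule_def using rmod_homD(3)[OF f] P.act_closed N.act_zero_left by auto
  moreover have "mcomp P k \<subseteq> ?E" using z sub by auto
  ultimately have "rspan R P (mcomp P k) \<subseteq> ?E" unfolding rspan_def by blast
  then show ?thesis using gen x unfolding generated_in_degree_def by blast
qed

text \<open>The grading of \<open>R\<close> starts at 0, so the elements without parts below degree
  \<open>j\<close> form a submodule, and this submodule contains the generators.\<close>

lemma generated_in_degree_lower_zero: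
  assumes M: "graded_module R M" and R: "is_grading R (acomp R)" "abelian_group R"
    and gen: "generated_in_degree R M j" and k: "k < j"
  shows "mcomp M k = {\<zero>\<^bsub>M\<^esub>}"
proof -
  interpret M: graded_module R M by fact
  interpret g: graded_group M "mcomp M" by (rule graded_module_group(1)[OF M])
  interpret r: graded_group R "acomp R" by (rule graded_group.intro[OF R(2)]) (unfold_locales, rule R(1))
  let ?S = "{x \<in> carrier M. \<forall>k<j. hpart M (mcomp M) x k = \<zero>\<^bsub>M\<^esub>}"
  have ag: "abelian_group M" by unfold_locales
  have "additive_subgroup ?S M"
  proof (rule additive_subgroupI'[OF ag])
    show "\<And>x. x \<in> ?S \<Longrightarrow> \<ominus>\<^bsub>M\<^esub> x \<in> ?S"
      using additive_inv[OF ag ag g.additive_hpart] by simp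
  qed (auto simp: g.hpart_add)
  moreover have "x \<triangleleft>\<^bsub>M\<^esub> r \<in> ?S" if x: "x \<in> ?S" and r: "r \<in> carrier R" for x r
    using r
  proof (induction rule: r.hom_induct)
    case zero
    show ?case using x M.act_zero_right by simp
  next
    case (add r s)
    then show ?case using x M.act_add_right M.act_closed by (simp add: g.hpart_add)
  next
    case (hom i r)
    have rc: "r \<in> carrier R" using r.comp_closed[OF hom] .
    have "hpart M (mcomp M) (x \<triangleleft>\<^bsub>M\<^esub> r) k = \<zero>\<^bsub>M\<^esub>" if "k < j" for k
    proof -
      \<comment> \<open>The part in degree \<open>k\<close> comes from degree
        \<open>k - int i\<close>, which is again below \<open>j\<close>.\<close>
      have "hpart M (mcomp M) (x \<triangleleft>\<^bsub>M\<^esub> r) (int i + (k - int i)) = hpart M (mcomp M) x (k - int i) \<triangleleft>\<^bsub>M\<^esub> r"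
        by (rule hpart_act[OF M _ rc hom]) (use x in simp)
      then show ?thesis using x that M.act_zero_left[OF rc] by simp
    qed
    then show ?case using x rc M.act_closed by simp
  qed
  ultimately have "rsubmodule R M ?S" unfolding rsubmodule_def by blast
  moreover have "mcomp M j \<subseteq> ?S"
    using g.hpart_hom g.comp_closed by auto
  ultimately have "rspan R M (mcomp M j) \<subseteq> ?S" unfolding rspan_def by blast
  then have S: "carrier M \<subseteq> ?S" using gen unfolding generated_in_degree_def by blast
  have "x = \<zero>\<^bsub>M\<^esub>" if x: "x \<in> mcomp M k" for x
  proof -
    have "hpart M (mcomp M) x k = \<zero>\<^bsub>M\<^esub>" using S g.comp_closed[OF x] k by blast
    then show ?thesis using g.hpart_hom[OF x] by simp
  qed
  then show ?thesis using g.comp_zero by blast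
qed

section \<open>Homogeneous classes, their products and their independence\<close>

context ext_setup begin

definition Zd :: "nat \<Rightarrow> int \<Rightarrow> ('p \<Rightarrow> 'm) set" where
  "Zd n i = {f \<in> Z n. has_degree (P n) M i f}"

lemma D_eq: "D n i = cls n ` Zd n i"
  unfolding ext_degree_def Zd_def by blast

sublocale gM: graded_group M "mcomp M" by (rule graded_module_group(1)[OF M])
sublocale gP: graded_group "P n" "mcomp (P n)" for n by (rule graded_module_group(1)[OF AD(1)])

lemma cochain_zero_apply: "x \<in> carrier (P n) \<Longrightarrow> \<zero>\<^bsub>C n\<^esub> x = \<zero>\<^bsub>M\<^esub>"
  by (simp add: cochains_ops(1))

lemma Zd_subgroup: "additive_subgroup (Zd n i) (C n)"
proof (rule additive_subgroupI'[OF cochains_group])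
  show "Zd n i \<subseteq> carrier (C n)" unfolding Zd_def using Z_closed by blast
  have "has_degree (P n) M i \<zero>\<^bsub>C n\<^esub>"
    unfolding has_degree_def using gP.comp_closed by (auto simp: cochain_zero_apply)
  then show "\<zero>\<^bsub>C n\<^esub> \<in> Zd n i" unfolding Zd_def by simp
  show "f \<oplus>\<^bsub>C n\<^esub> g \<in> Zd n i" if "f \<in> Zd n i" "g \<in> Zd n i" for f g
    using that gP.comp_closed gM.comp_add unfolding Zd_def has_degree_def
    by (auto simp: cochains_ops image_subset_iff Q.Z.a_closed[unfolded cochains_ops])
  show "\<ominus>\<^bsub>C n\<^esub> f \<in> Zd n i" if "f \<in> Zd n i" for f
    using that gP.comp_closed additive_subgroup.a_inv_closed[OF gM.comp_subgroup] Q.Z.a_inv_closed[of f n]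
    unfolding Zd_def has_degree_def by (auto simp: image_subset_iff cochains_a_inv Z_closed)
qed

lemma D_subgroup: "additive_subgroup (D n i) (E n)"
  unfolding D_eq E_eq ext_class_def
  by (rule Q.additive_subgroup_classes[OF Zd_subgroup]) (auto simp: Zd_def)

lemma D_closed: "X \<in> D n i \<Longrightarrow> X \<in> carrier (E n)"
  using additive_subgroup.a_subset[OF D_subgroup] by blast

lemma D_mult:
  assumes "X \<in> D m i" "Y \<in> D n j"
  shows "yon m n X Y \<in> D (m + n) (i + j)"
proof -
  obtain f g where f: "f \<in> Z m" "X = cls m f" "has_degree (P m) M i f"
    and g: "g \<in> Z n" "Y = cls n g" "has_degree (P n) M j g"
    using assms unfolding ext_degree_def by blast
  obtain G where G: "G \<in> Lf n g" "\<And>k. has_degree (P (k + n)) (P k) j (G k)"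
    using lift_exists[OF g(1), of j] g(3) by blast
  have "has_degree (P (m + n)) M (i + j) (\<lambda>x. f (G m x))"
    using has_degree_comp[OF G(2) f(3)] .
  then have "has_degree (P (m + n)) M (i + j) (cmp m n f G)"
    unfolding has_degree_def using gP.comp_closed by (auto simp: cmp_apply image_subset_iff)
  then show ?thesis
    unfolding ext_degree_def using yon_cls[OF f(1) g(1) G(1)] cmp_cocycle[OF f(1) G(1)] f(2) g(2) by blast
qed

text \<open>Bilinearity spreads \<open>D_mult\<close> from single degrees to sums. The index sets
  stay general because the ideal property pairs an open half-line of degrees with a closed
  one.\<close>

lemma internal_sum_mult:
  assumes X: "X \<in> internal_sum (E m) I (ext_degree R M A m)"
    and Y: "Y \<in> internal_sum (E n) J (ext_degree R M A n)"
    and L: "\<And>i j. \<lbrakk>i \<in> I; j \<in> J\<rbrakk> \<Longrightarrow> i + j \<in> L"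
  shows "yon m n X Y \<in> internal_sum (E (m + n)) L (ext_degree R M A (m + n))"
proof -
  let ?S = "internal_sum (E (m + n)) L (ext_degree R M A (m + n))"
  interpret S: additive_subgroup ?S "E (m + n)"
    by (rule E.additive_subgroup_internal_sum[OF D_subgroup])
  have sub: "ext_degree R M A k i \<subseteq> carrier (E k)" for k i using D_closed by blast
  have "internal_sum (E n) J (ext_degree R M A n) \<subseteq> carrier (E n)"
    by (rule E.internal_sum_closed) (rule sub)
  with Y have Yc: "Y \<in> carrier (E n)" by blast
  show ?thesis using X
  proof (induction rule: E.internal_sum_induct)
    case zero
    show ?case using \<mu>_zero_left[OF Yc] by simp
  next
    case (add X X')
    then show ?case using yon_add_left Yc by simp
  next
    case (hom i X)
    have Xc: "X \<in> carrier (E m)" using D_closed hom(2) by blast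
    show ?case using Y
    proof (induction rule: E.internal_sum_induct)
      case zero
      show ?case using \<mu>_zero_right[OF Xc] by simp
    next
      case (add Y Y')
      then show ?case using yon_add_right Xc by simp
    next
      case (hom j Y)
      then show ?case using D_mult[OF \<open>X \<in> D m i\<close> hom(2)] L[OF \<open>i \<in> I\<close> hom(1)] D_closed
        by (intro E.internal_sum_incl) auto
    qed (rule sub)
  qed (rule sub)
qed

text \<open>Components commute with precomposition by \<open>d n\<close>, and every component of the
  zero map is zero.\<close>

lemma hom_comp_cocycle:
  assumes f: "f \<in> Z n"
  shows "hom_comp (P n) M i f \<in> Zd n i"
proof -
  have f': "f \<in> rmod_hom R (P n) M" using f Z_closed by blast
  have "hom_comp (P n) M i f (d n x) = \<zero>\<^bsub>M\<^esub>" if x: "x \<in> carrier (P (Suc n))" for x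
  proof -
    let ?h = "\<lambda>x. f (d n x)"
    have z: "?h x = \<zero>\<^bsub>M\<^esub>" if "x \<in> carrier (P (Suc n))" for x using f that by (simp add: cocycles_iff)
    interpret graded_pair "P (Suc n)" "mcomp (P (Suc n))" M "mcomp M" by (rule graded_module_pair[OF AD(1) M])
    have "hom_comp (P (Suc n)) M i ?h x = \<zero>\<^bsub>M\<^esub>"
      by (rule hcomp_eqI[OF rmod_homD(4)[OF rmod_hom_comp[OF AD(4) f']] _ _ x])
        (use z in \<open>auto simp: additive_def gP.comp_closed\<close>)
    then show ?thesis using hom_comp_precomp[OF AD(1) AD(1) M AD(4,5) f' x, of ?h i] by simp
  qed
  moreover have "hom_comp (P n) M i f \<in> extensional (carrier (P n))" unfolding hcomp_def by simp
  ultimately show ?thesis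
    using hom_comp_rmod_hom[OF AD(1) M R_graded f'] hom_comp_has_degree[OF AD(1) M f']
    by (simp add: Zd_def cocycles_iff cochains_iff)
qed

text \<open>A component of \<open>u\<close> after \<open>d\<close> is the component of
  \<open>u\<close> after \<open>d\<close>, hence again a coboundary. So components make sense on
  classes, the basis of \<open>D_independent\<close>.\<close>

lemma hom_comp_coboundary:
  assumes b: "b \<in> B n"
  shows "hom_comp (P n) M i b \<in> B n"
proof -
  have bZ: "b \<in> Z n" using B_subset[OF b] .
  have c: "hom_comp (P n) M i b \<in> carrier (C n)" using hom_comp_cocycle[OF bZ] Z_closed unfolding Zd_def by blast
  show ?thesis
  proof (cases n)
    case 0
    then have b0: "b = \<zero>\<^bsub>C 0\<^esub>" using b coboundaries_0 by simp
    interpret graded_pair "P 0" "mcomp (P 0)" M "mcomp M" by (rule graded_module_pair[OF AD(1) M])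
    have "hom_comp (P 0) M i b x = \<zero>\<^bsub>M\<^esub>" if x: "x \<in> carrier (P 0)" for x
      by (rule hcomp_eqI[OF _ _ _ x]) (use b0 gP.comp_closed in \<open>auto simp: additive_def cochains_ops\<close>)
    then have "hom_comp (P n) M i b = \<zero>\<^bsub>C n\<^esub>"
      using 0 by (intro cochain_eqI[OF c]) (auto simp: cochain_zero_apply)
    then show ?thesis by simp
  next
    case (Suc m)
    then obtain u where u: "u \<in> carrier (C m)" "b = \<delta> m u" using b coboundaries_Suc by auto
    have u': "u \<in> rmod_hom R (P m) M" using u(1) by (simp add: cochains_iff)
    let ?v = "hom_comp (P m) M i u"
    have v: "?v \<in> carrier (C m)"
      unfolding cochains_iff using hom_comp_rmod_hom[OF AD(1) M R_graded u'] by (simp add: hcomp_def)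
    have "hom_comp (P n) M i b = \<delta> m ?v"
    proof (rule cochain_eqI[OF c])
      show "\<delta> m ?v \<in> carrier (C n)" using additiveD(1)[OF \<delta>_additive v] Suc by simp
      fix x assume x: "x \<in> carrier (P n)"
      then show "hom_comp (P n) M i b x = \<delta> m ?v x"
        using hom_comp_precomp[OF AD(1) AD(1) M AD(4,5) u', of x b i] Suc u(2) by (simp add: \<delta>_def)
    qed
    then show ?thesis using v Suc coboundaries_Suc by simp
  qed
qed

lemma hom_comp_cochain_add:
  assumes "f \<in> Z n" "g \<in> Z n"
  shows "hom_comp (P n) M i (f \<oplus>\<^bsub>C n\<^esub> g) = hom_comp (P n) M i f \<oplus>\<^bsub>C n\<^esub> hom_comp (P n) M i g"
proof -
  interpret graded_pair "P n" "mcomp (P n)" M "mcomp M" by (rule graded_module_pair[OF AD(1) M])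
  have c: "hom_comp (P n) M i h \<in> carrier (C n)" if "h \<in> Z n" for h
    using hom_comp_cocycle[OF that, of i] Z_closed(1) unfolding Zd_def by blast
  note fg = c[OF assms(1)] c[OF assms(2)] c[OF Q.Z.a_closed[OF assms]]
  show ?thesis
  proof (rule cochain_eqI[OF fg(3) C.a_closed[OF fg(1,2)]])
    fix x assume x: "x \<in> carrier (P n)"
    have "hom_comp (P n) M i (f \<oplus>\<^bsub>C n\<^esub> g) x = hom_comp (P n) M i f x \<oplus>\<^bsub>M\<^esub> hom_comp (P n) M i g x"
      by (rule hcomp_add[OF rmod_homD(4)[OF Z_closed(2)[OF assms(1)]] rmod_homD(4)[OF Z_closed(2)[OF assms(2)]] x])
        (simp add: cochains_ops)
    then show "hom_comp (P n) M i (f \<oplus>\<^bsub>C n\<^esub> g) x = (hom_comp (P n) M i f \<oplus>\<^bsub>C n\<^esub> hom_comp (P n) M i g) x"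
      using x by (simp add: cochains_ops)
  qed
qed

lemma hom_comp_Zd:
  assumes "f \<in> Zd n i"
  shows "hom_comp (P n) M j f = (if j = i then f else \<zero>\<^bsub>C n\<^esub>)"
proof -
  have f: "f \<in> Z n" "has_degree (P n) M i f" using assms by (auto simp: Zd_def)
  show ?thesis
    using hom_comp_of_degree[OF AD(1) M Z_closed(2)[OF f(1)] f(2)]
      hom_comp_cocycle[OF f(1), of j] Z_closed f(1)
    by (intro cochain_eqI[of _ n]) (auto simp: cochain_zero_apply Zd_def)
qed

text \<open>One representative \<open>f\<close> of \<open>X\<close>, a sum of cocycles with degrees
  in \<open>J\<close>, has a coboundary as its component of degree \<open>j\<close>; another,
  \<open>g\<close>, is its own component of degree \<open>j\<close>. Their difference is a
  coboundary, so taking components shows that \<open>g\<close> is one too.\<close>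

lemma D_independent:
  assumes X: "X \<in> internal_sum (E n) J (ext_degree R M A n)" "X \<in> D n j" and j: "j \<notin> J"
  shows "X = \<zero>\<^bsub>E n\<^esub>"
proof -
  have "\<exists>f\<in>Z n. X = cls n f \<and> hom_comp (P n) M j f \<in> B n"
    using X(1)
  proof (induction rule: E.internal_sum_induct)
    case zero
    have "\<zero>\<^bsub>C n\<^esub> \<in> B n" by simp
    then show ?case using hom_comp_coboundary cls_boundary B_subset by metis
  next
    case (hom i X)
    then obtain f where f: "f \<in> Zd n i" "X = cls n f" unfolding D_eq by blast
    have "hom_comp (P n) M j f = \<zero>\<^bsub>C n\<^esub>" using hom_comp_Zd[OF f(1), of j] hom(1) j by auto
    then have "hom_comp (P n) M j f \<in> B n" by simp
    then show ?case using f unfolding Zd_def by blast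
  next
    case (add X Y)
    then obtain f g where f: "f \<in> Z n" "X = cls n f" "hom_comp (P n) M j f \<in> B n"
      and g: "g \<in> Z n" "Y = cls n g" "hom_comp (P n) M j g \<in> B n" by blast
    have "hom_comp (P n) M j (f \<oplus>\<^bsub>C n\<^esub> g) \<in> B n"
      using hom_comp_cochain_add[OF f(1) g(1)] f(3) g(3) by simp
    then show ?case using f g cls_add[OF f(1) g(1)] Q.Z.a_closed[OF f(1) g(1)] by auto
  qed (use D_closed in blast)
  then obtain f where f: "f \<in> Z n" "X = cls n f" "hom_comp (P n) M j f \<in> B n" by blast
  obtain g where g: "g \<in> Zd n j" "X = cls n g" using X(2) unfolding D_eq by blast
  have gZ: "g \<in> Z n" using g(1) by (simp add: Zd_def)
  have b: "g \<ominus>\<^bsub>C n\<^esub> f \<in> B n" using cls_eq_minus[OF gZ f(1)] f(2) g(2) by simp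
  have "g = (g \<ominus>\<^bsub>C n\<^esub> f) \<oplus>\<^bsub>C n\<^esub> f"
    using Z_closed(1)[OF gZ] Z_closed(1)[OF f(1)] by (simp add: a_minus_def C.a_assoc C.l_neg)
  then have "hom_comp (P n) M j g = hom_comp (P n) M j (g \<ominus>\<^bsub>C n\<^esub> f) \<oplus>\<^bsub>C n\<^esub> hom_comp (P n) M j f"
    using hom_comp_cochain_add[OF B_subset[OF b] f(1)] by metis
  also have "\<dots> \<in> B n" by (rule Q.B.a_closed[OF hom_comp_coboundary[OF b] f(3)])
  finally have "g \<in> B n" using hom_comp_Zd[OF g(1), of j] by simp
  then show ?thesis using cls_boundary g(2) by simp
qed

lemma cochain_finsum_apply:
  assumes "finite F" "f \<in> F \<rightarrow> carrier (C n)" "x \<in> carrier (P n)"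
  shows "finsum (C n) f F x = finsum M (\<lambda>i. f i x) F"
proof (rule additive_finsum[OF cochains_group M.M.abelian_group_axioms _ assms(2)])
  show "additive (C n) M (\<lambda>f. f x)"
    unfolding additive_def using assms(3) rmod_homD(1) by (auto simp: cochains_iff cochains_ops(2))
qed

lemma E_sum_of_degrees:
  assumes "X \<in> carrier (E n)"
  shows "X \<in> internal_sum (E n) UNIV (ext_degree R M A n)"
proof -
  obtain f where f: "f \<in> Z n" "X = cls n f" using assms E_cases by metis
  obtain F where F: "finite F" "\<forall>x\<in>carrier (P n). f x = finsum M (\<lambda>i. hom_comp (P n) M i f x) F"
    using finitely_generated_hom_finite_sum[OF AD(1) M R_graded Z_closed(2)[OF f(1)] AD(3)] by blast
  let ?g = "\<lambda>i. hom_comp (P n) M i f"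
  have g: "?g i \<in> Zd n i" for i by (rule hom_comp_cocycle[OF f(1)])
  have gc: "?g \<in> F \<rightarrow> carrier (C n)" using g Z_closed unfolding Zd_def by blast
  have "f = finsum (C n) ?g F"
    by (rule cochain_eqI[OF Z_closed(1)[OF f(1)] C.finsum_closed[OF gc]])
      (use F cochain_finsum_apply[OF F(1) gc] in auto)
  then have "f \<in> internal_sum (C n) UNIV (Zd n)" unfolding internal_sum_def using g F(1) by blast
  \<comment> \<open>Membership in \<open>Z n\<close> is carried through the induction because
    \<open>cls_add\<close> asks both summands to be cocycles.\<close>
  then have "f \<in> Z n \<and> cls n f \<in> internal_sum (E n) UNIV (ext_degree R M A n)"
  proof (induction rule: C.internal_sum_induct)
    interpret S: additive_subgroup "internal_sum (E n) UNIV (ext_degree R M A n)" "E n"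
      by (rule E.additive_subgroup_internal_sum[OF D_subgroup])
    case zero
    have "\<zero>\<^bsub>C n\<^esub> \<in> B n" by simp
    then show ?case using cls_boundary by simp
  next
    interpret S: additive_subgroup "internal_sum (E n) UNIV (ext_degree R M A n)" "E n"
      by (rule E.additive_subgroup_internal_sum[OF D_subgroup])
    case (add f g)
    then show ?case using S.a_closed by (simp flip: cls_add)
  next
    case (hom i f)
    then have "cls n f \<in> D n i" unfolding D_eq by blast
    then show ?case using hom D_closed by (auto simp: Zd_def intro: E.internal_sum_incl)
  next
    case (sub i)
    show ?case using Z_closed unfolding Zd_def by blast
  qed
  then show ?thesis using f(2) by simp
qed

text \<open>For a linear resolution \<open>L\<close> of \<open>M\<close> the composite of comparison maps from the given resolution
  to \<open>L\<close> and back lifts the identity of \<open>M\<close>, so it acts trivially on Ext; and there are no nonzero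
  homomorphisms of degree \<open>i < - n\<close> from the \<open>n\<close>-th term of \<open>L\<close> to \<open>M\<close>.\<close>

lemma D_vanish:
  assumes lin: "linear_module R M" and i: "i < - int n" and X: "X \<in> D n i"
  shows "X = \<zero>\<^bsub>E n\<^esub>"
proof -
  obtain L :: "('r, nat \<Rightarrow> 'r, 'm) resolution" where L: "gr_proj_resolution R M L"
    "\<And>n. generated_in_degree R (res_mod L n) (int n)" and gen: "generated_in_degree R M 0"
    using lin unfolding linear_module_def by blast
  note LD = resolutionD[OF L(1)]
  interpret AL: comparison R "\<lambda>k. P k" "\<lambda>k. d k" M L
    by (intro comparison.intro) (rule R_graded M AD L(1) resolution_complex(2)[OF A] | assumption)+
  interpret LA: comparison R "\<lambda>k. res_mod L k" "\<lambda>k. res_diff L k" M A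
    by (intro comparison.intro) (rule R_graded M LD A resolution_complex(2)[OF L(1)] | assumption)+
  obtain \<phi> where \<phi>: "\<forall>k. \<phi> k \<in> rmod_hom R (P k) (res_mod L k)"
    "\<forall>x\<in>carrier (P 0). res_aug L (\<phi> 0 x) = res_aug A x"
    "\<forall>k. \<forall>x\<in>carrier (P (Suc k)). res_diff L k (\<phi> (Suc k) x) = \<phi> k (d k x)"
    using AL.chain_map_exists[OF AD(6) resolution_complex(1)[OF A]] by blast
  \<comment> \<open>\<open>\<psi>\<close> is chosen of degree 0, so that \<open>f\<close> after
    \<open>\<psi> n\<close> still has degree \<open>i\<close> on the linear term.\<close>
  obtain \<psi> where \<psi>: "\<forall>k. \<psi> k \<in> rmod_hom R (res_mod L k) (P k)"
    "\<forall>x\<in>carrier (res_mod L 0). res_aug A (\<psi> 0 x) = res_aug L x"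
    "\<forall>k. \<forall>x\<in>carrier (res_mod L (Suc k)). d k (\<psi> (Suc k) x) = \<psi> k (res_diff L k x)"
    "\<forall>k. has_degree (res_mod L k) (P k) 0 (\<psi> k)"
    using LA.chain_map_exists[OF LD(6) resolution_complex(1)[OF L(1)], of 0] LD(7) by blast
  let ?G = "\<lambda>k x. \<psi> k (\<phi> k x)"
  have \<phi>c: "\<phi> k x \<in> carrier (res_mod L k)" if "x \<in> carrier (P k)" for k x
    by (rule rmod_homD(1)[OF spec[OF \<phi>(1)] that])
  have G: "?G \<in> Lf 0 aug"
  proof (rule liftsI)
    show "?G k \<in> rmod_hom R (P (k + 0)) (P k)" for k 
      using rmod_hom_comp[OF spec[OF \<phi>(1)] spec[OF \<psi>(1)]] by simp
    show "res_aug A (?G 0 x) = aug x" if "x \<in> carrier (P 0)" for x using that \<phi>(2) \<psi>(2) \<phi>c by simp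
    show "d k (?G (Suc k) x) = ?G k (d (k + 0) x)" if "x \<in> carrier (P (Suc (k + 0)))" for k x
      using that \<phi>(3) \<psi>(3) \<phi>c by simp
  qed
  obtain f where f: "f \<in> Z n" "X = cls n f" "has_degree (P n) M i f"
    using X unfolding ext_degree_def by blast
  interpret gL: graded_group "res_mod L n" "mcomp (res_mod L n)" by (rule graded_module_group(1)[OF LD(1)])
  have R_ag: "abelian_group R" by (rule M.R.abelian_group_axioms)
  have f\<psi>: "(\<lambda>x. f (\<psi> n x)) \<in> rmod_hom R (res_mod L n) M"
    by (rule rmod_hom_comp[OF spec[OF \<psi>(1)] Z_closed(2)[OF f(1)]])
  have "f (\<psi> n x) = \<zero>\<^bsub>M\<^esub>" if "x \<in> carrier (res_mod L n)" for x
  proof (rule generated_in_degree_hom_zero[OF graded_module_group(2)[OF LD(1)] rmM f\<psi> L(2) _ _ that])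
    \<comment> \<open>A generator of degree \<open>n\<close> is sent to degree
      \<open>i + int n\<close>, which is negative by the bound on \<open>i\<close>; \<open>M\<close>
      is zero there since it is generated in degree 0.\<close>
    fix x assume "x \<in> mcomp (res_mod L n) (int n)"
    then have "\<psi> n x \<in> mcomp (P n) (int n)" using \<psi>(4) unfolding has_degree_def by fastforce
    then have "f (\<psi> n x) \<in> mcomp M (i + int n)" using f(3) unfolding has_degree_def by blast
    then show "f (\<psi> n x) = \<zero>\<^bsub>M\<^esub>"
      using generated_in_degree_lower_zero[OF M R_graded R_ag gen, of "i + int n"] i by auto
  qed (use gL.comp_closed in blast)
  then have "cmp n 0 f ?G = \<zero>\<^bsub>C n\<^esub>"
    using \<phi>c Z_closed(1)[OF cmp_cocycle[OF f(1) G]]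
    by (intro cochain_eqI[of _ n]) (auto simp: cmp_apply cochain_zero_apply)
  moreover have "\<zero>\<^bsub>C n\<^esub> \<in> B n" by simp
  ultimately show ?thesis using yon_unit_right_cmp[OF f(1) G] f(2) cls_boundary by metis
qed

section \<open>Scalar multiplication on classes and on the Ext algebra\<close>

lemma smult_cochain:
  assumes a: "a \<in> carrier K" and f: "f \<in> carrier (C n)"
  shows "a \<odot>\<^bsub>C n\<^esub> f \<in> carrier (C n)"
proof -
  let ?c = "a \<odot>\<^bsub>R\<^esub> \<one>\<^bsub>R\<^esub>"
  note c = graded_algebra.scalar_central[OF R a]
  have f': "f \<in> rmod_hom R (P n) M" using f by (simp add: cochains_iff)
  have "(\<lambda>x. f x \<triangleleft>\<^bsub>M\<^esub> ?c) \<in> rmod_hom R (P n) M"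
  proof (rule rmod_homI)
    fix x r assume x: "x \<in> carrier (P n)" and r: "r \<in> carrier R"
    have fx: "f x \<in> carrier M" using rmod_homD(1)[OF f' x] .
    show "f (x \<triangleleft>\<^bsub>P n\<^esub> r) \<triangleleft>\<^bsub>M\<^esub> ?c = f x \<triangleleft>\<^bsub>M\<^esub> ?c \<triangleleft>\<^bsub>M\<^esub> r"
      using rmod_homD(3)[OF f' x r] M.act_assoc[OF fx r c(2)] M.act_assoc[OF fx c(2) r] c(3)[OF r] by simp
  qed (use rmod_homD[OF f'] M.act_closed M.act_add_left c(2) in auto)
  then show ?thesis unfolding cochains_ops by (rule restrict_cochain)
qed

lemma smult_cochain_add:
  assumes a: "a \<in> carrier K" and "f \<in> carrier (C n)" "g \<in> carrier (C n)"
  shows "a \<odot>\<^bsub>C n\<^esub> (f \<oplus>\<^bsub>C n\<^esub> g) = a \<odot>\<^bsub>C n\<^esub> f \<oplus>\<^bsub>C n\<^esub> a \<odot>\<^bsub>C n\<^esub> g"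
proof -
  have "f \<in> rmod_hom R (P n) M" "g \<in> rmod_hom R (P n) M" using assms by (auto simp: cochains_iff)
  from this[THEN rmod_homD(1)] show ?thesis
    unfolding cochains_ops using M.act_add_left graded_algebra.scalar_central(2)[OF R a]
    by (auto intro!: restrict_ext)
qed

lemma smult_cocycle:
  assumes a: "a \<in> carrier K" and f: "f \<in> Z n"
  shows "a \<odot>\<^bsub>C n\<^esub> f \<in> Z n"
  using smult_cochain[OF a Z_closed(1)[OF f]] f M.act_zero_left graded_algebra.scalar_central(2)[OF R a]
    rmod_homD(1)[OF AD(4)]
  unfolding cocycles_iff by (auto simp: cochains_ops(3))

lemma smult_coboundary:
  assumes a: "a \<in> carrier K" and b: "b \<in> B n"
  shows "a \<odot>\<^bsub>C n\<^esub> b \<in> B n"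
proof (cases n)
  case 0
  then have "b = \<zero>\<^bsub>C n\<^esub>" using b coboundaries_0 by simp
  then have "a \<odot>\<^bsub>C n\<^esub> b = \<zero>\<^bsub>C n\<^esub>"
    using M.act_zero_left graded_algebra.scalar_central(2)[OF R a] by (auto simp: cochains_ops intro!: restrict_ext)
  then show ?thesis by simp
next
  case (Suc m)
  then obtain u where u: "u \<in> carrier (C m)" "b = \<delta> m u" using b coboundaries_Suc by auto
  have "a \<odot>\<^bsub>C n\<^esub> b = \<delta> m (a \<odot>\<^bsub>C m\<^esub> u)"
    using u Suc rmod_homD(1)[OF AD(4)] by (auto simp: cochains_ops \<delta>_def intro!: restrict_ext)
  then show ?thesis using smult_cochain[OF a u(1)] Suc coboundaries_Suc by simp
qed

lemma smult_cls:
  assumes a: "a \<in> carrier K" and f: "f \<in> Z n"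
  shows "a \<odot>\<^bsub>E n\<^esub> cls n f = cls n (a \<odot>\<^bsub>C n\<^esub> f)"
  unfolding E_eq ext_class_def
  by (rule Q.quot_smult[OF smult_cochain[OF a] smult_cochain_add[OF a] smult_coboundary[OF a] Z_closed(1)[OF f]])

lemma smult_additive:
  assumes a: "a \<in> carrier K"
  shows "additive (E n) (E n) (\<lambda>X. a \<odot>\<^bsub>E n\<^esub> X)"
  unfolding additive_def
proof (intro conjI Pi_I ballI)
  fix X assume "X \<in> carrier (E n)"
  then obtain f where f: "f \<in> Z n" "X = cls n f" using E_cases by metis
  then show "a \<odot>\<^bsub>E n\<^esub> X \<in> carrier (E n)" using smult_cls[OF a] smult_cocycle[OF a] cls_closed by simp
next
  fix X Y assume "X \<in> carrier (E n)" "Y \<in> carrier (E n)"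
  then obtain f g where f: "f \<in> Z n" "X = cls n f" and g: "g \<in> Z n" "Y = cls n g" using E_cases by metis
  then show "a \<odot>\<^bsub>E n\<^esub> (X \<oplus>\<^bsub>E n\<^esub> Y) = a \<odot>\<^bsub>E n\<^esub> X \<oplus>\<^bsub>E n\<^esub> a \<odot>\<^bsub>E n\<^esub> Y"
    using smult_cls[OF a] smult_cocycle[OF a] smult_cochain_add[OF a] Z_closed(1)
    by (simp add: cls_add)
qed

lemma smult_D:
  assumes a: "a \<in> carrier K" and X: "X \<in> D n i"
  shows "a \<odot>\<^bsub>E n\<^esub> X \<in> D n i"
proof -
  obtain f where f: "f \<in> Z n" "X = cls n f" "has_degree (P n) M i f"
    using X unfolding ext_degree_def by blast
  have "has_degree (P n) M i (a \<odot>\<^bsub>C n\<^esub> f)"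
    unfolding has_degree_def
  proof (intro allI image_subsetI)
    fix k x assume x: "x \<in> mcomp (P n) k"
    then have "f x \<in> mcomp M (i + k)" using f(3) unfolding has_degree_def by blast
    from M.mcomp_act[OF this graded_algebra.scalar_central(1)[OF R a]]
    show "(a \<odot>\<^bsub>C n\<^esub> f) x \<in> mcomp M (i + k)" using gP.comp_closed[OF x] by (simp add: cochains_ops)
  qed
  then show ?thesis
    unfolding ext_degree_def using f smult_cls[OF a f(1)] smult_cocycle[OF a f(1)] by blast
qed

lemma smult_internal_sum:
  assumes a: "a \<in> carrier K" and X: "X \<in> internal_sum (E n) J (ext_degree R M A n)"
  shows "a \<odot>\<^bsub>E n\<^esub> X \<in> internal_sum (E n) J (ext_degree R M A n)"
  using X
proof (induction rule: E.internal_sum_induct)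
  interpret S: additive_subgroup "internal_sum (E n) J (ext_degree R M A n)" "E n"
    by (rule E.additive_subgroup_internal_sum[OF D_subgroup])
  case zero
  show ?case using additive_zero[OF E_group E_group smult_additive[OF a]] by simp
next
  interpret S: additive_subgroup "internal_sum (E n) J (ext_degree R M A n)" "E n"
    by (rule E.additive_subgroup_internal_sum[OF D_subgroup])
  case (add X Y)
  then show ?case using additiveD(2)[OF smult_additive[OF a]] by simp
next
  case (hom i X)
  show ?case
    by (rule E.internal_sum_incl[OF hom(1)]) (use smult_D[OF a hom(2)] D_closed in blast)+
qed (use D_closed in blast)

abbreviation "Ext \<equiv> ext_algebra R M A"

lemma componentwise_submodule:
  assumes S: "\<And>n. additive_subgroup (S n) (E n)"
    and smult: "\<And>a n X. \<lbrakk>a \<in> carrier K; X \<in> S n\<rbrakk> \<Longrightarrow> a \<odot>\<^bsub>E n\<^esub> X \<in> S n"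
  shows "submodule {x \<in> carrier Ext. \<forall>n. x n \<in> S n} K Ext"
proof (intro submodule.intro submodule_axioms.intro)
  show "subgroup {x \<in> carrier Ext. \<forall>n. x n \<in> S n} (add_monoid Ext)"
    using additive_subgroup.a_subgroup[OF componentwise_subgroup[OF S]] .
  fix a x assume a: "a \<in> carrier K" and x: "x \<in> {x \<in> carrier Ext. \<forall>n. x n \<in> S n}"
  have z: "a \<odot>\<^bsub>E n\<^esub> \<zero>\<^bsub>E n\<^esub> = \<zero>\<^bsub>E n\<^esub>" for n
    by (rule additive_zero[OF E_group E_group smult_additive[OF a]])
  have "{n. a \<odot>\<^bsub>E n\<^esub> x n \<noteq> \<zero>\<^bsub>E n\<^esub>} \<subseteq> {n. x n \<noteq> \<zero>\<^bsub>E n\<^esub>}" using z by auto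
  then have "finite {n. a \<odot>\<^bsub>E n\<^esub> x n \<noteq> \<zero>\<^bsub>E n\<^esub>}"
    by (rule finite_subset) (use x in \<open>simp add: X_carrier\<close>)
  moreover have "a \<odot>\<^bsub>E n\<^esub> x n \<in> carrier (E n)" for n
    using additiveD(1)[OF smult_additive[OF a]] x X_closed by blast
  moreover have "a \<odot>\<^bsub>Ext\<^esub> x = (\<lambda>n. a \<odot>\<^bsub>E n\<^esub> x n)" by (simp add: ext_algebra_def)
  ultimately show "a \<odot>\<^bsub>Ext\<^esub> x \<in> {x \<in> carrier Ext. \<forall>n. x n \<in> S n}"
    using smult[OF a] x by (simp add: X_carrier)
qed

section \<open>The decomposition and the ideal property\<close>

abbreviation "off n \<equiv> internal_sum (E n) {- int n<..} (ext_degree R M A n)"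

lemma off_subgroup: "additive_subgroup (off n) (E n)"
  by (rule E.additive_subgroup_internal_sum[OF D_subgroup])

lemma off_closed: "X \<in> off n \<Longrightarrow> X \<in> carrier (E n)"
  using additive_subgroup.a_subset[OF off_subgroup] by blast

text \<open>For a class of a single degree, one of the two summands can be taken to be zero, and
  both if the degree is below \<open>- int n\<close>; sums are then regrouped.\<close>

lemma E_decomposition:
  assumes lin: "linear_module R M" and X: "X \<in> carrier (E n)"
  shows "\<exists>Y\<in>D n (- int n). \<exists>W\<in>off n. X = Y \<oplus>\<^bsub>E n\<^esub> W"
  using E_sum_of_degrees[OF X]
proof (induction rule: E.internal_sum_induct)
  interpret Y: additive_subgroup "D n (- int n)" "E n" by (rule D_subgroup)
  interpret W: additive_subgroup "off n" "E n" by (rule off_subgroup)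
  {
    case zero
    show ?case by (intro bexI[of _ "\<zero>\<^bsub>E n\<^esub>"]) auto
  next
    case (add X X')
    then obtain Y W Y' W' where Y: "Y \<in> D n (- int n)" "Y' \<in> D n (- int n)"
      and W: "W \<in> off n" "W' \<in> off n" and eq: "X = Y \<oplus>\<^bsub>E n\<^esub> W" "X' = Y' \<oplus>\<^bsub>E n\<^esub> W'"
      by blast
    have "X \<oplus>\<^bsub>E n\<^esub> X' = (Y \<oplus>\<^bsub>E n\<^esub> Y') \<oplus>\<^bsub>E n\<^esub> (W \<oplus>\<^bsub>E n\<^esub> W')"
      unfolding eq using Y W by (simp add: D_closed off_closed E.a_ac)
    then show ?case using Y.a_closed[OF Y] W.a_closed[OF W] by blast
  next
    case (hom i X)
    have Xc: "X \<in> carrier (E n)" using D_closed[OF hom(2)] .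
    consider "i < - int n" | "i = - int n" | "- int n < i" by linarith
    then show ?case
    proof cases
      case 1
      then show ?thesis using D_vanish[OF lin 1 hom(2)]
        by (intro bexI[of _ "\<zero>\<^bsub>E n\<^esub>"]) auto
    next
      case 2
      then show ?thesis using hom(2) Xc by (intro bexI[of _ X] bexI[of _ "\<zero>\<^bsub>E n\<^esub>"]) auto
    next
      case 3
      then have "X \<in> off n" by (intro E.internal_sum_incl[of i]) (use hom(2) Xc in auto)
      then show ?thesis using Xc by (intro bexI[of _ "\<zero>\<^bsub>E n\<^esub>"] bexI[of _ X]) auto
    qed
  }
qed (use D_closed in blast)

lemma diagonal_eq: "ext_diagonal R M A = {x \<in> carrier Ext. \<forall>n. x n \<in> D n (- int n)}"
  by (simp add: ext_diagonal_def)

lemma off_diagonal_eq: "ext_off_diagonal R M A = {x \<in> carrier Ext. \<forall>n. x n \<in> off n}"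
  by (simp add: ext_off_diagonal_def)

lemma diagonal_plus_off_diagonal:
  assumes lin: "linear_module R M"
  shows "carrier Ext = ext_diagonal R M A <+>\<^bsub>Ext\<^esub> ext_off_diagonal R M A"
proof
  interpret Ext: abelian_group Ext by (rule X_abelian_group)
  show "ext_diagonal R M A <+>\<^bsub>Ext\<^esub> ext_off_diagonal R M A \<subseteq> carrier Ext"
    unfolding set_add_def' diagonal_eq off_diagonal_eq by auto
  show "carrier Ext \<subseteq> ext_diagonal R M A <+>\<^bsub>Ext\<^esub> ext_off_diagonal R M A"
  proof
    fix x assume x: "x \<in> carrier Ext"
    \<comment> \<open>The last clause makes zero decompose into zeros. Without it the components
      chosen for different \<open>n\<close> could fail to have finite support.\<close>
    have "\<exists>Y W. Y \<in> D n (- int n) \<and> W \<in> off n \<and> x n = Y \<oplus>\<^bsub>E n\<^esub> W \<and>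
        (x n = \<zero>\<^bsub>E n\<^esub> \<longrightarrow> Y = \<zero>\<^bsub>E n\<^esub> \<and> W = \<zero>\<^bsub>E n\<^esub>)" for n
    proof (cases "x n = \<zero>\<^bsub>E n\<^esub>")
      case True
      then show ?thesis
        using additive_subgroup.zero_closed[OF D_subgroup] additive_subgroup.zero_closed[OF off_subgroup]
        by (intro exI[of _ "\<zero>\<^bsub>E n\<^esub>"]) simp
    next
      case False
      then show ?thesis using E_decomposition[OF lin X_closed[OF x]] by blast
    qed
    then obtain y w where yw: "\<And>n. y n \<in> D n (- int n)" "\<And>n. w n \<in> off n"
      "\<And>n. x n = y n \<oplus>\<^bsub>E n\<^esub> w n"
      "\<And>n. x n = \<zero>\<^bsub>E n\<^esub> \<Longrightarrow> y n = \<zero>\<^bsub>E n\<^esub> \<and> w n = \<zero>\<^bsub>E n\<^esub>" by metis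
    have fin: "finite {n. x n \<noteq> \<zero>\<^bsub>E n\<^esub>}" using x by (simp add: X_carrier)
    have "finite {n. y n \<noteq> \<zero>\<^bsub>E n\<^esub>}" "finite {n. w n \<noteq> \<zero>\<^bsub>E n\<^esub>}"
      by (rule finite_subset[OF _ fin]; use yw(4) in blast)+
    then have "y \<in> ext_diagonal R M A" "w \<in> ext_off_diagonal R M A"
      unfolding diagonal_eq off_diagonal_eq X_carrier using yw(1,2) D_closed off_closed by blast+
    moreover have "x = y \<oplus>\<^bsub>Ext\<^esub> w" using yw(3) by (auto simp: X_add)
    ultimately show "x \<in> ext_diagonal R M A <+>\<^bsub>Ext\<^esub> ext_off_diagonal R M A"
      unfolding set_add_def' by blast
  qed
qed

lemma diagonal_inter_off_diagonal:
  "ext_diagonal R M A \<inter> ext_off_diagonal R M A = {\<zero>\<^bsub>Ext\<^esub>}"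
proof
  interpret Ext: abelian_group Ext by (rule X_abelian_group)
  show "ext_diagonal R M A \<inter> ext_off_diagonal R M A \<subseteq> {\<zero>\<^bsub>Ext\<^esub>}"
  proof
    fix x assume x: "x \<in> ext_diagonal R M A \<inter> ext_off_diagonal R M A"
    have "x n = \<zero>\<^bsub>E n\<^esub>" for n
      by (rule D_independent[of _ _ "{- int n<..}" "- int n"])
        (use x in \<open>auto simp: diagonal_eq off_diagonal_eq\<close>)
    then show "x \<in> {\<zero>\<^bsub>Ext\<^esub>}" by (auto simp: X_zero)
  qed
  show "{\<zero>\<^bsub>Ext\<^esub>} \<subseteq> ext_diagonal R M A \<inter> ext_off_diagonal R M A"
    unfolding diagonal_eq off_diagonal_eq
    using additive_subgroup.zero_closed[OF componentwise_subgroup[of "\<lambda>n. D n (- int n)", OF D_subgroup]]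
      additive_subgroup.zero_closed[OF componentwise_subgroup[OF off_subgroup]] by blast
qed

lemma off_mult:
  assumes lin: "linear_module R M"
  shows "\<lbrakk>X \<in> off m; Y \<in> carrier (E n)\<rbrakk> \<Longrightarrow> yon m n X Y \<in> off (m + n)"
    and "\<lbrakk>X \<in> carrier (E m); Y \<in> off n\<rbrakk> \<Longrightarrow> yon m n X Y \<in> off (m + n)"
proof -
  \<comment> \<open>No class has parts below the diagonal, so an arbitrary factor lies in the closed
    half-line; a strict bound on the other factor then gives a strict bound on the sum of
    degrees.\<close>
  have ge: "X \<in> internal_sum (E n) {- int n..} (ext_degree R M A n)" if X: "X \<in> carrier (E n)" for X n
  proof -
    interpret S: additive_subgroup "internal_sum (E n) {- int n..} (ext_degree R M A n)" "E n"
      by (rule E.additive_subgroup_internal_sum[OF D_subgroup])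
    obtain Y W where YW: "Y \<in> D n (- int n)" "W \<in> off n" "X = Y \<oplus>\<^bsub>E n\<^esub> W"
      using E_decomposition[OF lin X] by blast
    have "Y \<in> internal_sum (E n) {- int n..} (ext_degree R M A n)"
      using YW(1) D_closed by (intro E.internal_sum_incl[of "- int n"]) auto
    moreover have "{- int n<..} \<subseteq> {- int n..}" by auto
    then have "W \<in> internal_sum (E n) {- int n..} (ext_degree R M A n)"
      using YW(2) E.internal_sum_mono by blast
    ultimately show ?thesis using YW(3) by simp
  qed
  show "\<lbrakk>X \<in> off m; Y \<in> carrier (E n)\<rbrakk> \<Longrightarrow> yon m n X Y \<in> off (m + n)"
    by (rule internal_sum_mult[OF _ ge]) auto
  show "\<lbrakk>X \<in> carrier (E m); Y \<in> off n\<rbrakk> \<Longrightarrow> yon m n X Y \<in> off (m + n)"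
    by (rule internal_sum_mult[OF ge]) auto
qed

end

theorem proposition2p2:
  fixes K :: "'k ring" and R :: "('k, 'r) gr_algebra" and M :: "('r, 'm) gr_module"
    and A :: "('r, 'p, 'm) resolution"
  assumes "koszul_algebra K R"
    and "linear_module R M"
    and "minimal_gr_proj_resolution R M A"
  shows "submodule (ext_diagonal R M A) K (ext_algebra R M A) \<and>
         submodule (ext_off_diagonal R M A) K (ext_algebra R M A) \<and>
         carrier (ext_algebra R M A) =
           ext_diagonal R M A <+>\<^bsub>ext_algebra R M A\<^esub> ext_off_diagonal R M A \<and>
         ext_diagonal R M A \<inter> ext_off_diagonal R M A = {\<zero>\<^bsub>ext_algebra R M A\<^esub>} \<and>
         ideal (ext_off_diagonal R M A) (ext_algebra R M A)"
proof -
  interpret ext_setup K R M A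
  proof (rule ext_setup.intro)
    show "graded_algebra K R" using assms(1) unfolding koszul_algebra_def by blast
    show "graded_module R M" using assms(2) unfolding linear_module_def by blast
    show "gr_proj_resolution R M A" using assms(3) unfolding minimal_gr_proj_resolution_def by blast
  qed
  have "submodule (ext_diagonal R M A) K Ext"
    unfolding diagonal_eq by (rule componentwise_submodule[of "\<lambda>n. D n (- int n)", OF D_subgroup smult_D])
  moreover have "submodule (ext_off_diagonal R M A) K Ext"
    unfolding off_diagonal_eq by (rule componentwise_submodule[OF off_subgroup smult_internal_sum])
  moreover have "ideal (ext_off_diagonal R M A) Ext"
    unfolding off_diagonal_eq by (rule componentwise_ideal[OF off_subgroup off_mult[OF assms(2)]])
  ultimately show ?thesis
    using diagonal_plus_off_diagonal[OF assms(2)] diagonal_inter_off_diagonal by blast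
qed

end
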